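(* Let $\mathbf p\in\mathbb Z^2\setminus\{0\}$, $\Gamma\in\mathbb C\setminus\{0\}$, and let $L$ be the associated linearized 2D Euler operator on $\ell^2(\mathbb Z^2)$, with components $L_{\mathbf q}$ on $\ell^2(\mathbb Z)$, $\mathbf q\in Q$. Then: (a) For each $\mathbf q\in Q$, $$\sigma_{\mathrm{ess}}(L_{\mathbf q})=\sigma(V\beta-V^*\overline\beta)=i[-2|\beta|,2|\beta|],\qquad \beta=\beta(\mathbf q).$$ (b) $\sigma(L)=\bigcup_{\mathbf q\in Q}\sigma(L_{\mathbf q})$. (c) $\sigma_{\mathrm{ess}}(L)=i\mathbb R$, and $$\sigma_p(L)\setminus i\mathbb R=\bigcup_{\mathbf q\in Q,\ \|\mathbf q\|\le\|\mathbf p\|}\bigl(\sigma_p(L_{\mathbf q})\setminus i\mathbb R\bigr)$$ is a bounded set with accumulation points only on $i\mathbb R$.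
   Context: Notation: $\|\cdot\|$ is the Euclidean norm on $\mathbb R^2$, $\mathbf p=(p_1,p_2)$, $\mathbf q=(q_1,q_2)$, etc. For $\mathbf a,\mathbf b\in\mathbb Z^2$ set $$A(\mathbf a,\mathbf b)=\frac12\left[\frac1{\|\mathbf a\|^2}-\frac1{\|\mathbf b\|^2}\right](a_1b_2-a_2b_1)\quad\text{if }\mathbf a\ne\pm\mathbf b,\ \mathbf a\neq0,\ \mathbf b\ne0,$$ and $A(\mathbf a,\mathbf b)=0$ otherwise; $A$ is symmetric in its arguments. The linearized 2D Euler operator (linearization, in Fourier variables, of the vorticity equation about the steady state whose only nonzero Fourier modes are $\omega^0_{\mathbf p}=\frac12\Gamma$, $\omega^0_{-\mathbf p}=\frac12\overline\Gamma$) is the operator on the space $\ell^2(\mathbb Z^2)$ of complex sequences $$L:(\omega_{\mathbf k})_{\mathbf k\in\mathbb Z^2}\mapsto\bigl(A(\mathbf p,\mathbf k-\mathbf p)\Gamma\omega_{\mathbf k-\mathbf p}+A(-\mathbf p,\mathbf k+\mathbf p)\overline\Gamma\omega_{\mathbf k+\mathbf p}\bigr)_{\mathbf k\in\mathbb Z^2},$$ with domain the set of all $\omega\in\ell^2(\mathbb Z^2)$ such that $L\omega\in\ell^2(\mathbb Z^2)$. For $\mathbf q\in\mathbb Z^2$ let $\Sigma_{\mathbf q}=\{\mathbf q+n\mathbf p: n\in\mathbb Z\}$, and let $\widehat{\mathbf q}(\mathbf q)$ be the element of $\Sigma_{\mathbf q}$ of minimal norm; if there are two such elements $\mathbf q+n\mathbf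 p$, the one with the larger $n$ is taken. Set $Q=\{\widehat{\mathbf q}(\mathbf q):\mathbf q\in\mathbb Z^2\}$. The sets $\Sigma_{\mathbf q}$, $\mathbf q\in Q$, partition $\mathbb Z^2$, and identifying sequences supported on $\Sigma_{\mathbf q}$ with sequences on $\mathbb Z$ via $\omega_n=\omega_{\mathbf q+n\mathbf p}$ one has $L=\bigoplus_{\mathbf q\in Q}L_{\mathbf q}$, where $L_{\mathbf q}$ is the bounded operator on $\ell^2(\mathbb Z)$ $$L_{\mathbf q}=VD-V^*D^*,\quad V:(\omega_n)\mapsto(\omega_{n-1}),\quad D:(\omega_n)\mapsto(A(\mathbf q+n\mathbf p,\mathbf p)\Gamma\omega_n).$$ Further, $\beta(\mathbf q)=-\frac{1}{2\|\mathbf p\|^2}(q_1p_2-q_2p_1)\Gamma$. $\sigma(\cdot)$ is the spectrum, $\sigma_p(\cdot)$ the point spectrum (set of eigenvalues), and $\sigma_{\mathrm{ess}}(\cdot)$ the essential spectrum, i.e. the spectrum with the isolated eigenvalues of finite algebraic multiplicity removed. *)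

theory Defs
  imports "HOL-Complex_Analysis.Complex_Analysis" "HOL-Library.Function_Algebras"
begin

section \<open>Operators on square-summable sequences\<close>

text \<open>
  Sequences are plain functions \<open>'i \<Rightarrow> complex\<close>. A (possibly unbounded) operator is given by
  its domain \<open>D \<subseteq> ell2\<close> together with a map \<open>T\<close>, whose values outside \<open>D\<close> are irrelevant.
\<close>

definition ell2 :: "('i \<Rightarrow> complex) set"
  where "ell2 = {f. (\<lambda>i. (cmod (f i))\<^sup>2) summable_on UNIV}"

definition ell2_norm :: "('i \<Rightarrow> complex) \<Rightarrow> real"
  where "ell2_norm f = sqrt (\<Sum>\<^sub>\<infinity>i. (cmod (f i))\<^sup>2)"

definition ell2_inner :: "('i \<Rightarrow> complex) \<Rightarrow> ('i \<Rightarrow> complex) \<Rightarrow> complex"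
  where "ell2_inner f g = (\<Sum>\<^sub>\<infinity>i. f i * cnj (g i))"

text \<open>The Hilbert space adjoint of a bounded operator (meaningful for arguments in \<open>ell2\<close>).\<close>

definition ell2_adjoint ::
    "(('i \<Rightarrow> complex) \<Rightarrow> ('i \<Rightarrow> complex)) \<Rightarrow> ('i \<Rightarrow> complex) \<Rightarrow> ('i \<Rightarrow> complex)"
  where "ell2_adjoint T g =
    (THE h. h \<in> ell2 \<and> (\<forall>f\<in>ell2. ell2_inner (T f) g = ell2_inner f h))"

definition cscale :: "complex \<Rightarrow> ('i \<Rightarrow> complex) \<Rightarrow> ('i \<Rightarrow> complex)"
  where "cscale c f = (\<lambda>i. c * f i)"

global_interpretation cfun: vector_space "cscale :: complex \<Rightarrow> ('i \<Rightarrow> complex) \<Rightarrow> _"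
  by unfold_locales (auto simp: cscale_def fun_eq_iff algebra_simps)

definition finite_dim :: "('i \<Rightarrow> complex) set \<Rightarrow> bool"
  where "finite_dim S \<longleftrightarrow> (\<exists>B. finite B \<and> S \<subseteq> cfun.span B)"

definition pencil ::
    "(('i \<Rightarrow> complex) \<Rightarrow> ('i \<Rightarrow> complex)) \<Rightarrow> complex \<Rightarrow> ('i \<Rightarrow> complex) \<Rightarrow> ('i \<Rightarrow> complex)"
  where "pencil T z f = (\<lambda>i. z * f i - T f i)"

text \<open>\<open>z\<close> is in the resolvent set iff \<open>z - T : D \<rightarrow> ell2\<close> is a bijection with bounded inverse.\<close>

definition resolvent_set ::
    "('i \<Rightarrow> complex) set \<Rightarrow> (('i \<Rightarrow> complex) \<Rightarrow> ('i \<Rightarrow> complex)) \<Rightarrow> complex set"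
  where "resolvent_set D T =
    {z. bij_betw (pencil T z) D ell2 \<and>
        (\<exists>C. \<forall>f\<in>D. ell2_norm f \<le> C * ell2_norm (pencil T z f))}"

definition resolvent ::
    "('i \<Rightarrow> complex) set \<Rightarrow> (('i \<Rightarrow> complex) \<Rightarrow> ('i \<Rightarrow> complex)) \<Rightarrow> complex
      \<Rightarrow> ('i \<Rightarrow> complex) \<Rightarrow> ('i \<Rightarrow> complex)"
  where "resolvent D T z = inv_into D (pencil T z)"

definition spectrum ::
    "('i \<Rightarrow> complex) set \<Rightarrow> (('i \<Rightarrow> complex) \<Rightarrow> ('i \<Rightarrow> complex)) \<Rightarrow> complex set"
  where "spectrum D T = - resolvent_set D T"

definition point_spectrum ::
    "('i \<Rightarrow> complex) set \<Rightarrow> (('i \<Rightarrow> complex) \<Rightarrow> ('i \<Rightarrow> complex)) \<Rightarrow> complex set"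
  where "point_spectrum D T = {z. \<exists>f\<in>D. f \<noteq> 0 \<and> T f = cscale z f}"

text \<open>
  The Riesz projection \<open>(1/2\<pi>i) \<ointegral> (z - T)\<^sup>-\<^sup>1 dz\<close> over the circle of radius \<open>r\<close> around \<open>z0\<close>.
  The resolvent is norm-analytic on the resolvent set, so the Banach-space valued integral
  can be computed coordinatewise.
\<close>

definition riesz_projection ::
    "('i \<Rightarrow> complex) set \<Rightarrow> (('i \<Rightarrow> complex) \<Rightarrow> ('i \<Rightarrow> complex)) \<Rightarrow> complex \<Rightarrow> real
      \<Rightarrow> ('i \<Rightarrow> complex) \<Rightarrow> ('i \<Rightarrow> complex)"
  where "riesz_projection D T z0 r f =
    (\<lambda>i. contour_integral (circlepath z0 r) (\<lambda>z. resolvent D T z f i) / (2 * of_real pi * \<i>))"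

text \<open>
  The isolated eigenvalues of finite algebraic multiplicity, the latter being the dimension
  of the range of the Riesz projection. The projection does not depend on the
  radius \<open>r\<close> as long as the closed disc meets the spectrum only in its centre.
\<close>

definition discrete_spectrum ::
    "('i \<Rightarrow> complex) set \<Rightarrow> (('i \<Rightarrow> complex) \<Rightarrow> ('i \<Rightarrow> complex)) \<Rightarrow> complex set"
  where "discrete_spectrum D T =
    {z0 \<in> point_spectrum D T.
      \<exists>r>0. spectrum D T \<inter> cball z0 r = {z0} \<and> finite_dim (riesz_projection D T z0 r ` ell2)}"

definition ess_spectrum ::
    "('i \<Rightarrow> complex) set \<Rightarrow> (('i \<Rightarrow> complex) \<Rightarrow> ('i \<Rightarrow> complex)) \<Rightarrow> complex set"
  where "ess_spectrum D T = spectrum D T - discrete_spectrum D T"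

section \<open>The linearized Euler operator\<close>

definition znorm :: "int \<times> int \<Rightarrow> real"
  where "znorm a = norm (real_of_int (fst a), real_of_int (snd a))"

definition coefA :: "int \<times> int \<Rightarrow> int \<times> int \<Rightarrow> real"
  where "coefA a b =
    (if a \<noteq> b \<and> a \<noteq> - b \<and> a \<noteq> 0 \<and> b \<noteq> 0
     then 1/2 * (1 / (znorm a)\<^sup>2 - 1 / (znorm b)\<^sup>2) * real_of_int (fst a * snd b - snd a * fst b)
     else 0)"

definition euler_L ::
    "int \<times> int \<Rightarrow> complex \<Rightarrow> (int \<times> int \<Rightarrow> complex) \<Rightarrow> (int \<times> int \<Rightarrow> complex)"
  where "euler_L p \<Gamma> \<omega> =
    (\<lambda>k. of_real (coefA p (k - p)) * \<Gamma> * \<omega> (k - p)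
       + of_real (coefA (- p) (k + p)) * cnj \<Gamma> * \<omega> (k + p))"

definition euler_dom :: "int \<times> int \<Rightarrow> complex \<Rightarrow> (int \<times> int \<Rightarrow> complex) set"
  where "euler_dom p \<Gamma> = {\<omega> \<in> ell2. euler_L p \<Gamma> \<omega> \<in> ell2}"

definition line_pt :: "int \<times> int \<Rightarrow> int \<times> int \<Rightarrow> int \<Rightarrow> int \<times> int"
  where "line_pt p q n = (fst q + n * fst p, snd q + n * snd p)"

definition qhat :: "int \<times> int \<Rightarrow> int \<times> int \<Rightarrow> int \<times> int"
  where "qhat p q =
    line_pt p q (GREATEST n. \<forall>m. znorm (line_pt p q n) \<le> znorm (line_pt p q m))"

definition Qset :: "int \<times> int \<Rightarrow> (int \<times> int) set"
  where "Qset p = range (qhat p)"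

definition shiftV :: "(int \<Rightarrow> complex) \<Rightarrow> (int \<Rightarrow> complex)"
  where "shiftV \<omega> = (\<lambda>n. \<omega> (n - 1))"

definition diagD ::
    "int \<times> int \<Rightarrow> complex \<Rightarrow> int \<times> int \<Rightarrow> (int \<Rightarrow> complex) \<Rightarrow> (int \<Rightarrow> complex)"
  where "diagD p \<Gamma> q \<omega> = (\<lambda>n. of_real (coefA (line_pt p q n) p) * \<Gamma> * \<omega> n)"

definition euler_Lq ::
    "int \<times> int \<Rightarrow> complex \<Rightarrow> int \<times> int \<Rightarrow> (int \<Rightarrow> complex) \<Rightarrow> (int \<Rightarrow> complex)"
  where "euler_Lq p \<Gamma> q \<omega> =
    shiftV (diagD p \<Gamma> q \<omega>) - ell2_adjoint shiftV (ell2_adjoint (diagD p \<Gamma> q) \<omega>)"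

definition betaq :: "int \<times> int \<Rightarrow> complex \<Rightarrow> int \<times> int \<Rightarrow> complex"
  where "betaq p \<Gamma> q =
    - of_real (1 / (2 * (znorm p)\<^sup>2) * real_of_int (fst q * snd p - snd q * fst p)) * \<Gamma>"

text \<open>The operator \<open>V \<beta> - V\<^sup>* \<beta>\<close>, with the second \<open>\<beta>\<close> conjugated.\<close>

definition const_op :: "complex \<Rightarrow> (int \<Rightarrow> complex) \<Rightarrow> (int \<Rightarrow> complex)"
  where "const_op \<beta> \<omega> = shiftV (cscale \<beta> \<omega>) - ell2_adjoint shiftV (cscale (cnj \<beta>) \<omega>)"

section \<open>Consistency of the definitions\<close>

lemma ell2_adjoint_eqI:
  assumes h: "h \<in> ell2" and adj: "\<And>f. f \<in> ell2 \<Longrightarrow> ell2_inner (T f) g = ell2_inner f h"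
  shows "ell2_adjoint T g = h"
proof -
  have coord: "ell2_inner (\<lambda>j. if j = i then 1 else 0) k = cnj (k i)" for i :: 'a and k
  proof -
    have "ell2_inner (\<lambda>j. if j = i then 1 else 0) k
        = (\<Sum>\<^sub>\<infinity>j\<in>{i}. (if j = i then 1 else 0) * cnj (k j))"
      unfolding ell2_inner_def by (rule infsum_cong_neutral) auto
    then show ?thesis by simp
  qed
  have e: "(\<lambda>j. if j = i then 1 else 0) \<in> ell2" for i :: 'a
  proof -
    have "(\<lambda>j. (cmod (if j = i then 1 else 0))\<^sup>2) summable_on {i}" by simp
    then have "(\<lambda>j. (cmod (if j = i then 1 else 0))\<^sup>2) summable_on UNIV"
      by (rule summable_on_cong_neutral[THEN iffD1, rotated -1]) auto
    then show ?thesis by (simp add: ell2_def)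
  qed
  show ?thesis
    unfolding ell2_adjoint_def
  proof (rule the_equality)
    show "h \<in> ell2 \<and> (\<forall>f\<in>ell2. ell2_inner (T f) g = ell2_inner f h)"
      using h adj by blast
  next
    fix k assume k: "k \<in> ell2 \<and> (\<forall>f\<in>ell2. ell2_inner (T f) g = ell2_inner f k)"
    have "cnj (k i) = cnj (h i)" for i
      using k adj[OF e[of i]] e[of i] coord[of i k] coord[of i h] by metis
    then show "k = h" by (auto simp: fun_eq_iff)
  qed
qed

lemma ell2_adjoint_shiftV:
  assumes "g \<in> ell2" shows "ell2_adjoint shiftV g = (\<lambda>n. g (n + 1))"
proof (rule ell2_adjoint_eqI)
  have bij: "bij_betw (\<lambda>n::int. n + 1) UNIV UNIV"
    by (rule bij_betwI[where g = "\<lambda>n. n - 1"]) auto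
  show "(\<lambda>n. g (n + 1)) \<in> ell2"
    using assms summable_on_reindex_bij_betw[OF bij, of "\<lambda>n. (cmod (g n))\<^sup>2"]
    by (simp add: ell2_def)
  show "ell2_inner (shiftV f) g = ell2_inner f (\<lambda>n. g (n + 1))" for f
    using infsum_reindex_bij_betw[OF bij, of "\<lambda>n. f (n - 1) * cnj (g n)"]
    by (simp add: ell2_inner_def shiftV_def)
qed

lemma znorm_sq: "(znorm a)\<^sup>2 = real_of_int ((fst a)\<^sup>2 + (snd a)\<^sup>2)"
  by (simp add: znorm_def norm_Pair)

lemma znorm_sq_ge_1: assumes "a \<noteq> 0" shows "(znorm a)\<^sup>2 \<ge> 1"
proof -
  have "(fst a)\<^sup>2 + (snd a)\<^sup>2 > 0"
    using assms by (auto simp: sum_power2_gt_zero_iff prod_eq_iff)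
  then show ?thesis unfolding znorm_sq by linarith
qed

lemma coefA_line_bound:
  "\<bar>coefA (line_pt p q n) p\<bar> \<le> \<bar>real_of_int (fst q * snd p - snd q * fst p)\<bar>"
proof (cases "line_pt p q n = 0 \<or> p = 0")
  case False
  define u v where "u = 1 / (znorm (line_pt p q n))\<^sup>2" and "v = 1 / (znorm p)\<^sup>2"
  have u: "0 \<le> u" "u \<le> 1" and v: "0 \<le> v" "v \<le> 1"
    using znorm_sq_ge_1[of "line_pt p q n"] znorm_sq_ge_1[of p] False
    unfolding u_def v_def by (auto simp: divide_le_eq)
  have cross: "fst (line_pt p q n) * snd p - snd (line_pt p q n) * fst p
      = fst q * snd p - snd q * fst p"
    by (simp add: line_pt_def algebra_simps)
  have "\<bar>1/2 * (u - v)\<bar> \<le> 1" using u v by (simp add: abs_le_iff)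
  then have "\<bar>1/2 * (u - v)\<bar> * \<bar>real_of_int (fst q * snd p - snd q * fst p)\<bar>
      \<le> 1 * \<bar>real_of_int (fst q * snd p - snd q * fst p)\<bar>"
    by (rule mult_right_mono) simp
  then show ?thesis
    unfolding coefA_def cross u_def[symmetric] v_def[symmetric] abs_mult[symmetric] by auto
qed (auto simp: coefA_def)

lemma ell2_adjoint_diagD:
  assumes "g \<in> ell2"
  shows "ell2_adjoint (diagD p \<Gamma> q) g
    = (\<lambda>n. of_real (coefA (line_pt p q n) p) * cnj \<Gamma> * g n)"
proof (rule ell2_adjoint_eqI)
  define c where "c = \<bar>real_of_int (fst q * snd p - snd q * fst p)\<bar>"
  have le: "(cmod (of_real (coefA (line_pt p q n) p) * cnj \<Gamma> * g n))\<^sup>2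
      \<le> (c * cmod \<Gamma>)\<^sup>2 * (cmod (g n))\<^sup>2" for n
  proof -
    have "cmod (of_real (coefA (line_pt p q n) p) * cnj \<Gamma> * g n) \<le> c * cmod \<Gamma> * cmod (g n)"
      using coefA_line_bound[of p q n] by (auto simp: norm_mult c_def intro!: mult_right_mono)
    then have "(cmod (of_real (coefA (line_pt p q n) p) * cnj \<Gamma> * g n))\<^sup>2
        \<le> (c * cmod \<Gamma> * cmod (g n))\<^sup>2"
      by (rule power_mono) simp
    then show ?thesis by (simp add: power_mult_distrib)
  qed
  have "(\<lambda>n. (c * cmod \<Gamma>)\<^sup>2 * (cmod (g n))\<^sup>2) summable_on UNIV"
    using assms by (intro summable_on_cmult_right) (simp add: ell2_def)
  then show "(\<lambda>n. of_real (coefA (line_pt p q n) p) * cnj \<Gamma> * g n) \<in> ell2"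
    unfolding ell2_def mem_Collect_eq
    by (rule summable_on_comparison_test) (use le in auto)
  show "ell2_inner (diagD p \<Gamma> q f) g
      = ell2_inner f (\<lambda>n. of_real (coefA (line_pt p q n) p) * cnj \<Gamma> * g n)" for f
    by (simp add: ell2_inner_def diagD_def mult_ac)
qed

lemma coefA_sym: "coefA a b = coefA b a"
proof -
  have "(a \<noteq> b \<and> a \<noteq> - b \<and> a \<noteq> 0 \<and> b \<noteq> 0) = (b \<noteq> a \<and> b \<noteq> - a \<and> b \<noteq> 0 \<and> a \<noteq> 0)"
    by (metis minus_minus)
  then show ?thesis unfolding coefA_def by (simp add: algebra_simps)
qed

lemma coefA_uminus: "coefA (- a) b = - coefA a b"
proof -
  have "(- a \<noteq> b \<and> - a \<noteq> - b \<and> - a \<noteq> 0 \<and> b \<noteq> 0) = (a \<noteq> b \<and> a \<noteq> - b \<and> a \<noteq> 0 \<and> b \<noteq> 0)"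
    by (metis minus_minus minus_zero)
  moreover have "znorm (- a) = znorm a" by (simp add: znorm_def norm_Pair)
  ultimately show ?thesis unfolding coefA_def by (simp add: algebra_simps)
qed

lemma euler_Lq_apply:
  assumes "\<omega> \<in> ell2"
  shows "euler_Lq p \<Gamma> q \<omega> n
    = of_real (coefA (line_pt p q (n - 1)) p) * \<Gamma> * \<omega> (n - 1)
      - of_real (coefA (line_pt p q (n + 1)) p) * cnj \<Gamma> * \<omega> (n + 1)"
proof -
  have "ell2_adjoint (diagD p \<Gamma> q) \<omega> \<in> ell2"
  proof -
    have "diagD p (cnj \<Gamma>) q \<omega> = ell2_adjoint (diagD p \<Gamma> q) \<omega>"
      using ell2_adjoint_diagD[OF assms] by (simp add: diagD_def)
    moreover define c where "c = \<bar>real_of_int (fst q * snd p - snd q * fst p)\<bar>"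
    have "(\<lambda>n. (c * cmod \<Gamma>)\<^sup>2 * (cmod (\<omega> n))\<^sup>2) summable_on UNIV"
      using assms by (intro summable_on_cmult_right) (simp add: ell2_def)
    then have "diagD p (cnj \<Gamma>) q \<omega> \<in> ell2"
      unfolding ell2_def mem_Collect_eq
    proof (rule summable_on_comparison_test)
      fix n
      have "cmod (diagD p (cnj \<Gamma>) q \<omega> n) \<le> c * cmod \<Gamma> * cmod (\<omega> n)"
        using coefA_line_bound[of p q n]
        by (auto simp: norm_mult c_def diagD_def intro!: mult_right_mono)
      then have "(cmod (diagD p (cnj \<Gamma>) q \<omega> n))\<^sup>2 \<le> (c * cmod \<Gamma> * cmod (\<omega> n))\<^sup>2"
        by (rule power_mono) simp
      then show "(cmod (diagD p (cnj \<Gamma>) q \<omega> n))\<^sup>2 \<le> (c * cmod \<Gamma>)\<^sup>2 * (cmod (\<omega> n))\<^sup>2"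
        by (simp add: power_mult_distrib)
    qed auto
    ultimately show ?thesis by simp
  qed
  then show ?thesis
    by (simp add: euler_Lq_def ell2_adjoint_shiftV ell2_adjoint_diagD[OF assms]
        shiftV_def diagD_def)
qed

text \<open>The components: restricting \<open>L \<omega>\<close> to the line through \<open>q\<close> gives \<open>L\<^sub>q\<close> of the restriction.\<close>

lemma euler_L_line:
  assumes "(\<lambda>n. \<omega> (line_pt p q n)) \<in> ell2"
  shows "euler_L p \<Gamma> \<omega> (line_pt p q n) = euler_Lq p \<Gamma> q (\<lambda>n. \<omega> (line_pt p q n)) n"
proof -
  have "line_pt p q n - p = line_pt p q (n - 1)" "line_pt p q n + p = line_pt p q (n + 1)"
    by (auto simp: line_pt_def prod_eq_iff algebra_simps)
  then show ?thesis
    unfolding euler_Lq_apply[OF assms] euler_L_def by (simp add: coefA_uminus coefA_sym[of p])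
qed

end

theory Submission
  imports Defs
begin

text \<open>
  In the coordinates of a line, \<open>L\<^sub>q\<close> is \<open>K A\<close> with \<open>K = \<gamma> V - cnj \<gamma> V\<^sup>*\<close> skew-adjoint and
  \<open>A\<close> a real diagonal operator whose entries tend to \<open>1/(2\<parallel>p\<parallel>\<^sup>2)\<close> and are positive except at
  the at most two lattice points with \<open>\<parallel>q + n p\<parallel> \<le> \<parallel>p\<parallel>\<close>. If \<open>A\<close> is positive, then \<open>K A\<close> is
  similar to the skew-adjoint operator \<open>A\<^sup>1\<^sup>/\<^sup>2 K A\<^sup>1\<^sup>/\<^sup>2\<close> of norm at most \<open>2\<bar>\<beta>\<bar>\<close>, which places its
  spectrum in the segment \<open>\<i>[-2\<bar>\<beta>\<bar>, 2\<bar>\<beta>\<bar>]\<close> with a resolvent bound that is uniform in \<open>q\<close>. The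
  general case is a perturbation of rank two of the positive one: off the segment the spectrum
  is the zero set of a 2 by 2 perturbation determinant, hence discrete, and Cramer's rule
  shows that the Riesz projections have finite rank. Weyl sequences show that the whole segment
  belongs to the spectrum. As only finitely many \<open>q\<close> have \<open>\<parallel>q\<parallel> \<le> \<parallel>p\<parallel>\<close>, the resolvents of
  the components are uniformly bounded off the imaginary axis, so the direct sum inherits its
  spectrum from the components; and the segments exhaust the axis since \<open>\<bar>\<beta>(q)\<bar>\<close> is unbounded.
\<close>

section \<open>The space of square-summable sequences\<close>

text \<open>Since \<bar>\<beta>(q)\<bar> is unbounded, so is \<open>L\<close>, and the spectrum of
  an infinite direct sum can exceed the union of the component spectra: the resolvents on the lines
  may exist without a common bound. What matters is therefore the condition number of the square
  root of \<open>A\<close>. Put P = \<parallel>p\<parallel> squared. If \<parallel>q\<parallel> >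
  \<parallel>p\<parallel>, all points of the line have an integer squared norm of at least P + 1, so
  the entries of \<open>A\<close> lie between 1/2 (1/P - 1/(P + 1)) and 1/(2P). Their ratio P + 1
  yields the resolvent bound sqrt(P + 1)/\<bar>Re z\<bar>, free of \<open>q\<close> and \<Gamma>. On
  the remaining lines \<open>A\<close> may have zero or negative entries, which rules out the square
  root; resetting two entries to the limit value restores it. The determinant does not vanish
  identically, because the complement of the segment is connected and unbounded while the component
  is bounded. That the segment is essential spectrum follows by accumulation: it has no isolated
  points. This argument breaks down for \<beta> = 0, where the segment is the point 0; there the
  component is zero and its Riesz projection is the identity.\<close>

lemma ell2_normI:
  assumes "\<And>F. finite F \<Longrightarrow> L2_set (\<lambda>i. cmod (f i)) F \<le> B"
  shows "f \<in> ell2" "ell2_norm f \<le> B"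
proof -
  have B: "0 \<le> B" using assms[of "{}"] by simp
  have le: "(\<Sum>i\<in>F. (cmod (f i))\<^sup>2) \<le> B\<^sup>2" if "finite F" for F
    using assms[OF that] real_sqrt_le_iff[of _ "B\<^sup>2"] B by (simp add: L2_set_def)
  have s: "(\<lambda>i. (cmod (f i))\<^sup>2) summable_on UNIV"
    by (rule nonneg_bdd_above_summable_on) (auto intro!: bdd_aboveI2[where M = "B\<^sup>2"] le)
  then show "f \<in> ell2" by (simp add: ell2_def)
  have "(\<Sum>\<^sub>\<infinity>i. (cmod (f i))\<^sup>2) \<le> B\<^sup>2"
    by (rule infsum_le_finite_sums[OF s]) (rule le)
  then show "ell2_norm f \<le> B"
    unfolding ell2_norm_def using B by (simp add: real_le_lsqrt infsum_nonneg)
qed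

lemma ell2_norm_nonneg [simp]: "0 \<le> ell2_norm f"
  by (simp add: ell2_norm_def infsum_nonneg)

lemma ell2_norm_power2: "(ell2_norm f)\<^sup>2 = (\<Sum>\<^sub>\<infinity>i. (cmod (f i))\<^sup>2)"
  by (simp add: ell2_norm_def infsum_nonneg)

lemma L2_set_le_ell2_norm:
  assumes "f \<in> ell2" "finite F"
  shows "L2_set (\<lambda>i. cmod (f i)) F \<le> ell2_norm f"
  unfolding L2_set_def ell2_norm_def
  by (intro real_sqrt_le_mono finite_sum_le_infsum) (use assms in \<open>auto simp: ell2_def\<close>)

lemma cmod_le_ell2_norm: "f \<in> ell2 \<Longrightarrow> cmod (f i) \<le> ell2_norm f"
  using L2_set_le_ell2_norm[of f "{i}"] by simp

lemma ell2_norm_eq_0_iff: "f \<in> ell2 \<Longrightarrow> ell2_norm f = 0 \<longleftrightarrow> f = 0"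
  using cmod_le_ell2_norm[of f] by (auto simp: fun_eq_iff ell2_norm_def)

lemma
  assumes "f \<in> ell2" "g \<in> ell2"
  shows ell2_add: "(\<lambda>i. f i + g i) \<in> ell2"
    and ell2_norm_triangle: "ell2_norm (\<lambda>i. f i + g i) \<le> ell2_norm f + ell2_norm g"
proof -
  have "L2_set (\<lambda>i. cmod (f i + g i)) F \<le> ell2_norm f + ell2_norm g" if "finite F" for F
  proof -
    have "L2_set (\<lambda>i. cmod (f i + g i)) F \<le> L2_set (\<lambda>i. cmod (f i) + cmod (g i)) F"
      by (rule L2_set_mono) (auto intro: norm_triangle_ineq)
    also have "\<dots> \<le> L2_set (\<lambda>i. cmod (f i)) F + L2_set (\<lambda>i. cmod (g i)) F"
      by (rule L2_set_triangle_ineq)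
    also have "\<dots> \<le> ell2_norm f + ell2_norm g"
      by (intro add_mono L2_set_le_ell2_norm assms that)
    finally show ?thesis .
  qed
  from ell2_normI[OF this]
  show "(\<lambda>i. f i + g i) \<in> ell2" "ell2_norm (\<lambda>i. f i + g i) \<le> ell2_norm f + ell2_norm g"
    by auto
qed

lemma
  assumes "f \<in> ell2" "0 \<le> b" "\<And>i. cmod (g i) \<le> b * cmod (f i)"
  shows ell2_dominated: "g \<in> ell2"
    and ell2_norm_dominated: "ell2_norm g \<le> b * ell2_norm f"
proof -
  have "L2_set (\<lambda>i. cmod (g i)) F \<le> b * ell2_norm f" if "finite F" for F
  proof -
    have "L2_set (\<lambda>i. cmod (g i)) F \<le> L2_set (\<lambda>i. b * cmod (f i)) F"
      by (rule L2_set_mono) (use assms in auto)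
    also have "\<dots> = b * L2_set (\<lambda>i. cmod (f i)) F"
      using assms by (simp add: L2_set_right_distrib)
    also have "\<dots> \<le> b * ell2_norm f"
      by (intro mult_left_mono L2_set_le_ell2_norm assms that)
    finally show ?thesis .
  qed
  from ell2_normI[OF this] show "g \<in> ell2" "ell2_norm g \<le> b * ell2_norm f" by auto
qed

lemma ell2_mult_left: "f \<in> ell2 \<Longrightarrow> (\<lambda>i. c * f i) \<in> ell2"
  by (rule ell2_dominated[where b = "cmod c"]) (auto simp: norm_mult)

lemma ell2_norm_mult_left: "ell2_norm (\<lambda>i. c * f i) = cmod c * ell2_norm f"
  by (simp add: ell2_norm_def norm_mult power_mult_distrib infsum_cmult_right' real_sqrt_mult)

lemma ell2_diff: "f \<in> ell2 \<Longrightarrow> g \<in> ell2 \<Longrightarrow> (\<lambda>i. f i - g i) \<in> ell2"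
  using ell2_add[of f "\<lambda>i. - 1 * g i"] ell2_mult_left[of g "-1"] by simp

lemma ell2_norm_diff_triangle:
  assumes "f \<in> ell2" "g \<in> ell2"
  shows "ell2_norm (\<lambda>i. f i - g i) \<le> ell2_norm f + ell2_norm g"
  using ell2_norm_triangle[of f "\<lambda>i. - 1 * g i"] ell2_mult_left[of g "-1"] assms
    ell2_norm_mult_left[of "-1" g] by simp

lemma ell2_zero [simp]: "0 \<in> ell2" "(\<lambda>i. 0) \<in> ell2"
  by (simp_all add: ell2_def)

lemma ell2_norm_zero [simp]: "ell2_norm 0 = 0" "ell2_norm (\<lambda>i. 0) = 0"
  by (simp_all add: ell2_norm_def)

lemma
  assumes "bij \<pi>"
  shows ell2_reindex: "(\<lambda>i. f (\<pi> i)) \<in> ell2 \<longleftrightarrow> f \<in> ell2"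
    and ell2_norm_reindex: "ell2_norm (\<lambda>i. f (\<pi> i)) = ell2_norm f"
  using summable_on_reindex_bij_betw[OF assms, of "\<lambda>i. (cmod (f i))\<^sup>2"]
    infsum_reindex_bij_betw[OF assms, of "\<lambda>i. (cmod (f i))\<^sup>2"]
  by (auto simp: ell2_def ell2_norm_def)

lemma bij_int_plus: "bij (\<lambda>n::int. n + k)"
  by (rule bij_betwI[where g = "\<lambda>n. n - k"]) auto

lemma bij_int_minus: "bij (\<lambda>n::int. n - k)"
  by (rule bij_betwI[where g = "\<lambda>n. n + k"]) auto

lemmas ell2_shift =
  ell2_reindex[OF bij_int_plus] ell2_reindex[OF bij_int_minus]
lemmas ell2_norm_shift =
  ell2_norm_reindex[OF bij_int_plus] ell2_norm_reindex[OF bij_int_minus]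

lemma ell2_finite_support:
  assumes "finite F" "\<And>i. i \<notin> F \<Longrightarrow> f i = 0"
  shows "f \<in> ell2" "(ell2_norm f)\<^sup>2 = (\<Sum>i\<in>F. (cmod (f i))\<^sup>2)"
proof -
  have "(\<lambda>i. (cmod (f i))\<^sup>2) summable_on F" using assms by simp
  then have "(\<lambda>i. (cmod (f i))\<^sup>2) summable_on UNIV"
    by (rule summable_on_cong_neutral[THEN iffD1, rotated -1]) (use assms in auto)
  then show "f \<in> ell2" by (simp add: ell2_def)
  have "(\<Sum>\<^sub>\<infinity>i. (cmod (f i))\<^sup>2) = (\<Sum>\<^sub>\<infinity>i\<in>F. (cmod (f i))\<^sup>2)"
    by (rule infsum_cong_neutral) (use assms in auto)
  then show "(ell2_norm f)\<^sup>2 = (\<Sum>i\<in>F. (cmod (f i))\<^sup>2)"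
    using assms by (simp add: ell2_norm_power2)
qed

text \<open>A Fatou-type substitute for completeness: limits are formed in each coordinate, and the
  uniform bound on finite sections places them in \<open>ell2\<close>.\<close>

lemma ell2_pointwise_limit:
  assumes s: "\<And>n. s n \<in> ell2" "\<And>n. ell2_norm (s n) \<le> B"
    and lim: "\<And>i. (\<lambda>n. s n i) \<longlonglongrightarrow> f i"
  shows "f \<in> ell2" "ell2_norm f \<le> B"
proof -
  have "L2_set (\<lambda>i. cmod (f i)) F \<le> B" if "finite F" for F
  proof (rule LIMSEQ_le_const2)
    show "(\<lambda>n. L2_set (\<lambda>i. cmod (s n i)) F) \<longlonglongrightarrow> L2_set (\<lambda>i. cmod (f i)) F"
      unfolding L2_set_def by (intro tendsto_intros lim)
    show "\<exists>N. \<forall>n\<ge>N. L2_set (\<lambda>i. cmod (s n i)) F \<le> B"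
      using s L2_set_le_ell2_norm[OF _ that] by (meson order_trans)
  qed
  from ell2_normI[OF this] show "f \<in> ell2" "ell2_norm f \<le> B" by auto
qed

text \<open>Linearity on all sequences rather than on \<open>ell2\<close> spares membership
  conditions. \<open>euler_Lq\<close> is defined through adjoints that are meaningful on
  \<open>ell2\<close> only, so it is replaced by an explicit formula before this notion is
  applied.\<close>

definition linear_op :: "(('i \<Rightarrow> complex) \<Rightarrow> ('i \<Rightarrow> complex)) \<Rightarrow> bool"
  where "linear_op A \<longleftrightarrow> (\<forall>f g. A (\<lambda>i. f i + g i) = (\<lambda>i. A f i + A g i)) \<and>
    (\<forall>c f. A (\<lambda>i. c * f i) = (\<lambda>i. c * A f i))"

lemma linear_op_add: "linear_op A \<Longrightarrow> A (\<lambda>i. f i + g i) = (\<lambda>i. A f i + A g i)"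
  and linear_op_scale: "linear_op A \<Longrightarrow> A (\<lambda>i. c * f i) = (\<lambda>i. c * A f i)"
  by (auto simp: linear_op_def)

lemma linear_op_diff: "linear_op A \<Longrightarrow> A (\<lambda>i. f i - g i) = (\<lambda>i. A f i - A g i)"
  using linear_op_add[of A f "\<lambda>i. - 1 * g i"] linear_op_scale[of A "-1" g] by simp

lemma linear_op_zero: "linear_op A \<Longrightarrow> A (\<lambda>i. 0) = (\<lambda>i. 0)"
  using linear_op_scale[of A 0 "\<lambda>i. 0"] by simp

lemma linear_op_sum:
  assumes "linear_op A" "finite K"
  shows "A (\<lambda>i. \<Sum>k\<in>K. u k i) = (\<lambda>i. \<Sum>k\<in>K. A (u k) i)"
  using assms(2)
  by (induction K rule: finite_induct)
    (simp_all add: linear_op_zero[OF assms(1)] linear_op_add[OF assms(1)])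

lemma linear_op_pencil: "linear_op T \<Longrightarrow> linear_op (pencil T z)"
  by (simp add: linear_op_def pencil_def algebra_simps)

text \<open>The solution is the series of \<open>(A ^^ k) g\<close>, summed coordinatewise. As
  \<open>A\<close> is continuous for the norm only, the remainders have to be estimated in norm
  before \<open>A\<close> can be exchanged with the limit.\<close>

lemma ell2_neumann:
  fixes A :: "('i \<Rightarrow> complex) \<Rightarrow> ('i \<Rightarrow> complex)"
  assumes A: "linear_op A" "\<And>f. f \<in> ell2 \<Longrightarrow> A f \<in> ell2"
      "\<And>f. f \<in> ell2 \<Longrightarrow> ell2_norm (A f) \<le> \<kappa> * ell2_norm f"
    and \<kappa>: "0 \<le> \<kappa>" "\<kappa> < 1" and g: "g \<in> ell2"
  obtains f where "f \<in> ell2" "\<And>i. f i = A f i + g i"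
proof -
  define u where "u k = (A ^^ k) g" for k
  define s where "s n = (\<lambda>i. \<Sum>k<n. u k i)" for n
  define f where "f = (\<lambda>i. \<Sum>k. u k i)"
  define B where "B = ell2_norm g / (1 - \<kappa>)"
  have u: "u k \<in> ell2" for k
    unfolding u_def by (induction k) (simp_all add: g A)
  have uSuc: "u (Suc k) = A (u k)" for k by (simp add: u_def)
  have un: "ell2_norm (u k) \<le> \<kappa> ^ k * ell2_norm g" for k
  proof (induction k)
    case (Suc k)
    have "ell2_norm (u (Suc k)) \<le> \<kappa> * ell2_norm (u k)" unfolding uSuc by (rule A(3)[OF u])
    also have "\<dots> \<le> \<kappa> * (\<kappa> ^ k * ell2_norm g)" by (intro mult_left_mono Suc \<kappa>)
    finally show ?case by simp
  qed (simp add: u_def)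
  \<comment> \<open>Blocks of the series are bounded independently of their length:
    \<open>n = 0\<close> bounds the partial sums, large \<open>n\<close> the remainders.\<close>
  have part: "(\<lambda>i. \<Sum>k=n..<m. u k i) \<in> ell2 \<and> ell2_norm (\<lambda>i. \<Sum>k=n..<m. u k i)
      \<le> \<kappa> ^ n * B" for n m
  proof -
    have "(\<lambda>i. \<Sum>k=n..<n+l. u k i) \<in> ell2 \<and>
      ell2_norm (\<lambda>i. \<Sum>k=n..<n+l. u k i) \<le> (\<Sum>k=n..<n+l. \<kappa> ^ k) * ell2_norm g" for l
    proof (induction l)
      case (Suc l)
      have "ell2_norm (\<lambda>i. (\<Sum>k=n..<n+l. u k i) + u (n+l) i)
          \<le> ell2_norm (\<lambda>i. \<Sum>k=n..<n+l. u k i) + ell2_norm (u (n+l))"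
        using Suc u by (intro ell2_norm_triangle) auto
      also have "\<dots> \<le> (\<Sum>k=n..<n+l. \<kappa> ^ k) * ell2_norm g + \<kappa> ^ (n+l) * ell2_norm g"
        using Suc un by (intro add_mono) auto
      finally show ?case using Suc u by (simp add: ell2_add algebra_simps)
    qed simp
    moreover have "(\<Sum>k=n..<n+l. \<kappa> ^ k) \<le> \<kappa> ^ n / (1 - \<kappa>)" for l
    proof -
      have "(\<Sum>k=n..<n+l. \<kappa> ^ k) = \<kappa> ^ n * (\<Sum>k<l. \<kappa> ^ k)"
        by (simp add: sum_distrib_left power_add[symmetric]
            sum.shift_bounds_nat_ivl[of _ 0 n l, simplified add.commute, simplified] atLeast0LessThan add.commute)
      also have "\<dots> \<le> \<kappa> ^ n * (1 / (1 - \<kappa>))"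
        using \<kappa> by (intro mult_left_mono) (auto simp: sum_gp_strict divide_right_mono)
      finally show ?thesis by simp
    qed
    ultimately show ?thesis
    proof (cases "n \<le> m")
      case True
      then obtain l where m: "m = n + l" using le_Suc_ex by blast
      have "(\<Sum>k=n..<n+l. \<kappa> ^ k) * ell2_norm g \<le> \<kappa> ^ n / (1 - \<kappa>) * ell2_norm g"
        by (intro mult_right_mono) (use \<open>\<And>l. (\<Sum>k=n..<n+l. \<kappa> ^ k) \<le> _\<close> in auto)
      then show ?thesis
        using \<open>\<And>l. (\<lambda>i. \<Sum>k=n..<n+l. u k i) \<in> ell2 \<and> _\<close>[of l] m
        by (auto simp: B_def)
    qed (use \<kappa> in \<open>auto simp: B_def\<close>)
  qed
  have sums: "(\<lambda>n. s n i) \<longlonglongrightarrow> f i" for i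
  proof -
    have "summable (\<lambda>k. u k i)"
    proof (rule summable_comparison_test')
      show "summable (\<lambda>k. \<kappa> ^ k * ell2_norm g)"
        using \<kappa> by (intro summable_mult2 summable_geometric) auto
      show "norm (u k i) \<le> \<kappa> ^ k * ell2_norm g" if "k \<ge> 0" for k
        using cmod_le_ell2_norm[OF u, of k i] un[of k] by linarith
    qed
    then show ?thesis unfolding s_def f_def by (rule summable_LIMSEQ)
  qed
  have f: "f \<in> ell2"
    by (rule ell2_pointwise_limit[of s _ f, OF _ _ sums])
      (use part[of 0] in \<open>auto simp: s_def atLeast0LessThan\<close>)
  have sn: "s n \<in> ell2" for n
    using part[of 0 n] by (simp add: s_def atLeast0LessThan)
  \<comment> \<open>Sending the upper end of a block to infinity bounds the remainder in
    norm.\<close>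
  have fs: "ell2_norm (\<lambda>i. f i - s n i) \<le> \<kappa> ^ n * B" for n
  proof (rule ell2_pointwise_limit[of "\<lambda>m i. s (m + n) i - s n i"])
    have "(\<lambda>i. s (m + n) i - s n i) = (\<lambda>i. \<Sum>k=n..<m+n. u k i)" for m
      unfolding s_def by (auto simp: fun_eq_iff lessThan_atLeast0 sum_diff_nat_ivl)
    then show "(\<lambda>i. s (m + n) i - s n i) \<in> ell2"
      "ell2_norm (\<lambda>i. s (m + n) i - s n i) \<le> \<kappa> ^ n * B" for m
      using part[of n "m + n"] by auto
    show "(\<lambda>m. s (m + n) i - s n i) \<longlonglongrightarrow> f i - s n i" for i
      by (intro tendsto_intros LIMSEQ_ignore_initial_segment sums)
  qed
  have "f i = A f i + g i" for i
  proof -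
    have lim: "(\<lambda>n. A (s n) i) \<longlonglongrightarrow> A f i"
    proof (rule Lim_null[THEN iffD2], rule tendsto_norm_zero_cancel, rule tendsto_0_le)
      show "(\<lambda>n. \<kappa> ^ n * B) \<longlonglongrightarrow> 0"
        using \<kappa> by (intro tendsto_mult_left_zero LIMSEQ_realpow_zero) auto
      show "\<forall>\<^sub>F n in sequentially. norm (cmod (A (s n) i - A f i)) \<le> norm (\<kappa> ^ n * B) * \<kappa>"
      proof (rule always_eventually, rule allI)
        fix n
        have d: "(\<lambda>i. f i - s n i) \<in> ell2" by (intro ell2_diff f sn)
        have "cmod (A (s n) i - A f i) = cmod (A (\<lambda>i. f i - s n i) i)"
          by (simp add: linear_op_diff[OF A(1)] norm_minus_commute)
        also have "\<dots> \<le> ell2_norm (A (\<lambda>i. f i - s n i))"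
          by (rule cmod_le_ell2_norm) (intro A d)
        also have "\<dots> \<le> \<kappa> * ell2_norm (\<lambda>i. f i - s n i)" by (rule A(3)[OF d])
        also have "\<dots> \<le> \<kappa> * (\<kappa> ^ n * B)" by (intro mult_left_mono fs \<kappa>)
        also have "\<dots> \<le> norm (\<kappa> ^ n * B) * \<kappa>"
          using \<kappa> by (simp add: B_def abs_mult mult_ac)
        finally show "norm (cmod (A (s n) i - A f i)) \<le> norm (\<kappa> ^ n * B) * \<kappa>" by simp
      qed
    qed
    have "A (s n) i = s (Suc n) i - g i" for n
    proof -
      have "A (s n) i = (\<Sum>k<n. u (Suc k) i)"
        unfolding s_def uSuc by (subst linear_op_sum[OF A(1)]) auto
      moreover have "s (Suc n) i = u 0 i + (\<Sum>k<n. u (Suc k) i)"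
        unfolding s_def by (rule sum.lessThan_Suc_shift)
      ultimately show ?thesis by (simp add: u_def)
    qed
    then have "(\<lambda>n. A (s n) i) = (\<lambda>n. s (Suc n) i - g i)" by blast
    moreover have "(\<lambda>n. s (Suc n) i - g i) \<longlonglongrightarrow> f i - g i"
      by (intro tendsto_intros LIMSEQ_Suc sums)
    ultimately have "A f i = f i - g i"
      using LIMSEQ_unique[OF lim] by simp
    then show ?thesis by simp
  qed
  with f that show ?thesis by blast
qed

section \<open>Inner products and orthogonality\<close>

lemma ell2_inner_summable:
  assumes "f \<in> ell2" "g \<in> ell2"
  shows "(\<lambda>i. f i * cnj (g i)) summable_on UNIV"
proof (rule abs_summable_summable, rule summable_on_comparison_test)
  show "(\<lambda>i. (cmod (f i))\<^sup>2 + (cmod (g i))\<^sup>2) summable_on UNIV"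
    using assms by (intro summable_on_add) (auto simp: ell2_def)
  show "cmod (f i * cnj (g i)) \<le> (cmod (f i))\<^sup>2 + (cmod (g i))\<^sup>2" for i
  proof -
    have "0 \<le> cmod (f i) * cmod (g i)" by simp
    with sum_squares_bound[of "cmod (f i)" "cmod (g i)"] show ?thesis
      unfolding norm_mult complex_mod_cnj by linarith
  qed
qed auto

text \<open>Only the real part of the inner product enters, so \<open>f\<close> may be paired with
  its image under a skew-adjoint operator, where the inner product is purely imaginary.\<close>

lemma ell2_norm_pythagoras:
  assumes f: "f \<in> ell2" and g: "g \<in> ell2" and orth: "Re (ell2_inner f g) = 0"
  shows "(ell2_norm (\<lambda>i. f i + g i))\<^sup>2 = (ell2_norm f)\<^sup>2 + (ell2_norm g)\<^sup>2"
proof -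
  have sf: "(\<lambda>i. (cmod (f i))\<^sup>2) summable_on UNIV" and sg: "(\<lambda>i. (cmod (g i))\<^sup>2) summable_on UNIV"
    using f g by (auto simp: ell2_def)
  note sfg = ell2_inner_summable[OF f g]
  have re: "(\<lambda>i. 2 * Re (f i * cnj (g i))) summable_on UNIV"
    by (intro summable_on_cmult_right summable_on_Re sfg)
  have "(cmod (f i + g i))\<^sup>2 = ((cmod (f i))\<^sup>2 + (cmod (g i))\<^sup>2) + 2 * Re (f i * cnj (g i))" for i
    unfolding cmod_power2 by (simp add: power2_eq_square algebra_simps)
  then have "(ell2_norm (\<lambda>i. f i + g i))\<^sup>2
      = (\<Sum>\<^sub>\<infinity>i. ((cmod (f i))\<^sup>2 + (cmod (g i))\<^sup>2) + 2 * Re (f i * cnj (g i)))"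
    by (simp add: ell2_norm_power2)
  also have "\<dots> = (\<Sum>\<^sub>\<infinity>i. (cmod (f i))\<^sup>2) + (\<Sum>\<^sub>\<infinity>i. (cmod (g i))\<^sup>2)
      + 2 * (\<Sum>\<^sub>\<infinity>i. Re (f i * cnj (g i)))"
    unfolding infsum_add[OF summable_on_add[OF sf sg] re] infsum_add[OF sf sg]
    by (simp only: infsum_cmult_right')
  also have "(\<Sum>\<^sub>\<infinity>i. Re (f i * cnj (g i))) = 0"
    using orth infsum_Re[OF sfg] by (simp add: ell2_inner_def)
  finally show ?thesis by (simp add: ell2_norm_power2)
qed

section \<open>Resolvents\<close>

lemma pencil_diff:
  "linear_op T \<Longrightarrow> pencil T z (\<lambda>i. f i - g i) = (\<lambda>i. pencil T z f i - pencil T z g i)"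
  by (rule linear_op_diff[OF linear_op_pencil])

text \<open>The bound, applied to a difference, already gives injectivity; surjectivity is the only
  other point.\<close>

lemma resolvent_setI:
  assumes T: "linear_op T" "\<And>f. f \<in> ell2 \<Longrightarrow> T f \<in> ell2"
    and bound: "\<And>f. f \<in> ell2 \<Longrightarrow> ell2_norm f \<le> C * ell2_norm (pencil T z f)"
    and surj: "\<And>g. g \<in> ell2 \<Longrightarrow> \<exists>f\<in>ell2. pencil T z f = g"
  shows "z \<in> resolvent_set ell2 T"
proof -
  have "inj_on (pencil T z) ell2"
  proof
    fix f g assume fg: "f \<in> ell2" "g \<in> ell2" "pencil T z f = pencil T z g"
    then have "ell2_norm (\<lambda>i. f i - g i) \<le> C * ell2_norm (\<lambda>i. 0)"
      using bound[OF ell2_diff[OF fg(1,2)]] by (simp add: pencil_diff[OF T(1)])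
    then have "ell2_norm (\<lambda>i. f i - g i) = 0"
      using ell2_norm_nonneg[of "\<lambda>i. f i - g i"] by simp
    then show "f = g"
      using ell2_norm_eq_0_iff[OF ell2_diff[OF fg(1,2)]] by (auto simp: fun_eq_iff)
  qed
  moreover have "pencil T z f \<in> ell2" if "f \<in> ell2" for f
    unfolding pencil_def by (intro ell2_diff ell2_mult_left T that)
  ultimately have "bij_betw (pencil T z) ell2 ell2"
    using surj unfolding bij_betw_def by blast
  then show ?thesis using bound unfolding resolvent_set_def by blast
qed

lemma
  assumes "z \<in> resolvent_set D T"
  shows resolvent_in: "g \<in> ell2 \<Longrightarrow> resolvent D T z g \<in> D"
    and pencil_resolvent: "g \<in> ell2 \<Longrightarrow> pencil T z (resolvent D T z g) = g"
    and resolvent_pencil: "f \<in> D \<Longrightarrow> resolvent D T z (pencil T z f) = f"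
    and resolvent_unique: "f \<in> D \<Longrightarrow> pencil T z f = g \<Longrightarrow> resolvent D T z g = f"
proof -
  have bij: "bij_betw (pencil T z) D ell2"
    using assms by (simp add: resolvent_set_def)
  show "g \<in> ell2 \<Longrightarrow> resolvent D T z g \<in> D"
    using bij unfolding resolvent_def bij_betw_def by (metis inv_into_into)
  show "g \<in> ell2 \<Longrightarrow> pencil T z (resolvent D T z g) = g"
    using bij unfolding resolvent_def bij_betw_def by (metis f_inv_into_f)
  show *: "f \<in> D \<Longrightarrow> resolvent D T z (pencil T z f) = f" for f
    using bij unfolding resolvent_def bij_betw_def by (metis inv_into_f_f)
  show "f \<in> D \<Longrightarrow> pencil T z f = g \<Longrightarrow> resolvent D T z g = f"
    using * by blast
qed

text \<open>Every spectral notion sees an operator only on its domain. This lets the adjoint-based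
  definitions be exchanged for explicit formulas that are linear on all sequences.\<close>

lemma resolvent_cong:
  assumes "\<And>f. f \<in> D \<Longrightarrow> T f = T' f"
  shows "resolvent_set D T = resolvent_set D T'" "spectrum D T = spectrum D T'"
    "point_spectrum D T = point_spectrum D T'"
    "resolvent D T z g = resolvent D T' z g"
    "riesz_projection D T z r f = riesz_projection D T' z r f"
    "ess_spectrum D T = ess_spectrum D T'"
proof -
  have p: "f \<in> D \<Longrightarrow> pencil T z f = pencil T' z f" for f z
    using assms by (simp add: pencil_def)
  show rs: "resolvent_set D T = resolvent_set D T'"
    unfolding resolvent_set_def using p by (simp cong: bij_betw_cong)
  then show s: "spectrum D T = spectrum D T'" by (simp add: spectrum_def)
  show ps: "point_spectrum D T = point_spectrum D T'"
    unfolding point_spectrum_def using assms by auto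
  have r: "resolvent D T z g = resolvent D T' z g" for z g
    unfolding resolvent_def inv_into_def using p by (metis (mono_tags, opaque_lifting))
  then show "resolvent D T z g = resolvent D T' z g" .
  show "riesz_projection D T z r f = riesz_projection D T' z r f"
    unfolding riesz_projection_def r ..
  have "riesz_projection D T = riesz_projection D T'"
    by (simp add: riesz_projection_def r fun_eq_iff)
  then show "ess_spectrum D T = ess_spectrum D T'"
    by (simp add: ess_spectrum_def discrete_spectrum_def s ps)
qed

text \<open>The resolvent identity turns the difference quotient into \<open>- R z (R w g)\<close>,
  and a continuous, hence locally bounded, resolvent bound supplies its limit. Coordinatewise
  holomorphy is what the coordinatewise Riesz projection calls for.\<close>

lemma resolvent_holomorphic:
  assumes T: "linear_op T"
    and \<Omega>: "open \<Omega>" "\<Omega> \<subseteq> resolvent_set ell2 T"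
    and C: "continuous_on \<Omega> C"
    and bound: "\<And>z f. z \<in> \<Omega> \<Longrightarrow> f \<in> ell2 \<Longrightarrow> ell2_norm f \<le> C z * ell2_norm (pencil T z f)"
    and g: "g \<in> ell2"
  shows "(\<lambda>z. resolvent ell2 T z g i) holomorphic_on \<Omega>"
proof -
  define R where "R = resolvent ell2 T"
  have R: "R z h \<in> ell2" "pencil T z (R z h) = h" if "z \<in> \<Omega>" "h \<in> ell2" for z h
    using that \<Omega> resolvent_in pencil_resolvent unfolding R_def by blast+
  \<comment> \<open>The first resolvent identity: both sides have the same image under the injective
    \<open>z - T\<close>.\<close>
  have diff: "(\<lambda>j. R z h j - R w h j) = (\<lambda>j. (w - z) * R z (R w h) j)"
    if "z \<in> \<Omega>" "w \<in> \<Omega>" "h \<in> ell2" for z w h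
  proof -
    have "pencil T z (\<lambda>j. R z h j - R w h j) = (\<lambda>j. (w - z) * R w h j)"
    proof
      fix j
      have "pencil T z (\<lambda>j. R z h j - R w h j) j = h j - pencil T z (R w h) j"
        using that by (simp add: pencil_diff[OF T] R)
      also have "pencil T z (R w h) j = pencil T w (R w h) j + (z - w) * R w h j"
        by (simp add: pencil_def algebra_simps)
      also have "\<dots> = h j + (z - w) * R w h j" using that by (simp add: R)
      finally show "pencil T z (\<lambda>j. R z h j - R w h j) j = (w - z) * R w h j"
        by (simp add: algebra_simps)
    qed
    moreover have "pencil T z (\<lambda>j. (w - z) * R z (R w h) j) = (\<lambda>j. (w - z) * R w h j)"
      unfolding linear_op_scale[OF linear_op_pencil[OF T]] using that by (simp add: R)
    ultimately show ?thesis
      using resolvent_pencil[of z ell2 T] \<Omega> that R ell2_diff ell2_mult_left by (metis subsetD)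
  qed
  \<comment> \<open>Continuity is stated for every \<open>h\<close>, because the derivative at
    \<open>w\<close> uses it for \<open>h = R w g\<close>.\<close>
  have tendsto: "((\<lambda>z. R z h i) \<longlongrightarrow> R w h i) (at w)" if w: "w \<in> \<Omega>" and h: "h \<in> ell2" for w h
  proof (rule Lim_null[THEN iffD2], rule Lim_null_comparison)
    have "isCont C w" using C \<Omega>(1) w by (simp add: continuous_on_eq_continuous_at)
    then have "((\<lambda>z. cmod (w - z) * (C z * ell2_norm (R w h))) \<longlongrightarrow>
        cmod (w - w) * (C w * ell2_norm (R w h))) (at w)"
      by (intro tendsto_intros) (simp add: isCont_def)
    then show "((\<lambda>z. cmod (w - z) * (C z * ell2_norm (R w h))) \<longlongrightarrow> 0) (at w)" by simp
    show "\<forall>\<^sub>F z in at w. norm (R z h i - R w h i) \<le> cmod (w - z) * (C z * ell2_norm (R w h))"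
      using eventually_at_in_open[OF \<Omega>(1) w]
    proof eventually_elim
      case (elim z)
      then have z: "z \<in> \<Omega>" by simp
      have "R z h i - R w h i = (w - z) * R z (R w h) i"
        using diff[OF z w h] by meson
      moreover have "cmod (R z (R w h) i) \<le> ell2_norm (R z (R w h))"
        by (intro cmod_le_ell2_norm R z w h)
      moreover have "\<dots> \<le> C z * ell2_norm (R w h)"
        using bound[OF z R(1)[OF z R(1)[OF w h]]] R(2)[OF z R(1)[OF w h]] by simp
      ultimately show ?case by (simp add: norm_mult mult_left_mono)
    qed
  qed
  have "((\<lambda>z. R z g i) has_field_derivative - R w (R w g) i) (at w)" if w: "w \<in> \<Omega>" for w
    unfolding has_field_derivative_iff
  proof (rule Lim_transform_eventually)
    show "((\<lambda>z. - R z (R w g) i) \<longlongrightarrow> - R w (R w g) i) (at w)"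
      by (intro tendsto_minus tendsto R w g)
    show "\<forall>\<^sub>F z in at w. - R z (R w g) i = (R z g i - R w g i) / (z - w)"
      using eventually_at_in_open[OF \<Omega>(1) w]
    proof eventually_elim
      case (elim z)
      then have "R z g i - R w g i = (w - z) * R z (R w g) i"
        using diff[of z w g] w g by (meson DiffD1)
      then show ?case using elim by (simp add: field_simps)
    qed
  qed
  then show ?thesis
    using \<Omega>(1) unfolding R_def[symmetric] by (auto simp: holomorphic_on_open)
qed

section \<open>Tridiagonal operators with vanishing diagonal\<close>

definition hop :: "(int \<Rightarrow> complex) \<Rightarrow> (int \<Rightarrow> complex) \<Rightarrow> (int \<Rightarrow> complex) \<Rightarrow> (int \<Rightarrow> complex)"
  where "hop u v f = (\<lambda>n. u n * f (n - 1) + v n * f (n + 1))"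

lemma linear_op_hop: "linear_op (hop u v)"
  by (simp add: linear_op_def hop_def algebra_simps)

lemma
  assumes f: "f \<in> ell2" and b: "\<And>n. cmod (u n) \<le> b" "\<And>n. cmod (v n) \<le> b"
  shows hop_ell2: "hop u v f \<in> ell2"
    and ell2_norm_hop_le: "ell2_norm (hop u v f) \<le> 2 * b * ell2_norm f"
proof -
  have b0: "0 \<le> b" using b(1)[of 0] norm_ge_zero[of "u 0"] by linarith
  have 1: "(\<lambda>n. f (n - 1)) \<in> ell2" "(\<lambda>n. f (n + 1)) \<in> ell2"
    using f by (simp_all add: ell2_shift)
  have 2: "(\<lambda>n. u n * f (n - 1)) \<in> ell2" "(\<lambda>n. v n * f (n + 1)) \<in> ell2"
    by (rule ell2_dominated[OF 1(1) b0] ell2_dominated[OF 1(2) b0],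
        simp add: norm_mult b mult_right_mono)+
  have 3: "ell2_norm (\<lambda>n. u n * f (n - 1)) \<le> b * ell2_norm (\<lambda>n. f (n - 1))"
    "ell2_norm (\<lambda>n. v n * f (n + 1)) \<le> b * ell2_norm (\<lambda>n. f (n + 1))"
    by (rule ell2_norm_dominated[OF 1(1) b0] ell2_norm_dominated[OF 1(2) b0],
        simp add: norm_mult b mult_right_mono)+
  show "hop u v f \<in> ell2" unfolding hop_def by (intro ell2_add 2)
  have "ell2_norm (hop u v f) \<le> b * ell2_norm (\<lambda>n. f (n - 1)) + b * ell2_norm (\<lambda>n. f (n + 1))"
    unfolding hop_def by (rule order_trans[OF ell2_norm_triangle[OF 2] add_mono[OF 3]])
  then show "ell2_norm (hop u v f) \<le> 2 * b * ell2_norm f"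
    by (simp add: ell2_norm_shift)
qed

text \<open>The weighted shift \<open>V s\<close> minus its adjoint. The second weight is taken at
  \<open>n\<close> because the adjoint shifts back first and then multiplies by
  \<open>cnj s\<close>.\<close>

definition skew_hop :: "(int \<Rightarrow> complex) \<Rightarrow> (int \<Rightarrow> complex) \<Rightarrow> (int \<Rightarrow> complex)"
  where "skew_hop s = hop (\<lambda>n. s (n - 1)) (\<lambda>n. - cnj (s n))"

text \<open>The real parts telescope: the term at \<open>n\<close> is
  \<open>x (n + 1) - x n\<close>, and the sum of \<open>x\<close> over the integers is invariant
  under the shift.\<close>

lemma skew_hop_skew:
  assumes f: "f \<in> ell2" and s: "\<And>n. cmod (s n) \<le> b"
  shows "Re (ell2_inner (\<lambda>n. \<i> * of_real y * f n - skew_hop s f n) f) = 0"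
proof -
  define x where "x n = Re (s (n - 1) * f (n - 1) * cnj (f n))" for n
  have g: "(\<lambda>n. s (n - 1) * f (n - 1)) \<in> ell2"
  proof (rule ell2_dominated[where b = b and f = "\<lambda>n. f (n - 1)"])
    show "(\<lambda>n. f (n - 1)) \<in> ell2" using f by (simp add: ell2_shift)
    show "0 \<le> b" using s[of 0] norm_ge_zero[of "s 0"] by linarith
  qed (auto simp: norm_mult intro!: mult_right_mono s)
  have sx: "x summable_on UNIV"
    unfolding x_def by (intro summable_on_Re ell2_inner_summable g f)
  have K: "(\<lambda>n. \<i> * of_real y * f n - skew_hop s f n) \<in> ell2"
    unfolding skew_hop_def by (intro ell2_diff ell2_mult_left f hop_ell2[where b = b]) (auto simp: s)
  have "Re ((\<i> * of_real y * f n - skew_hop s f n) * cnj (f n)) = x (n + 1) + - x n" for n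
    by (simp add: x_def skew_hop_def hop_def algebra_simps)
  then have "Re (ell2_inner (\<lambda>n. \<i> * of_real y * f n - skew_hop s f n) f)
      = (\<Sum>\<^sub>\<infinity>n. x (n + 1) + - x n)"
    unfolding ell2_inner_def infsum_Re[OF ell2_inner_summable[OF K f], symmetric] by simp
  also have "\<dots> = (\<Sum>\<^sub>\<infinity>n. x (n + 1)) + (\<Sum>\<^sub>\<infinity>n. - x n)"
    using sx by (intro infsum_add)
      (simp_all add: summable_on_reindex_bij_betw[OF bij_int_plus] summable_on_uminus)
  also have "\<dots> = 0"
    by (simp add: infsum_reindex_bij_betw[OF bij_int_plus] infsum_uminus)
  finally show ?thesis .
qed

text \<open>
  A lower bound for the distance of \<open>z\<close> to the segment \<open>\<i>[-2b, 2b]\<close>; it is positive exactly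
  off the segment.
\<close>

definition gap :: "real \<Rightarrow> complex \<Rightarrow> real"
  where "gap b z = max \<bar>Re z\<bar> (cmod z - 2 * b)"

text \<open>With \<open>K\<close> skew-adjoint and \<open>z - S = K + Re z\<close>, the two summands
  are orthogonal in real part, which gives the entry \<bar>Re z\<bar> of \<open>gap\<close>; the
  other entry is the triangle inequality, as the norm of \<open>S\<close> is at most
  \<open>2 * b\<close>. Surjectivity rests on a Neumann series on and off the imaginary
  axis.\<close>

lemma
  fixes s :: "int \<Rightarrow> complex"
  assumes s: "\<And>n. cmod (s n) \<le> b"
  shows skew_hop_pencil_bound:
      "f \<in> ell2 \<Longrightarrow> gap b z * ell2_norm f \<le> ell2_norm (pencil (skew_hop s) z f)"
    and skew_hop_pencil_surj:
      "gap b z > 0 \<Longrightarrow> g \<in> ell2 \<Longrightarrow> \<exists>f\<in>ell2. pencil (skew_hop s) z f = g"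
proof -
  define S where "S = skew_hop s"
  define K where "K f = (\<lambda>n. \<i> * of_real (Im z) * f n - S f n)" for f
  have b0: "0 \<le> b" using s[of 0] norm_ge_zero[of "s 0"] by linarith
  have linS: "linear_op S" by (simp add: S_def skew_hop_def linear_op_hop)
  have S: "S f \<in> ell2" "ell2_norm (S f) \<le> 2 * b * ell2_norm f" if "f \<in> ell2" for f
    unfolding S_def skew_hop_def
    using hop_ell2[OF that, of "\<lambda>n. s (n - 1)" b "\<lambda>n. - cnj (s n)"]
      ell2_norm_hop_le[OF that, of "\<lambda>n. s (n - 1)" b "\<lambda>n. - cnj (s n)"] s by simp_all
  have K: "K f \<in> ell2" if "f \<in> ell2" for f
    unfolding K_def by (intro ell2_diff ell2_mult_left S that)
  have Kn: "ell2_norm (K f) \<le> (\<bar>Im z\<bar> + 2 * b) * ell2_norm f" if f: "f \<in> ell2" for f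
  proof -
    have "ell2_norm (K f) \<le> ell2_norm (\<lambda>n. \<i> * of_real (Im z) * f n) + ell2_norm (S f)"
      unfolding K_def by (intro ell2_norm_diff_triangle ell2_mult_left S f)
    also have "\<dots> \<le> \<bar>Im z\<bar> * ell2_norm f + 2 * b * ell2_norm f"
      unfolding ell2_norm_mult_left using S(2)[OF f] by (simp add: norm_mult)
    finally show ?thesis by (simp add: algebra_simps)
  qed
  have pyth: "(ell2_norm (\<lambda>n. K f n + of_real c * f n))\<^sup>2 = (ell2_norm (K f))\<^sup>2 + c\<^sup>2 * (ell2_norm f)\<^sup>2"
    if f: "f \<in> ell2" for f c
  proof -
    have "ell2_inner (K f) (\<lambda>n. of_real c * f n) = of_real c * ell2_inner (K f) f"
      by (simp add: ell2_inner_def infsum_cmult_right'[symmetric] mult_ac)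
    then have "Re (ell2_inner (K f) (\<lambda>n. of_real c * f n)) = 0"
      using skew_hop_skew[OF f s, where y = "Im z"] by (simp add: K_def S_def)
    then show ?thesis
      using ell2_norm_pythagoras[OF K[OF f] ell2_mult_left[OF f]]
      by (simp add: ell2_norm_mult_left power_mult_distrib)
  qed
  have penc: "pencil S z f = (\<lambda>n. K f n + of_real (Re z) * f n)" for f
    by (subst complex_eq[of z]) (simp add: pencil_def K_def algebra_simps)
  have re: "\<bar>Re z\<bar> * ell2_norm f \<le> ell2_norm (pencil S z f)" if f: "f \<in> ell2" for f
  proof (rule power2_le_imp_le)
    show "(\<bar>Re z\<bar> * ell2_norm f)\<^sup>2 \<le> (ell2_norm (pencil S z f))\<^sup>2"
      unfolding penc pyth[OF f] by (simp add: power_mult_distrib)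
  qed simp
  have norm: "(cmod z - 2 * b) * ell2_norm f \<le> ell2_norm (pencil S z f)" if f: "f \<in> ell2" for f
  proof -
    have p: "pencil S z f \<in> ell2" unfolding penc by (intro ell2_add ell2_mult_left K f)
    have "cmod z * ell2_norm f = ell2_norm (\<lambda>n. pencil S z f n + S f n)"
      by (simp add: pencil_def ell2_norm_mult_left)
    also have "\<dots> \<le> ell2_norm (pencil S z f) + ell2_norm (S f)"
      by (intro ell2_norm_triangle p S f)
    finally show ?thesis using S(2)[OF f] by (simp add: algebra_simps)
  qed
  show "gap b z * ell2_norm f \<le> ell2_norm (pencil (skew_hop s) z f)" if "f \<in> ell2"
    using re[OF that] norm[OF that] by (auto simp: gap_def S_def max_def)
  show "\<exists>f\<in>ell2. pencil (skew_hop s) z f = g" if pos: "gap b z > 0" and g: "g \<in> ell2"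
  proof (cases "Re z = 0")
    case True
    with pos have z: "cmod z > 2 * b" by (auto simp: gap_def max_def split: if_splits)
    define A where "A f = (\<lambda>n. 1 / z * S f n)" for f
    obtain f where f: "f \<in> ell2" "\<And>n. f n = A f n + 1 / z * g n"
    proof (rule ell2_neumann[of A "2 * b / cmod z" "\<lambda>n. 1 / z * g n"])
      show "linear_op A"
        using linS by (simp add: linear_op_def A_def algebra_simps)
      show "A f \<in> ell2" if "f \<in> ell2" for f
        unfolding A_def by (intro ell2_mult_left S that)
      show "ell2_norm (A f) \<le> 2 * b / cmod z * ell2_norm f" if "f \<in> ell2" for f
        unfolding A_def ell2_norm_mult_left using S(2)[OF that] z b0
        by (simp add: norm_divide divide_right_mono)
      show "2 * b / cmod z < 1" "0 \<le> 2 * b / cmod z" using z b0 by (auto simp: divide_less_eq)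
      show "(\<lambda>n. 1 / z * g n) \<in> ell2" by (rule ell2_mult_left[OF g])
    qed blast
    have "z \<noteq> 0" using z b0 by auto
    then have "pencil S z f = g"
      using f(2) by (auto simp: pencil_def A_def fun_eq_iff field_simps)
    then show ?thesis using f(1) by (auto simp: S_def)
  next
    case False
    \<comment> \<open>\<open>f - (z - S) f / c\<close> is a contraction if the real number \<open>c\<close> is large, by orthogonality\<close>
    define x where "x = Re z"
    define M where "M = \<bar>Im z\<bar> + 2 * b"
    \<comment> \<open>This \<open>c\<close> minimises the squared contraction factor
      \<open>((x - c)\<^sup>2 + M\<^sup>2) / c\<^sup>2\<close>; it has the sign of
      \<open>x\<close>.\<close>
    define c where "c = (x\<^sup>2 + M\<^sup>2) / x"
    define \<kappa> where "\<kappa> = sqrt (1 - (x\<^sup>2 + M\<^sup>2) / c\<^sup>2)"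
    have x: "x \<noteq> 0" using False by (simp add: x_def)
    have xM: "x\<^sup>2 + M\<^sup>2 > 0" using x by (simp add: sum_power2_gt_zero_iff)
    then have c: "c \<noteq> 0" using x by (simp add: c_def)
    have cx: "c * x = x\<^sup>2 + M\<^sup>2" using x by (simp add: c_def)
    have id: "1 - (x\<^sup>2 + M\<^sup>2) / c\<^sup>2 = ((x - c)\<^sup>2 + M\<^sup>2) / c\<^sup>2"
      using c cx by (simp add: field_simps power2_eq_square)
    have nn: "0 \<le> 1 - (x\<^sup>2 + M\<^sup>2) / c\<^sup>2" unfolding id by simp
    have \<kappa>: "0 \<le> \<kappa>" "\<kappa> < 1" "\<kappa>\<^sup>2 = ((x - c)\<^sup>2 + M\<^sup>2) / c\<^sup>2"
    proof -
      have "0 < (x\<^sup>2 + M\<^sup>2) / c\<^sup>2" using xM c by simp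
      then have "\<kappa> < sqrt 1" unfolding \<kappa>_def by (intro real_sqrt_less_mono) linarith
      then show "\<kappa> < 1" by simp
      show "0 \<le> \<kappa>" "\<kappa>\<^sup>2 = ((x - c)\<^sup>2 + M\<^sup>2) / c\<^sup>2"
        using nn id by (simp_all add: \<kappa>_def)
    qed
    define A where "A f = (\<lambda>n. - 1 / of_real c * (K f n + of_real (x - c) * f n))" for f
    obtain f where f: "f \<in> ell2" "\<And>n. f n = A f n + 1 / of_real c * g n"
    proof (rule ell2_neumann[of A \<kappa> "\<lambda>n. 1 / of_real c * g n"])
      show "linear_op A"
        using linS by (simp add: linear_op_def A_def K_def algebra_simps)
      show "A f \<in> ell2" if "f \<in> ell2" for f
        unfolding A_def by (intro ell2_mult_left ell2_add K that)
      show "ell2_norm (A f) \<le> \<kappa> * ell2_norm f" if f: "f \<in> ell2" for f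
      proof (rule power2_le_imp_le)
        have "(ell2_norm (A f))\<^sup>2 = ((ell2_norm (K f))\<^sup>2 + (x - c)\<^sup>2 * (ell2_norm f)\<^sup>2) / c\<^sup>2"
          unfolding A_def ell2_norm_mult_left power_mult_distrib pyth[OF f]
          by (simp add: norm_divide power_divide)
        also have "\<dots> \<le> ((M * ell2_norm f)\<^sup>2 + (x - c)\<^sup>2 * (ell2_norm f)\<^sup>2) / c\<^sup>2"
          using Kn[OF f] by (intro divide_right_mono add_right_mono power_mono) (auto simp: M_def)
        also have "\<dots> = (\<kappa> * ell2_norm f)\<^sup>2"
          unfolding power_mult_distrib \<kappa>(3) by (simp add: field_simps)
        finally show "(ell2_norm (A f))\<^sup>2 \<le> (\<kappa> * ell2_norm f)\<^sup>2" .
      qed (use \<kappa> in auto)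
      show "(\<lambda>n. 1 / of_real c * g n) \<in> ell2" by (rule ell2_mult_left[OF g])
    qed (use \<kappa> in auto)
    have "pencil S z f n = g n" for n
      using f(2)[of n] c unfolding penc A_def x_def[symmetric] by (simp add: field_simps)
    then show ?thesis using f(1) by (auto simp: S_def)
  qed
qed

text \<open>The diagonal factor acts first, hence each term carries the weight of the neighbour it
  comes from.\<close>

definition line_op :: "(int \<Rightarrow> real) \<Rightarrow> complex \<Rightarrow> (int \<Rightarrow> complex) \<Rightarrow> (int \<Rightarrow> complex)"
  where "line_op h \<gamma> = hop (\<lambda>n. of_real (h (n - 1)) * \<gamma>) (\<lambda>n. - of_real (h (n + 1)) * cnj \<gamma>)"

lemma linear_op_line_op: "linear_op (line_op h \<gamma>)"
  by (simp add: line_op_def linear_op_hop)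

lemma
  assumes "f \<in> ell2" "\<And>n. \<bar>h n\<bar> \<le> M"
  shows line_op_ell2: "line_op h \<gamma> f \<in> ell2"
    and ell2_norm_line_op_le: "ell2_norm (line_op h \<gamma> f) \<le> 2 * (M * cmod \<gamma>) * ell2_norm f"
  unfolding line_op_def
  by (rule hop_ell2[where b = "M * cmod \<gamma>"] ell2_norm_hop_le;
      use assms in \<open>auto simp: norm_mult intro!: mult_right_mono\<close>)+

text \<open>Conjugation by the diagonal operator \<open>sqrt h\<close> makes the operator skew-adjoint.\<close>

lemma
  assumes h: "\<And>n. m \<le> h n" "\<And>n. h n \<le> M" and m: "0 < m"
  shows line_op_resolvent_set: "gap (M * cmod \<gamma>) z > 0 \<Longrightarrow> z \<in> resolvent_set ell2 (line_op h \<gamma>)"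
    and line_op_resolvent_bound: "gap (M * cmod \<gamma>) z > 0 \<Longrightarrow> f \<in> ell2 \<Longrightarrow>
      ell2_norm f \<le> sqrt (M / m) / gap (M * cmod \<gamma>) z * ell2_norm (pencil (line_op h \<gamma>) z f)"
proof -
  define b where "b = M * cmod \<gamma>"
  define r where "r n = sqrt (h n)" for n
  \<comment> \<open>The weights of the conjugated operator are geometric means of neighbouring
    entries, times \<gamma>, so \<open>M\<close> bounds them as it bounds \<open>h\<close>.\<close>
  define s where "s n = \<gamma> * of_real (r n * r (n + 1))" for n
  have h0: "0 < h n" for n using h(1)[of n] m by linarith
  have M: "0 < M" using h0 h(2) less_le_trans by blast
  have r: "0 < r n" "sqrt m \<le> r n" "r n \<le> sqrt M" "r n * r n = h n" for n
    using h h0 by (auto simp: r_def less_imp_le)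
  have s: "cmod (s n) \<le> b" for n
  proof -
    have "r n * r (n + 1) \<le> sqrt M * sqrt M" using r M by (intro mult_mono) (auto simp: less_imp_le)
    then have "cmod \<gamma> * (r n * r (n + 1)) \<le> cmod \<gamma> * M"
      using M by (intro mult_left_mono) auto
    then show ?thesis using r(1)
      by (simp add: s_def b_def norm_mult abs_mult less_imp_le mult.commute)
  qed
  \<comment> \<open>The similarity in the form that is used: multiplication by \<open>r\<close>
    intertwines the two pencils.\<close>
  have conj: "of_real (r n) * pencil (line_op h \<gamma>) z f n
      = pencil (skew_hop s) z (\<lambda>n. of_real (r n) * f n) n" for f n
  proof -
    have "complex_of_real (h k) = of_real (r k) * of_real (r k)" for k
      using r(4)[of k] by (metis of_real_mult)
    then show ?thesis
      by (simp add: pencil_def line_op_def skew_hop_def hop_def s_def algebra_simps)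
  qed
  have rell2: "(\<lambda>n. of_real (r n) * f n) \<in> ell2"
    and rnorm: "ell2_norm (\<lambda>n. of_real (r n) * f n) \<le> sqrt M * ell2_norm f"
    if "f \<in> ell2" for f
  proof -
    have "cmod (of_real (r n) * f n) \<le> sqrt M * cmod (f n)" for n
      using r(1,3)[of n] by (simp add: norm_mult mult_right_mono)
    then show "(\<lambda>n. of_real (r n) * f n) \<in> ell2"
      "ell2_norm (\<lambda>n. of_real (r n) * f n) \<le> sqrt M * ell2_norm f"
      using M by (auto intro!: ell2_dominated[OF that, of "sqrt M"] ell2_norm_dominated[OF that])
  qed
  have rinv: "(\<lambda>n. f n / of_real (r n)) \<in> ell2" 
    and rinvnorm: "ell2_norm (\<lambda>n. f n / of_real (r n)) \<le> (1 / sqrt m) * ell2_norm f"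
    if "f \<in> ell2" for f
  proof -
    have "cmod (f n / of_real (r n)) \<le> 1 / sqrt m * cmod (f n)" for n
      using r(1,2)[of n] m by (simp add: norm_divide frac_le)
    then show "(\<lambda>n. f n / of_real (r n)) \<in> ell2"
      "ell2_norm (\<lambda>n. f n / of_real (r n)) \<le> (1 / sqrt m) * ell2_norm f"
      using m ell2_dominated[OF that, of "1 / sqrt m"] ell2_norm_dominated[OF that, of "1 / sqrt m"]
      by auto
  qed
  have hM: "\<bar>h n\<bar> \<le> M" for n using h0[of n] h(2)[of n] by simp
  have pell2: "pencil (line_op h \<gamma>) z f \<in> ell2" if "f \<in> ell2" for f
    unfolding pencil_def by (intro ell2_diff ell2_mult_left line_op_ell2[OF _ hM] that)
  show bound: "ell2_norm f \<le> sqrt (M / m) / gap (M * cmod \<gamma>) z * ell2_norm (pencil (line_op h \<gamma>) z f)"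
    if gap: "gap (M * cmod \<gamma>) z > 0" and f: "f \<in> ell2" for f
  proof -
    \<comment> \<open>The factor \<open>sqrt (M / m)\<close> is a bound for the condition number of
      multiplication by \<open>r\<close>: dividing costs \<open>1 / sqrt m\<close>, multiplying
      \<open>sqrt M\<close>.\<close>
    have "ell2_norm f = ell2_norm (\<lambda>n. (of_real (r n) * f n) / of_real (r n))"
      using r(1) by (simp add: less_imp_neq[symmetric])
    also have "\<dots> \<le> 1 / sqrt m * ell2_norm (\<lambda>n. of_real (r n) * f n)"
      by (rule rinvnorm[OF rell2[OF f]])
    also have "ell2_norm (\<lambda>n. of_real (r n) * f n)
        \<le> ell2_norm (pencil (skew_hop s) z (\<lambda>n. of_real (r n) * f n)) / gap b z"
      using skew_hop_pencil_bound[OF s rell2[OF f], of z] gap by (simp add: field_simps b_def)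
    also have "pencil (skew_hop s) z (\<lambda>n. of_real (r n) * f n)
        = (\<lambda>n. of_real (r n) * pencil (line_op h \<gamma>) z f n)"
      using conj by (simp add: fun_eq_iff)
    also have "ell2_norm \<dots> \<le> sqrt M * ell2_norm (pencil (line_op h \<gamma>) z f)"
      by (rule rnorm[OF pell2[OF f]])
    finally show ?thesis
      using m gap by (simp add: b_def real_sqrt_divide divide_right_mono mult_left_mono)
  qed
  show "z \<in> resolvent_set ell2 (line_op h \<gamma>)" if gap: "gap (M * cmod \<gamma>) z > 0"
  proof (rule resolvent_setI[OF linear_op_line_op line_op_ell2[OF _ hM]
        bound[OF gap]])
    fix g :: "int \<Rightarrow> complex" assume g: "g \<in> ell2"
    obtain f where f: "f \<in> ell2" "pencil (skew_hop s) z f = (\<lambda>n. of_real (r n) * g n)"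
      using skew_hop_pencil_surj[of s b z, OF s _ rell2[OF g]] gap b_def by auto
    have "pencil (line_op h \<gamma>) z (\<lambda>n. f n / of_real (r n)) = g"
    proof
      fix n
      have "of_real (r n) * pencil (line_op h \<gamma>) z (\<lambda>n. f n / of_real (r n)) n = of_real (r n) * g n"
        using f(2) r(1) unfolding conj by (simp add: less_imp_neq[symmetric])
      then show "pencil (line_op h \<gamma>) z (\<lambda>n. f n / of_real (r n)) n = g n"
        using r(1)[of n] by simp
    qed
    then show "\<exists>f\<in>ell2. pencil (line_op h \<gamma>) z f = g" using rinv[OF f(1)] by blast
  qed
qed

section \<open>Perturbations of rank two\<close>

lemma sum_fun_apply: "(\<Sum>x\<in>A. F x) i = (\<Sum>x\<in>A. F x i)"
  by (induction A rule: infinite_finite_induct) auto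

lemma
  assumes T: "linear_op T" and z: "z \<in> resolvent_set ell2 T"
  shows resolvent_add: "f \<in> ell2 \<Longrightarrow> g \<in> ell2 \<Longrightarrow>
      resolvent ell2 T z (\<lambda>i. f i + g i) = (\<lambda>i. resolvent ell2 T z f i + resolvent ell2 T z g i)"
    and resolvent_scale: "f \<in> ell2 \<Longrightarrow>
      resolvent ell2 T z (\<lambda>i. c * f i) = (\<lambda>i. c * resolvent ell2 T z f i)"
  by (rule resolvent_unique[OF z];
      simp add: ell2_add ell2_mult_left resolvent_in[OF z] pencil_resolvent[OF z]
        linear_op_add[OF linear_op_pencil[OF T]] linear_op_scale[OF linear_op_pencil[OF T]])+

lemma norm_point_spectrum_le:
  assumes B: "\<And>f. f \<in> ell2 \<Longrightarrow> ell2_norm (T f) \<le> B * ell2_norm f"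
    and z: "z \<in> point_spectrum ell2 T"
  shows "cmod z \<le> B"
proof -
  obtain f where f: "f \<in> ell2" "f \<noteq> 0" "T f = cscale z f"
    using z by (auto simp: point_spectrum_def)
  have "cmod z * ell2_norm f \<le> B * ell2_norm f"
    using B[OF f(1)] by (simp add: f(3) cscale_def ell2_norm_mult_left)
  moreover have "ell2_norm f > 0"
    using f ell2_norm_eq_0_iff ell2_norm_nonneg[of f] by (metis less_eq_real_def)
  ultimately show ?thesis by simp
qed

lemma linear_op_0: "linear_op T \<Longrightarrow> T 0 = 0"
  using linear_op_zero[of T] by (simp add: zero_fun_def)

lemma point_spectrum_subset:
  assumes "0 \<in> D" "T 0 = 0"
  shows "point_spectrum D T \<subseteq> spectrum D T"
proof
  fix z assume "z \<in> point_spectrum D T"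
  then obtain f where f: "f \<in> D" "f \<noteq> 0" "T f = cscale z f"
    by (auto simp: point_spectrum_def)
  have "pencil T z f = 0" "pencil T z 0 = 0"
    using f assms(2) by (simp_all add: pencil_def cscale_def fun_eq_iff)
  then have "f = 0" if "z \<in> resolvent_set D T"
    using resolvent_unique[OF that] f(1) assms(1) by metis
  then show "z \<in> spectrum D T" using f(2) by (auto simp: spectrum_def)
qed

text \<open>The perturbation alters two columns of an infinite matrix, hence the coordinate
  functionals at \<open>e1\<close> and \<open>e2\<close>. Connectedness and unboundedness of
  \<Omega> keep the perturbation determinant from vanishing identically.\<close>

locale rank_two_perturbation =
  fixes T0 T :: "('i \<Rightarrow> complex) \<Rightarrow> ('i \<Rightarrow> complex)"
    and \<Omega> :: "complex set" and B :: real and e1 e2 :: 'i and k1 k2 :: "'i \<Rightarrow> complex"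
  assumes T0: "linear_op T0" "\<And>f. f \<in> ell2 \<Longrightarrow> T0 f \<in> ell2"
      "\<And>f. f \<in> ell2 \<Longrightarrow> ell2_norm (T0 f) \<le> B * ell2_norm f"
    and \<Omega>: "open \<Omega>" "connected \<Omega>" "\<not> bounded \<Omega>" "\<Omega> \<subseteq> resolvent_set ell2 T0"
    and hol: "\<And>g i. g \<in> ell2 \<Longrightarrow> (\<lambda>z. resolvent ell2 T0 z g i) holomorphic_on \<Omega>"
    and k: "k1 \<in> ell2" "k2 \<in> ell2"
    and T_eq: "\<And>f. T f = (\<lambda>i. T0 f i + f e1 * k1 i + f e2 * k2 i)"
begin

abbreviation R :: "complex \<Rightarrow> ('i \<Rightarrow> complex) \<Rightarrow> 'i \<Rightarrow> complex"
  where "R \<equiv> resolvent ell2 T0"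

text \<open>The determinant of the identity minus the 2 by 2 matrix of the values of
  \<open>R z k1\<close> and \<open>R z k2\<close> at \<open>e1\<close> and
  \<open>e2\<close>.\<close>

definition perturbation_det :: "complex \<Rightarrow> complex"
  where "perturbation_det z = (1 - R z k1 e1) * (1 - R z k2 e2) - R z k2 e1 * R z k1 e2"

text \<open>
  The equation \<open>(z - T) f = g\<close> reads \<open>f = R g + f e1 \<cdot> R k1 + f e2 \<cdot> R k2\<close>; evaluated at \<open>e1\<close>
  and \<open>e2\<close> it is a linear system for \<open>f e1\<close> and \<open>f e2\<close>, to which Cramer's rule applies.
\<close>

definition cramer1 :: "complex \<Rightarrow> ('i \<Rightarrow> complex) \<Rightarrow> complex"
  where "cramer1 z g = (1 - R z k2 e2) * R z g e1 + R z k2 e1 * R z g e2"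

definition cramer2 :: "complex \<Rightarrow> ('i \<Rightarrow> complex) \<Rightarrow> complex"
  where "cramer2 z g = R z k1 e2 * R z g e1 + (1 - R z k1 e1) * R z g e2"

definition solution :: "complex \<Rightarrow> ('i \<Rightarrow> complex) \<Rightarrow> 'i \<Rightarrow> complex"
  where "solution z g = (\<lambda>i. R z g i + cramer1 z g / perturbation_det z * R z k1 i
    + cramer2 z g / perturbation_det z * R z k2 i)"

lemma linear_op_T: "linear_op T"
  using T0(1) unfolding linear_op_def T_eq by (simp add: algebra_simps)

lemma T_ell2: "f \<in> ell2 \<Longrightarrow> T f \<in> ell2"
  unfolding T_eq by (intro ell2_add ell2_mult_left T0 k)

lemma ell2_norm_T_le:
  assumes f: "f \<in> ell2"
  shows "ell2_norm (T f) \<le> (B + ell2_norm k1 + ell2_norm k2) * ell2_norm f"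
proof -
  have "ell2_norm (T f) \<le> ell2_norm (\<lambda>i. T0 f i + f e1 * k1 i) + ell2_norm (\<lambda>i. f e2 * k2 i)"
    unfolding T_eq by (intro ell2_norm_triangle ell2_add ell2_mult_left T0 k f)
  also have "ell2_norm (\<lambda>i. T0 f i + f e1 * k1 i) \<le> ell2_norm (T0 f) + ell2_norm (\<lambda>i. f e1 * k1 i)"
    by (intro ell2_norm_triangle ell2_mult_left T0 k f)
  also have "\<dots> + ell2_norm (\<lambda>i. f e2 * k2 i)
      \<le> B * ell2_norm f + ell2_norm f * ell2_norm k1 + ell2_norm f * ell2_norm k2"
    unfolding ell2_norm_mult_left
    by (intro add_mono T0 f mult_right_mono cmod_le_ell2_norm) auto
  finally show ?thesis by (simp add: algebra_simps)
qed

lemma resolvent_set_T0: "z \<in> \<Omega> \<Longrightarrow> z \<in> resolvent_set ell2 T0"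
  using \<Omega> by blast

lemma R_ell2: "z \<in> \<Omega> \<Longrightarrow> g \<in> ell2 \<Longrightarrow> R z g \<in> ell2"
  by (rule resolvent_in[OF resolvent_set_T0])

lemma pencil_T: "pencil T z f = (\<lambda>i. pencil T0 z f i - (f e1 * k1 i + f e2 * k2 i))"
  by (simp add: pencil_def T_eq algebra_simps)

lemma pencil_T_eq_iff:
  assumes z: "z \<in> \<Omega>" and f: "f \<in> ell2" and g: "g \<in> ell2"
  shows "pencil T z f = g \<longleftrightarrow> f = (\<lambda>i. R z g i + f e1 * R z k1 i + f e2 * R z k2 i)"
proof -
  note rs = resolvent_set_T0[OF z]
  define G where "G = (\<lambda>i. g i + f e1 * k1 i + f e2 * k2 i)"
  have G: "G \<in> ell2" unfolding G_def by (intro ell2_add ell2_mult_left k g)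
  have "pencil T z f = g \<longleftrightarrow> pencil T0 z f = G"
    unfolding pencil_T G_def by (auto simp: fun_eq_iff algebra_simps)
  also have "\<dots> \<longleftrightarrow> f = R z G"
    using resolvent_pencil[OF rs f] pencil_resolvent[OF rs G] by auto
  also have "R z G = (\<lambda>i. R z g i + f e1 * R z k1 i + f e2 * R z k2 i)"
    unfolding G_def
    by (simp add: resolvent_add[OF T0(1) rs] resolvent_scale[OF T0(1) rs] ell2_add ell2_mult_left k g)
  finally show ?thesis .
qed

lemma solution_ell2: "z \<in> \<Omega> \<Longrightarrow> g \<in> ell2 \<Longrightarrow> solution z g \<in> ell2"
  unfolding solution_def by (intro ell2_add ell2_mult_left R_ell2 k)

lemma pencil_solution:
  assumes z: "z \<in> \<Omega>" and D: "perturbation_det z \<noteq> 0" and g: "g \<in> ell2"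
  shows "pencil T z (solution z g) = g"
proof -
  \<comment> \<open>Cleared of the denominator, the claim is a polynomial identity between values of
    the resolvent.\<close>
  have "D * solution z g e1 = cramer1 z g" "D * solution z g e2 = cramer2 z g"
    if "D = perturbation_det z" for D
  proof -
    have "D * solution z g e1 = D * R z g e1 + cramer1 z g * R z k1 e1 + cramer2 z g * R z k2 e1"
      "D * solution z g e2 = D * R z g e2 + cramer1 z g * R z k1 e2 + cramer2 z g * R z k2 e2"
      using \<open>perturbation_det z \<noteq> 0\<close> that by (simp_all add: solution_def field_simps)
    then show "D * solution z g e1 = cramer1 z g" "D * solution z g e2 = cramer2 z g"
      unfolding that perturbation_det_def cramer1_def cramer2_def by (simp_all add: algebra_simps)
  qed
  then have "solution z g e1 = cramer1 z g / perturbation_det z"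
    "solution z g e2 = cramer2 z g / perturbation_det z"
    using D by (metis nonzero_mult_div_cancel_left)+
  then show ?thesis
    unfolding pencil_T_eq_iff[OF z solution_ell2[OF z g] g] by (simp add: solution_def)
qed

text \<open>The linear system forces the values of \<open>f\<close> at \<open>e1\<close> and
  \<open>e2\<close>. This turns a bound for \<open>solution\<close> into the lower bound for
  \<open>pencil T z\<close> that the resolvent set asks for.\<close>

lemma solution_pencil:
  assumes z: "z \<in> \<Omega>" and D: "perturbation_det z \<noteq> 0" and f: "f \<in> ell2"
  shows "f = solution z (pencil T z f)"
proof -
  define g where "g = pencil T z f"
  have g: "g \<in> ell2" unfolding g_def pencil_def by (intro ell2_diff ell2_mult_left T_ell2 f)
  have eq: "f i = R z g i + f e1 * R z k1 i + f e2 * R z k2 i" for i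
    by (rule fun_cong[OF pencil_T_eq_iff[OF z f g, THEN iffD1, OF g_def[symmetric]]])
  define x y where "x = f e1" and "y = f e2"
  have *: "R z g e1 = x - x * R z k1 e1 - y * R z k2 e1" "R z g e2 = y - x * R z k1 e2 - y * R z k2 e2"
    using eq[of e1] eq[of e2] by (simp_all add: x_def y_def algebra_simps)
  have "cramer1 z g = x * perturbation_det z" "cramer2 z g = y * perturbation_det z"
    unfolding cramer1_def cramer2_def perturbation_det_def * by (simp_all add: algebra_simps)
  then show ?thesis
    unfolding g_def[symmetric] solution_def
    by (intro ext) (use D eq in \<open>simp add: x_def[symmetric] y_def[symmetric]\<close>)
qed

lemma resolvent_setI_det:
  assumes z: "z \<in> \<Omega>" and D: "perturbation_det z \<noteq> 0"
  shows "z \<in> resolvent_set ell2 T"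
proof -
  note rs = resolvent_set_T0[OF z]
  obtain C where C: "\<And>f. f \<in> ell2 \<Longrightarrow> ell2_norm f \<le> C * ell2_norm (pencil T0 z f)"
    using rs by (auto simp: resolvent_set_def)
  have RC: "ell2_norm (R z g) \<le> C * ell2_norm g" if "g \<in> ell2" for g
    using C[OF R_ell2[OF z that]] pencil_resolvent[OF rs that] by simp
  have Re: "cmod (R z g i) \<le> C * ell2_norm g" if "g \<in> ell2" for g i
    using cmod_le_ell2_norm[OF R_ell2[OF z that]] RC[OF that] order_trans by blast
  define c1 where "c1 = (cmod (1 - R z k2 e2) + cmod (R z k2 e1)) * C / cmod (perturbation_det z)"
  define c2 where "c2 = (cmod (R z k1 e2) + cmod (1 - R z k1 e1)) * C / cmod (perturbation_det z)"
  have cr: "cmod (a * R z g e1 + b * R z g e2) / cmod (perturbation_det z)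
      \<le> (cmod a + cmod b) * C / cmod (perturbation_det z) * ell2_norm g" if "g \<in> ell2" for a b g
  proof -
    have "cmod (a * R z g e1 + b * R z g e2) \<le> cmod a * cmod (R z g e1) + cmod b * cmod (R z g e2)"
      by (metis norm_mult norm_triangle_ineq)
    also have "\<dots> \<le> cmod a * (C * ell2_norm g) + cmod b * (C * ell2_norm g)"
      by (intro add_mono mult_left_mono Re that) auto
    finally show ?thesis by (simp add: divide_right_mono algebra_simps)
  qed
  have bound: "ell2_norm (solution z g) \<le> (C + c1 * ell2_norm (R z k1) + c2 * ell2_norm (R z k2)) * ell2_norm g"
    if g: "g \<in> ell2" for g
  proof -
    have "ell2_norm (solution z g) \<le> ell2_norm (\<lambda>i. R z g i + cramer1 z g / perturbation_det z * R z k1 i)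
        + ell2_norm (\<lambda>i. cramer2 z g / perturbation_det z * R z k2 i)"
      unfolding solution_def by (intro ell2_norm_triangle ell2_add ell2_mult_left R_ell2 k g z)
    also have "ell2_norm (\<lambda>i. R z g i + cramer1 z g / perturbation_det z * R z k1 i)
        \<le> ell2_norm (R z g) + ell2_norm (\<lambda>i. cramer1 z g / perturbation_det z * R z k1 i)"
      by (intro ell2_norm_triangle ell2_mult_left R_ell2 k g z)
    also have "\<dots> + ell2_norm (\<lambda>i. cramer2 z g / perturbation_det z * R z k2 i)
        \<le> C * ell2_norm g + c1 * ell2_norm g * ell2_norm (R z k1) + c2 * ell2_norm g * ell2_norm (R z k2)"
      unfolding ell2_norm_mult_left
      using cr[OF g] by (intro add_mono RC g mult_right_mono)
        (auto simp: norm_divide c1_def c2_def cramer1_def cramer2_def)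
    finally show ?thesis by (simp add: algebra_simps)
  qed
  show ?thesis
  proof (rule resolvent_setI[OF linear_op_T T_ell2])
    fix f :: "'i \<Rightarrow> complex" assume f: "f \<in> ell2"
    have "pencil T z f \<in> ell2" unfolding pencil_def by (intro ell2_diff ell2_mult_left T_ell2 f)
    from bound[OF this] show "ell2_norm f \<le>
      (C + c1 * ell2_norm (R z k1) + c2 * ell2_norm (R z k2)) * ell2_norm (pencil T z f)"
      using solution_pencil[OF z D f] by simp
  next
    fix g :: "'i \<Rightarrow> complex" assume "g \<in> ell2"
    then show "\<exists>f\<in>ell2. pencil T z f = g"
      using solution_ell2 pencil_solution z D by blast
  qed
qed

lemma resolvent_T_eq:
  assumes "z \<in> \<Omega>" "perturbation_det z \<noteq> 0" "g \<in> ell2"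
  shows "resolvent ell2 T z g = solution z g"
  by (rule resolvent_unique[OF resolvent_setI_det]) (use assms solution_ell2 pencil_solution in auto)

lemma point_spectrumI_det:
  assumes z: "z \<in> \<Omega>" and D: "perturbation_det z = 0"
  shows "z \<in> point_spectrum ell2 T"
proof -
  note rs = resolvent_set_T0[OF z]
  have R0: "R z (\<lambda>i. 0) = (\<lambda>i. 0)"
    by (rule resolvent_unique[OF rs]) (auto simp: linear_op_zero[OF linear_op_pencil[OF T0(1)]])
  obtain x y where xy: "x \<noteq> 0 \<or> y \<noteq> 0"
      "x * R z k1 e1 + y * R z k2 e1 = x" "x * R z k1 e2 + y * R z k2 e2 = y"
  proof -
    define a b c d where "a = R z k1 e1" and "b = R z k2 e1" and "c = R z k1 e2" and "d = R z k2 e2"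
    have D': "(1 - a) * (1 - d) = b * c"
      using D by (simp add: perturbation_det_def a_def b_def c_def d_def)
    \<comment> \<open>A kernel vector of the singular matrix: \<open>(b, 1 - a)\<close> is
      annihilated by its first row and \<open>(1 - d, c)\<close> by its second, the other row
      following from the determinant; if both vectors vanish, so does the matrix.\<close>
    consider "b \<noteq> 0 \<or> 1 - a \<noteq> 0" | "1 - d \<noteq> 0 \<or> c \<noteq> 0" | "b = 0" "a = 1" "c = 0" "d = 1"
      by fastforce
    then show thesis
    proof cases
      case 1
      then show thesis using D' that[of b "1 - a"]
        by (simp add: a_def[symmetric] b_def[symmetric] c_def[symmetric] d_def[symmetric] algebra_simps)
    next
      case 2
      then show thesis using D' that[of "1 - d" c]
        by (simp add: a_def[symmetric] b_def[symmetric] c_def[symmetric] d_def[symmetric] algebra_simps)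
    next
      case 3
      then show thesis using that[of 1 0]
        by (simp add: a_def[symmetric] b_def[symmetric] c_def[symmetric] d_def[symmetric])
    qed
  qed
  define f where "f = (\<lambda>i. x * R z k1 i + y * R z k2 i)"
  have f: "f \<in> ell2" unfolding f_def by (intro ell2_add ell2_mult_left R_ell2 k z)
  have fe: "f e1 = x" "f e2 = y" using xy by (simp_all add: f_def)
  have "pencil T z f = (\<lambda>i. 0)"
    unfolding pencil_T_eq_iff[OF z f ell2_zero(2)] R0 fe by (simp add: f_def)
  then have "T f = cscale z f" by (simp add: pencil_def cscale_def fun_eq_iff)
  moreover have "f \<noteq> 0" using xy(1) fe by auto
  ultimately show ?thesis using f unfolding point_spectrum_def by blast
qed

lemma spectrum_iff_det:
  assumes "z \<in> \<Omega>"
  shows "z \<in> spectrum ell2 T \<longleftrightarrow> perturbation_det z = 0"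
    and "z \<in> point_spectrum ell2 T \<longleftrightarrow> perturbation_det z = 0"
  using point_spectrumI_det[OF assms] resolvent_setI_det[OF assms]
    point_spectrum_subset[of ell2 T, OF ell2_zero(1) linear_op_0[OF linear_op_T]] by (auto simp: spectrum_def)

lemma holomorphic_perturbation_det: "perturbation_det holomorphic_on \<Omega>"
  unfolding perturbation_det_def[abs_def] by (intro holomorphic_intros hol k)

text \<open>Beyond the norm bound of \<open>T\<close> there are no eigenvalues, and \<Omega> reaches
  there, so the determinant is not constantly zero and its zeros have finite order \<open>m\<close>.
  Points with non-zero determinant are included as the case \<open>m = 0\<close>.\<close>

lemma perturbation_det_factor:
  assumes z: "z \<in> \<Omega>"
  obtains g r m where "0 < r" "ball z r \<subseteq> \<Omega>" "g holomorphic_on ball z r"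
    "\<And>w. w \<in> ball z r \<Longrightarrow> perturbation_det w = (w - z) ^ m * g w"
    "\<And>w. w \<in> ball z r \<Longrightarrow> g w \<noteq> 0"
proof (cases "perturbation_det z = 0")
  case True
  obtain w where w: "w \<in> \<Omega>" "cmod w > B + ell2_norm k1 + ell2_norm k2"
    using \<Omega>(3) by (auto simp: bounded_iff not_le)
  have "w \<notin> point_spectrum ell2 T"
    using norm_point_spectrum_le[of T _ w, OF ell2_norm_T_le] w(2) by fastforce
  then have "perturbation_det w \<noteq> 0" using spectrum_iff_det(2)[OF w(1)] by simp
  then have "\<not> perturbation_det constant_on \<Omega>"
    using True z w(1) unfolding constant_on_def by metis
  from holomorphic_factor_zero_nonconstant[OF holomorphic_perturbation_det \<Omega>(1,2) z True this]
  show ?thesis using that by metis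
next
  case False
  have "open (\<Omega> \<inter> perturbation_det -` (- {0}))"
    by (rule continuous_open_preimage[OF holomorphic_on_imp_continuous_on[OF
          holomorphic_perturbation_det] \<Omega>(1)]) auto
  then obtain r where r: "r > 0" "ball z r \<subseteq> \<Omega> \<inter> perturbation_det -` (- {0})"
    using z False by (metis ComplI IntI open_contains_ball singletonD vimageI)
  show ?thesis
  proof (rule that[of r perturbation_det 0])
    show "ball z r \<subseteq> \<Omega>" "\<And>w. w \<in> ball z r \<Longrightarrow> perturbation_det w \<noteq> 0" using r(2) by blast+
    then show "perturbation_det holomorphic_on ball z r"
      using holomorphic_on_subset[OF holomorphic_perturbation_det] by blast
  qed (use r(1) in auto)
qed

text \<open>Apart from the holomorphic term \<open>R w f i\<close>, the index \<open>i\<close>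
  enters the Riesz integral only through \<open>R w k1 i\<close> and \<open>R w k2 i\<close>.
  Cauchy's formula replaces these by their derivatives at \<open>z\<close> of order at most
  \<open>m\<close>, which form vectors independent of \<open>f\<close>.\<close>

lemma isolated_finite_rank:
  assumes z: "z \<in> \<Omega>"
  obtains r0 where "0 < r0" "cball z r0 \<subseteq> \<Omega>" "cball z r0 \<inter> spectrum ell2 T \<subseteq> {z}"
    "\<And>r. 0 < r \<Longrightarrow> r \<le> r0 \<Longrightarrow> finite_dim (riesz_projection ell2 T z r ` ell2)"
proof -
  obtain g \<rho> m where \<rho>: "0 < \<rho>" "ball z \<rho> \<subseteq> \<Omega>" and g: "g holomorphic_on ball z \<rho>"
    and fac: "\<And>w. w \<in> ball z \<rho> \<Longrightarrow> perturbation_det w = (w - z) ^ m * g w"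
    and g0: "\<And>w. w \<in> ball z \<rho> \<Longrightarrow> g w \<noteq> 0"
    using perturbation_det_factor[OF z] by metis
  have sub: "cball z (\<rho>/2) \<subseteq> ball z \<rho>" using \<rho> by (auto simp: cball_def ball_def)
  have D: "perturbation_det w \<noteq> 0" if "w \<in> ball z \<rho>" "w \<noteq> z" for w
    using that fac g0 by simp
  \<comment> \<open>The spanning vectors; \<open>finite_dim\<close> admits arbitrary sequences as
    generators.\<close>
  define v where "v k l = (\<lambda>i. (deriv ^^ l) (\<lambda>w. R w k i) z)" for k l
  define V where "V = (\<lambda>(k, l). v k l) ` ({k1, k2} \<times> {..m})"
  have fin: "riesz_projection ell2 T z r f \<in> cfun.span V" if r: "0 < r" "r \<le> \<rho>/2" and f: "f \<in> ell2" for r f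
  proof -
    have r\<rho>: "cball z r \<subseteq> ball z \<rho>" using r \<rho> by (auto simp: cball_def ball_def)
    \<comment> \<open>The extra factor \<open>w - z\<close> raises the exponent in the denominator
      to \<open>Suc m\<close>, as in Cauchy's formula for the derivative of order \<open>m\<close>,
      so that \<open>m = 0\<close> is no exception.\<close>
    define H1 where "H1 w = cramer1 w f * (w - z) / g w" for w
    define H2 where "H2 w = cramer2 w f * (w - z) / g w" for w
    have hR: "(\<lambda>w. R w h i) holomorphic_on ball z \<rho>" if "h \<in> ell2" for h i
      by (rule holomorphic_on_subset[OF hol[OF that] \<rho>(2)])
    have H: "H1 holomorphic_on ball z \<rho>" "H2 holomorphic_on ball z \<rho>"
    proof -
      have "(\<lambda>w. cramer1 w f) holomorphic_on ball z \<rho>"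
        unfolding cramer1_def by (intro holomorphic_intros hR k f)
      moreover have "(\<lambda>w. cramer2 w f) holomorphic_on ball z \<rho>"
        unfolding cramer2_def by (intro holomorphic_intros hR k f)
      ultimately show "H1 holomorphic_on ball z \<rho>" "H2 holomorphic_on ball z \<rho>"
        unfolding H1_def[abs_def] H2_def[abs_def] by (intro holomorphic_intros g; simp add: g0)+
    qed
    define a where "a H l = of_nat (m choose l) * (deriv ^^ l) H z / fact m" for H :: "complex \<Rightarrow> complex" and l
    have int: "((\<lambda>w. H w * R w h i / (w - z) ^ Suc m) has_contour_integral
        2 * of_real pi * \<i> * (\<Sum>l\<le>m. a H l * v h (m - l) i)) (circlepath z r)"
      if "H holomorphic_on ball z \<rho>" "h \<in> ell2" for H h i
    proof -
      have hol: "(\<lambda>w. H w * R w h i) holomorphic_on ball z \<rho>" by (intro holomorphic_intros that hR)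
      have "((\<lambda>w. H w * R w h i / (w - z) ^ Suc m) has_contour_integral
        2 * of_real pi * \<i> / fact m * (deriv ^^ m) (\<lambda>w. H w * R w h i) z) (circlepath z r)"
        using Cauchy_has_contour_integral_higher_derivative_circlepath[of z r "\<lambda>w. H w * R w h i" z m]
          holomorphic_on_imp_continuous_on[OF holomorphic_on_subset[OF hol r\<rho>]]
          holomorphic_on_subset[OF hol order_trans[OF ball_subset_cball r\<rho>]] r by simp
      also have "(deriv ^^ m) (\<lambda>w. H w * R w h i) z
          = (\<Sum>l = 0..m. of_nat (m choose l) * (deriv ^^ l) H z * (deriv ^^ (m - l)) (\<lambda>w. R w h i) z)"
        by (rule higher_deriv_mult[OF that(1) hR[OF that(2)] open_ball]) (use \<rho> in auto)
      finally show ?thesis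
        by (simp add: a_def v_def sum_distrib_left atLeast0AtMost mult_ac)
    qed
    have "riesz_projection ell2 T z r f i
      = (\<Sum>l\<le>m. a H1 l * v k1 (m - l) i) + (\<Sum>l\<le>m. a H2 l * v k2 (m - l) i)" (is "_ = ?s1 + ?s2") for i
    proof -
      have "((\<lambda>w. R w f i) has_contour_integral 0) (circlepath z r)"
        by (rule Cauchy_theorem_disc_simple[OF hR[OF f]]) (use r r\<rho> in auto)
      then have "((\<lambda>w. R w f i + H1 w * R w k1 i / (w - z) ^ Suc m + H2 w * R w k2 i / (w - z) ^ Suc m)
          has_contour_integral 0 + 2 * of_real pi * \<i> * ?s1 + 2 * of_real pi * \<i> * ?s2) (circlepath z r)"
        by (intro has_contour_integral_add int H k)
      then have "((\<lambda>w. resolvent ell2 T w f i) has_contour_integral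
          0 + 2 * of_real pi * \<i> * ?s1 + 2 * of_real pi * \<i> * ?s2) (circlepath z r)"
      proof (rule has_contour_integral_eq)
        fix w assume "w \<in> path_image (circlepath z r)"
        then have "w \<in> cball z r" "w \<noteq> z" using r by auto
        then have w: "w \<in> ball z \<rho>" "w \<in> \<Omega>" "w \<noteq> z" using r\<rho> \<rho>(2) by auto
        have "resolvent ell2 T w f i = solution w f i"
          using resolvent_T_eq[OF w(2) D[OF w(1,3)] f] by simp
        also have "\<dots> = R w f i + H1 w * R w k1 i / (w - z) ^ Suc m + H2 w * R w k2 i / (w - z) ^ Suc m"
          using w(3) g0[OF w(1)] unfolding solution_def fac[OF w(1)] H1_def H2_def by (simp add: mult_ac)
        finally show "R w f i + H1 w * R w k1 i / (w - z) ^ Suc m + H2 w * R w k2 i / (w - z) ^ Suc m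
          = resolvent ell2 T w f i" ..
      qed
      then show ?thesis
        unfolding riesz_projection_def by (simp add: contour_integral_unique field_simps)
    qed
    then have "riesz_projection ell2 T z r f
        = (\<Sum>l\<le>m. cscale (a H1 l) (v k1 (m - l))) + (\<Sum>l\<le>m. cscale (a H2 l) (v k2 (m - l)))"
      by (simp add: fun_eq_iff sum_fun_apply cscale_def)
    also have "\<dots> \<in> cfun.span V"
      by (intro cfun.span_add cfun.span_sum cfun.span_scale cfun.span_base) (auto simp: V_def)
    finally show ?thesis .
  qed
  show ?thesis
  proof
    show "0 < \<rho>/2" "cball z (\<rho>/2) \<subseteq> \<Omega>" using \<rho> sub by auto
    show "cball z (\<rho>/2) \<inter> spectrum ell2 T \<subseteq> {z}"
      using spectrum_iff_det(1) D \<rho>(2) sub by blast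
    show "finite_dim (riesz_projection ell2 T z r ` ell2)" if "0 < r" "r \<le> \<rho>/2" for r
      unfolding finite_dim_def using fin[OF that]
      by (intro exI[of _ V]) (auto simp: V_def)
  qed
qed

end

section \<open>The spectrum of tridiagonal operators of line type\<close>

lemma gap_pos_iff: "gap b z > 0 \<longleftrightarrow> Re z \<noteq> 0 \<or> cmod z > 2 * b"
  by (auto simp: gap_def less_max_iff_disj)

lemma gap_ge_abs_Re: "\<bar>Re z\<bar> \<le> gap b z"
  by (simp add: gap_def)

lemma continuous_on_gap: "continuous_on A (gap b)"
  unfolding gap_def by (intro continuous_intros)

lemma segment_eq_gap:
  assumes "0 \<le> b"
  shows "(\<lambda>t. \<i> * complex_of_real t) ` {- 2 * b .. 2 * b} = - {z. gap b z > 0}"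
proof (intro equalityI subsetI)
  fix z assume "z \<in> (\<lambda>t. \<i> * complex_of_real t) ` {- 2 * b .. 2 * b}"
  then show "z \<in> - {z. gap b z > 0}" by (auto simp: gap_pos_iff norm_mult)
next
  fix z assume "z \<in> - {z. gap b z > 0}"
  then have z: "Re z = 0" "cmod z \<le> 2 * b" by (auto simp: gap_pos_iff)
  then have "\<bar>Im z\<bar> \<le> 2 * b" using abs_Im_le_cmod[of z] by linarith
  moreover have "z = \<i> * complex_of_real (Im z)" using z(1) by (simp add: complex_eq_iff)
  ultimately show "z \<in> (\<lambda>t. \<i> * complex_of_real t) ` {- 2 * b .. 2 * b}"
    by (intro image_eqI[of _ _ "Im z"]) auto
qed

lemma
  assumes b: "0 \<le> b"
  shows open_gap: "open {z. gap b z > 0}"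
    and connected_gap: "connected {z. gap b z > 0}"
    and unbounded_gap: "\<not> bounded {z. gap b z > 0}"
proof -
  define S where "S = (\<lambda>t. \<i> * complex_of_real t) ` {- 2 * b .. 2 * b}"
  have S: "- S = {z. gap b z > 0}" using segment_eq_gap[OF b] by (auto simp: S_def)
  show "open {z. gap b z > 0}"
    by (intro open_Collect_less continuous_on_gap continuous_on_const)
  have bS: "bounded S"
    unfolding S_def by (intro compact_imp_bounded compact_continuous_image continuous_intros) auto
  have "convex S"
    unfolding S_def by (intro convex_linear_image convex_real_interval)
      (simp add: linear_iff scaleR_conv_of_real algebra_simps)
  then show "connected {z. gap b z > 0}"
    unfolding S[symmetric] using bS by (intro connected_complement_bounded_convex) auto
  show "\<not> bounded {z. gap b z > 0}"
    unfolding S[symmetric] using bS cobounded_imp_unbounded by fastforce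
qed

text \<open>The right-hand side is the symbol of the constant-coefficient operator: it is the factor
  by which the plane wave \<open>\<mu> powi n\<close> is multiplied. For unimodular \<mu> it equals
  \<open>w - cnj w\<close> with \<open>w = \<beta> * cnj \<mu>\<close>, so \<open>w\<close> must
  have the modulus of \<beta> and imaginary part \<open>t / 2\<close>.\<close>

lemma segment_point_unimodular:
  assumes t: "\<bar>t\<bar> \<le> 2 * cmod \<beta>"
  obtains \<mu> where "cmod \<mu> = 1" "\<i> * of_real t = \<beta> / \<mu> - cnj \<beta> * \<mu>"
proof (cases "\<beta> = 0")
  case True
  then show ?thesis using t that[of 1] by simp
next
  case False
  define w where "w = Complex (sqrt ((cmod \<beta>)\<^sup>2 - (t / 2)\<^sup>2)) (t / 2)"
  define \<mu> where "\<mu> = cnj (w / \<beta>)"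
  have "\<bar>t / 2\<bar>\<^sup>2 \<le> (cmod \<beta>)\<^sup>2" using t by (intro power_mono) auto
  then have "(cmod w)\<^sup>2 = (cmod \<beta>)\<^sup>2"
    unfolding cmod_power2[of w] power2_abs by (simp add: w_def)
  then have "cmod w = cmod \<beta>" by simp
  then have \<mu>: "cmod \<mu> = 1" using False by (simp add: \<mu>_def norm_divide)
  then have inv: "1 / \<mu> = cnj \<mu>" and "\<mu> \<noteq> 0"
    by (auto simp: divide_eq_eq complex_norm_square[symmetric] mult.commute)
  have "\<beta> / \<mu> = \<beta> * cnj \<mu>"
    using times_divide_eq_right[of \<beta> 1 \<mu>] unfolding inv by simp
  then have "\<beta> / \<mu> - cnj \<beta> * \<mu> = \<beta> * cnj \<mu> - cnj (\<beta> * cnj \<mu>)"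
    by simp
  also have "\<beta> * cnj \<mu> = w" using False by (simp add: \<mu>_def)
  also have "w - cnj w = \<i> * of_real t" by (simp add: w_def complex_eq_iff)
  finally show ?thesis using that \<mu> by simp
qed

text \<open>Weyl sequences: plane waves \<open>\<mu>\<^sup>n\<close> cut off to long intervals far to the right.\<close>

lemma line_op_plane_wave_spectrum:
  assumes lim: "(h \<longlongrightarrow> c) at_top" and h: "\<And>n. \<bar>h n\<bar> \<le> M" and \<mu>: "cmod \<mu> = 1"
    and z: "z = of_real c * \<gamma> / \<mu> - of_real c * cnj \<gamma> * \<mu>"
  shows "z \<in> spectrum ell2 (line_op h \<gamma>)"
proof (rule ccontr)
  assume "z \<notin> spectrum ell2 (line_op h \<gamma>)"
  then obtain C0 where C0: "\<And>f. f \<in> ell2 \<Longrightarrow> ell2_norm f \<le> C0 * ell2_norm (pencil (line_op h \<gamma>) z f)"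
    by (auto simp: spectrum_def resolvent_set_def)
  define C where "C = \<bar>C0\<bar> + 1"
  have "C0 \<le> C" by (simp add: C_def)
  then have C: "ell2_norm f \<le> C * ell2_norm (pencil (line_op h \<gamma>) z f)" if "f \<in> ell2" for f
    using order_trans[OF C0[OF that] mult_right_mono] by simp
  have Cpos: "C > 0" by (simp add: C_def)
  \<comment> \<open>Chosen so that the coefficient error, multiplied by \<open>C\<close>, amounts to
    half of \<open>ell2_norm f\<close>.\<close>
  define \<epsilon> where "\<epsilon> = 1 / (4 * C)"
  have \<epsilon>: "\<epsilon> > 0" using Cpos by (simp add: \<epsilon>_def)
  have "((\<lambda>n. of_real (h n) * \<gamma>) \<longlongrightarrow> of_real c * \<gamma>) at_top"
    by (intro tendsto_intros lim)
  then have "\<forall>\<^sub>F n in at_top. dist (of_real (h n) * \<gamma>) (of_real c * \<gamma>) < \<epsilon>"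
    using \<epsilon> by (rule tendstoD)
  then obtain a where a: "\<And>n. n \<ge> a \<Longrightarrow> cmod (of_real (h n) * \<gamma> - of_real c * \<gamma>) < \<epsilon>"
    by (auto simp: eventually_at_top_linorder dist_norm)
  define \<beta> where "\<beta> = of_real c * \<gamma>"
  define K where "K = cmod z + 2 * cmod \<beta>"
  \<comment> \<open>Long enough for the norm \<open>sqrt N\<close> of the cut-off wave to exceed
    \<open>4 * K * C\<close>, which comes from the ends of the window.\<close>
  define N where "N = nat \<lceil>(4 * K * C)\<^sup>2\<rceil> + 1"
  have N: "real N > (4 * K * C)\<^sup>2" unfolding N_def by linarith
  define f where "f n = (if a \<le> n \<and> n < a + int N then \<mu> powi n else 0)" for n
  have \<mu>0: "\<mu> \<noteq> 0" using \<mu> by auto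
  have f_le: "cmod (f n) \<le> 1" for n using \<mu> by (simp add: f_def norm_power_int)
  have f: "f \<in> ell2" "(ell2_norm f)\<^sup>2 = real N"
  proof -
    have supp: "f n = 0" if "n \<notin> {a..<a + int N}" for n using that by (auto simp: f_def)
    show "f \<in> ell2" by (rule ell2_finite_support(1)[where F = "{a..<a + int N}", OF _ supp]) auto
    have "(ell2_norm f)\<^sup>2 = (\<Sum>n\<in>{a..<a + int N}. (cmod (f n))\<^sup>2)"
      by (rule ell2_finite_support(2)[where F = "{a..<a + int N}", OF _ supp]) auto
    also have "\<dots> = (\<Sum>n\<in>{a..<a + int N}. 1)"
      using \<mu> by (intro sum.cong) (auto simp: f_def norm_power_int)
    finally show "(ell2_norm f)\<^sup>2 = real N" by simp
  qed
  \<comment> \<open>The constant-coefficient part, which vanishes except at the ends of the window;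
    \<open>u\<close> and \<open>v\<close> collect the deviation of the coefficients from their
    limits.\<close>
  define P0 where "P0 n = z * f n - \<beta> * f (n - 1) + cnj \<beta> * f (n + 1)" for n
  \<comment> \<open>The thresholds match the support of \<open>f\<close>: \<open>f (n - 1)\<close>
    vanishes for \<open>n \<le> a\<close> and \<open>f (n + 1)\<close> for \<open>n < a - 1\<close>.
    Cutting off \<open>u\<close> and \<open>v\<close> there leaves \<open>hop u v f\<close>
    unchanged and makes both small everywhere.\<close>
  define u where "u n = (if n > a then \<beta> - of_real (h (n - 1)) * \<gamma> else 0)" for n
  define v where "v n = (if n \<ge> a - 1 then - (cnj \<beta> - of_real (h (n + 1)) * cnj \<gamma>) else 0)" for n
  define F where "F = {a - 1, a, a + int N - 1, a + int N}"
  have P0: "P0 n = 0" if "n \<notin> F" for n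
  proof -
    have "(n < a - 1 \<or> n > a + int N) \<or> a < n \<and> n < a + int N - 1"
      using that by (simp add: F_def) linarith
    then consider "n < a - 1 \<or> n > a + int N" | "a < n" "n < a + int N - 1" by blast
    then show ?thesis
    proof cases
      case 1
      then have "f n = 0" "f (n - 1) = 0" "f (n + 1) = 0" by (auto simp: f_def)
      then show ?thesis by (simp add: P0_def)
    next
      case 2
      then have "f n = \<mu> powi n" "f (n - 1) = \<mu> powi n / \<mu>" "f (n + 1) = \<mu> powi n * \<mu>"
        using \<mu>0 by (auto simp: f_def power_int_diff power_int_add)
      then have "P0 n = \<mu> powi n * (z - \<beta> / \<mu> + cnj \<beta> * \<mu>)"
        by (simp add: P0_def algebra_simps)
      then show ?thesis by (simp add: z \<beta>_def)
    qed
  qed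
  have P0ell2: "P0 \<in> ell2" and P0norm: "ell2_norm P0 \<le> 2 * K"
  proof -
    show "P0 \<in> ell2" by (rule ell2_finite_support(1)[where F = F, OF _ P0]) (auto simp: F_def)
    have le: "cmod (P0 n) \<le> K" for n
    proof -
      have "cmod (P0 n) \<le> cmod (z * f n) + cmod (\<beta> * f (n - 1)) + cmod (cnj \<beta> * f (n + 1))"
        unfolding P0_def by (rule norm_triangle_le, rule add_right_mono, rule norm_triangle_ineq4)
      also have "\<dots> \<le> cmod z * 1 + cmod \<beta> * 1 + cmod \<beta> * 1"
        unfolding norm_mult complex_mod_cnj by (intro add_mono mult_left_mono f_le) auto
      finally show ?thesis by (simp add: K_def)
    qed
    have "(ell2_norm P0)\<^sup>2 = (\<Sum>n\<in>F. (cmod (P0 n))\<^sup>2)"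
      by (rule ell2_finite_support(2)[where F = F, OF _ P0]) (auto simp: F_def)
    also have "\<dots> \<le> of_nat (card F) * K\<^sup>2"
      by (intro sum_bounded_above power_mono le) auto
    also have "card F \<le> 4" unfolding F_def by (intro order_trans[OF card_insert_le_m1]) auto
    then have "of_nat (card F) * K\<^sup>2 \<le> (2 * K)\<^sup>2"
      using mult_right_mono[of "of_nat (card F)" 4 "K\<^sup>2"] by (simp add: power_mult_distrib)
    finally show "ell2_norm P0 \<le> 2 * K"
      by (rule power2_le_imp_le) (simp add: K_def)
  qed
  have uv: "cmod (u n) \<le> \<epsilon>" "cmod (v n) \<le> \<epsilon>" for n
  proof -
    show "cmod (u n) \<le> \<epsilon>"
      using a[of "n - 1"] \<epsilon> by (auto simp: u_def \<beta>_def norm_minus_commute)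
    have "cmod (cnj \<beta> - of_real (h (n + 1)) * cnj \<gamma>) = cmod (cnj (\<beta> - of_real (h (n + 1)) * \<gamma>))"
      by simp
    also have "\<dots> = cmod (of_real (h (n + 1)) * \<gamma> - of_real c * \<gamma>)"
      unfolding complex_mod_cnj by (simp add: \<beta>_def norm_minus_commute)
    finally show "cmod (v n) \<le> \<epsilon>"
      using a[of "n + 1"] \<epsilon> 
      by (auto simp: v_def norm_minus_commute)
  qed
  have "pencil (line_op h \<gamma>) z f = (\<lambda>n. P0 n + hop u v f n)"
  proof
    fix n
    have "hop u v f n = (\<beta> - of_real (h (n - 1)) * \<gamma>) * f (n - 1)
        - (cnj \<beta> - of_real (h (n + 1)) * cnj \<gamma>) * f (n + 1)"
      by (auto simp: hop_def u_def v_def f_def algebra_simps)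
    then show "pencil (line_op h \<gamma>) z f n = P0 n + hop u v f n"
      by (simp add: pencil_def line_op_def hop_def P0_def algebra_simps)
  qed
  then have "ell2_norm (pencil (line_op h \<gamma>) z f) \<le> ell2_norm P0 + ell2_norm (hop u v f)"
    using ell2_norm_triangle[OF P0ell2 hop_ell2[OF f(1) uv]] by simp
  also have "\<dots> \<le> 2 * K + 2 * \<epsilon> * ell2_norm f"
    by (intro add_mono P0norm ell2_norm_hop_le f uv)
  finally have "C * ell2_norm (pencil (line_op h \<gamma>) z f) \<le> C * (2 * K + 2 * \<epsilon> * ell2_norm f)"
    using Cpos by (intro mult_left_mono) auto
  also have "\<dots> = 2 * K * C + ell2_norm f / 2" using Cpos by (simp add: \<epsilon>_def field_simps)
  finally have "ell2_norm f \<le> 4 * K * C" using C[OF f(1)] by linarith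
  then have "(ell2_norm f)\<^sup>2 \<le> (4 * K * C)\<^sup>2" by (intro power_mono) auto
  with f(2) N show False by linarith
qed

lemma segment_subset_spectrum_line_op:
  assumes lim: "(h \<longlongrightarrow> c) at_top" and h: "\<And>n. \<bar>h n\<bar> \<le> M" and c: "0 \<le> c"
  shows "- {z. gap (c * cmod \<gamma>) z > 0} \<subseteq> spectrum ell2 (line_op h \<gamma>)"
proof
  fix z assume "z \<in> - {z. gap (c * cmod \<gamma>) z > 0}"
  then have "z \<in> (\<lambda>t. \<i> * complex_of_real t) ` {- 2 * (c * cmod \<gamma>) .. 2 * (c * cmod \<gamma>)}"
    using segment_eq_gap[of "c * cmod \<gamma>"] c by simp
  then obtain t where t: "z = \<i> * of_real t" "\<bar>t\<bar> \<le> 2 * (c * cmod \<gamma>)" by auto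
  then obtain \<mu> where "cmod \<mu> = 1"
    "\<i> * of_real t = (of_real c * \<gamma>) / \<mu> - cnj (of_real c * \<gamma>) * \<mu>"
    using segment_point_unimodular[of t "of_real c * \<gamma>"] c by (auto simp: norm_mult)
  then show "z \<in> spectrum ell2 (line_op h \<gamma>)"
    using line_op_plane_wave_spectrum[OF lim h] t(1) by simp
qed

lemma line_op_resolvent_holomorphic:
  assumes h: "\<And>n. m \<le> h n" "\<And>n. h n \<le> M" and m: "0 < m" and g: "g \<in> ell2"
  shows "(\<lambda>z. resolvent ell2 (line_op h \<gamma>) z g i) holomorphic_on {z. gap (M * cmod \<gamma>) z > 0}"
proof -
  have M: "0 \<le> M" using h(1,2)[of 0] m by linarith
  show ?thesis
  proof (rule resolvent_holomorphic[OF linear_op_line_op open_gap _ _ _ g])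
    show "continuous_on {z. gap (M * cmod \<gamma>) z > 0} (\<lambda>z. sqrt (M / m) / gap (M * cmod \<gamma>) z)"
      by (intro continuous_intros continuous_on_gap) auto
  qed (use M line_op_resolvent_set[OF h m] line_op_resolvent_bound[OF h m] in auto)
qed

text \<open>Resetting \<open>h\<close> to \<open>M\<close> at \<open>e1\<close> and \<open>e2\<close> changes the operator by one of rank two.\<close>

lemma line_op_discrete:
  assumes h: "\<And>n. n \<noteq> e1 \<Longrightarrow> n \<noteq> e2 \<Longrightarrow> m \<le> h n" "\<And>n. n \<noteq> e1 \<Longrightarrow> n \<noteq> e2 \<Longrightarrow> h n \<le> M"
    and m: "0 < m" and e: "e1 \<noteq> e2" and z: "gap (M * cmod \<gamma>) z > 0"
  obtains r0 where "0 < r0" "cball z r0 \<inter> spectrum ell2 (line_op h \<gamma>) \<subseteq> {z}"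
    "\<And>r. 0 < r \<Longrightarrow> r \<le> r0 \<Longrightarrow> finite_dim (riesz_projection ell2 (line_op h \<gamma>) z r ` ell2)"
    "z \<in> spectrum ell2 (line_op h \<gamma>) \<Longrightarrow> z \<in> point_spectrum ell2 (line_op h \<gamma>)"
proof -
  define h0 where "h0 n = (if n = e1 \<or> n = e2 then M else h n)" for n
  define d where "d n = h n - h0 n" for n
  \<comment> \<open>Column \<open>e\<close> of the line operator with weights
    \<open>d\<close>.\<close>
  define k where "k e = (\<lambda>n. (if n = e + 1 then of_real (d e) * \<gamma> else 0)
    - (if n = e - 1 then of_real (d e) * cnj \<gamma> else 0))" for e
  obtain n0 where "n0 \<noteq> e1" "n0 \<noteq> e2"
    using that by (metis (full_types) add_cancel_left_right add_eq_0_iff e one_neq_neg_one zero_neq_one)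
  then have mM: "m \<le> M" using h order_trans by blast
  have h0: "m \<le> h0 n" "h0 n \<le> M" for n using h mM by (auto simp: h0_def)
  have h0': "\<bar>h0 n\<bar> \<le> M" for n using h0[of n] m by linarith
  have M: "0 \<le> M" using mM m by linarith
  have kell2: "k e \<in> ell2" for e
    by (rule ell2_finite_support(1)[of "{e + 1, e - 1}"]) (auto simp: k_def)
  have T_eq: "line_op h \<gamma> f = (\<lambda>n. line_op h0 \<gamma> f n + f e1 * k e1 n + f e2 * k e2 n)" for f
  proof
    fix n
    have d: "of_real (d l) * f l = (if l = e1 then of_real (d e1) * f e1 else 0)
        + (if l = e2 then of_real (d e2) * f e2 else 0)" for l
      using e by (auto simp: d_def h0_def)
    have "line_op h \<gamma> f n = line_op h0 \<gamma> f n + \<gamma> * (of_real (d (n - 1)) * f (n - 1))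
        - cnj \<gamma> * (of_real (d (n + 1)) * f (n + 1))"
      by (simp add: line_op_def hop_def d_def algebra_simps)
    also have "\<dots> = line_op h0 \<gamma> f n + f e1 * k e1 n + f e2 * k e2 n"
      by (subst d[of "n - 1"], subst d[of "n + 1"]) (auto simp: k_def algebra_simps)
    finally show "line_op h \<gamma> f n = line_op h0 \<gamma> f n + f e1 * k e1 n + f e2 * k e2 n" .
  qed
  define \<Omega> where "\<Omega> = {z. gap (M * cmod \<gamma>) z > 0}"
  interpret rank_two_perturbation "line_op h0 \<gamma>" "line_op h \<gamma>" \<Omega> "2 * (M * cmod \<gamma>)" e1 e2 "k e1" "k e2"
  proof
    show "open \<Omega>" "connected \<Omega>" "\<not> bounded \<Omega>"
      unfolding \<Omega>_def using M by (intro open_gap connected_gap unbounded_gap; simp)+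
    show "\<Omega> \<subseteq> resolvent_set ell2 (line_op h0 \<gamma>)"
      unfolding \<Omega>_def using line_op_resolvent_set[OF h0 m] by auto
    show "(\<lambda>z. resolvent ell2 (line_op h0 \<gamma>) z g i) holomorphic_on \<Omega>" if "g \<in> ell2" for g i
      unfolding \<Omega>_def by (rule line_op_resolvent_holomorphic[OF h0 m that])
  qed (use linear_op_line_op line_op_ell2[OF _ h0'] ell2_norm_line_op_le[OF _ h0'] kell2 T_eq in auto)
  have z\<Omega>: "z \<in> \<Omega>" using z by (simp add: \<Omega>_def)
  show ?thesis
    using isolated_finite_rank[OF z\<Omega>] spectrum_iff_det[OF z\<Omega>] that by metis
qed

section \<open>The degenerate segment and accumulation points of the spectrum\<close>

lemma not_finite_dim_ell2: "\<not> finite_dim (ell2 :: (int \<Rightarrow> complex) set)"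
proof
  assume "finite_dim (ell2 :: (int \<Rightarrow> complex) set)"
  then obtain B where B: "finite B" "(ell2 :: (int \<Rightarrow> complex) set) \<subseteq> cfun.span B"
    by (auto simp: finite_dim_def)
  define e :: "int \<Rightarrow> int \<Rightarrow> complex" where "e i = (\<lambda>j. if j = i then 1 else 0)" for i
  have inj: "inj e" by (auto simp: inj_def e_def fun_eq_iff split: if_splits)
  have "cfun.independent (range e)"
    unfolding cfun.dependent_explicit
  proof safe
    fix t u v assume t: "finite t" "t \<subseteq> range e" and s: "(\<Sum>v\<in>t. cscale (u v) v) = 0"
      and v: "v \<in> t" "u v \<noteq> 0"
    obtain i where i: "v = e i" using t v by blast
    have "0 = (\<Sum>v\<in>t. cscale (u v) v) i" using s by simp
    also have "\<dots> = (\<Sum>w\<in>t. if w = v then u v else 0)"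
      unfolding sum_fun_apply
    proof (intro sum.cong refl)
      fix w assume "w \<in> t"
      then obtain j where "w = e j" using t(2) by blast
      then show "cscale (u w) w i = (if w = v then u v else 0)"
        using inj by (auto simp: i inj_eq cscale_def) (auto simp: e_def)
    qed
    also have "\<dots> = u v" using t v by simp
    finally show False using v by simp
  qed
  moreover have "range e \<subseteq> cfun.span B"
    using B(2) ell2_finite_support(1)[of "{i}" "e i" for i] by (auto simp: e_def)
  ultimately show False
    using cfun.independent_span_bound[OF B(1), of "range e"] finite_imageD[of e UNIV] inj
    by (simp add: infinite_UNIV_int)
qed

text \<open>The operator is zero and its resolvent is division by \<open>z\<close>, so by Cauchy's
  formula the Riesz projection at 0 is the identity, of infinite rank.\<close>

lemma zero_notin_discrete_spectrum_line_op_0: "0 \<notin> discrete_spectrum ell2 (line_op h 0)"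
proof
  assume "0 \<in> discrete_spectrum ell2 (line_op h 0)"
  then obtain r where r: "r > 0" and fin: "finite_dim (riesz_projection ell2 (line_op h 0) 0 r ` ell2)"
    by (auto simp: discrete_spectrum_def)
  \<comment> \<open>With \<gamma> = 0 the weights have no effect; constant weights 1 meet the
    positivity condition under which the resolvent set is known.\<close>
  have T: "line_op h 0 = line_op (\<lambda>_. 1) 0" by (simp add: line_op_def)
  have res: "resolvent ell2 (line_op h 0) z f i = f i / z" if z: "z \<noteq> 0" and f: "f \<in> ell2" for z f i
  proof -
    have "gap (1 * cmod 0) z > 0" using z by (simp add: gap_pos_iff)
    then have "z \<in> resolvent_set ell2 (line_op h 0)"
      unfolding T using line_op_resolvent_set[of 1 "\<lambda>_. 1" 1 0 z] by simp
    then have "resolvent ell2 (line_op h 0) z f = (\<lambda>i. (1 / z) * f i)"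
      using z f by (intro resolvent_unique ell2_mult_left)
        (auto simp: pencil_def line_op_def hop_def)
    then show ?thesis by simp
  qed
  have "riesz_projection ell2 (line_op h 0) 0 r f = f" if f: "f \<in> ell2" for f
  proof
    fix i
    have "((\<lambda>z. f i / (z - 0)) has_contour_integral 2 * of_real pi * \<i> * f i) (circlepath 0 r)"
      using r by (intro Cauchy_integral_circlepath_simple) auto
    then have "((\<lambda>z. resolvent ell2 (line_op h 0) z f i) has_contour_integral
        2 * of_real pi * \<i> * f i) (circlepath 0 r)"
      by (rule has_contour_integral_eq) (use r res f in auto)
    then show "riesz_projection ell2 (line_op h 0) 0 r f i = f i"
      by (simp add: riesz_projection_def contour_integral_unique)
  qed
  then have "riesz_projection ell2 (line_op h 0) 0 r ` ell2 = ell2" by force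
  with fin show False by (simp add: not_finite_dim_ell2)
qed

text \<open>A connected set with more than one point has no isolated points; \<open>0 < b\<close>
  provides a second point.\<close>

lemma islimpt_segment:
  assumes "0 < b" "z \<in> - {z. gap b z > 0}"
  shows "z islimpt (- {z. gap b z > 0})"
proof -
  have "connected (- {z. gap b z > 0})"
    using assms unfolding segment_eq_gap[OF less_imp_le[OF assms(1)], symmetric]
    by (intro connected_continuous_image continuous_intros) auto
  moreover have "\<i> * of_real b \<in> - {z. gap b z > 0}" "0 \<in> - {z. gap b z > 0}"
    using assms(1) by (auto simp: gap_pos_iff norm_mult)
  moreover have "\<i> * of_real b \<noteq> 0" using assms(1) by simp
  ultimately show ?thesis
    using connected_imp_perfect[OF _ assms(2)] by (metis singletonD)
qed

lemma discrete_spectrum_isolated: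
  assumes "z \<in> discrete_spectrum D T"
  shows "\<not> z islimpt spectrum D T"
proof -
  obtain r where r: "r > 0" "spectrum D T \<inter> cball z r = {z}"
    using assms by (auto simp: discrete_spectrum_def)
  show ?thesis
    unfolding islimpt_approachable using r
    by (metis IntI dist_commute less_le_not_le linorder_le_less_linear mem_cball singletonD)
qed

text \<open>Off the segment the spectrum is discrete by the rank-two perturbation. Points of the
  segment are not isolated in it, unless \<gamma> = 0 and the segment is a single point.\<close>

theorem ess_spectrum_line_op:
  assumes lim: "(h \<longlongrightarrow> M) at_top"
    and h: "\<And>n. n \<noteq> e1 \<Longrightarrow> n \<noteq> e2 \<Longrightarrow> m \<le> h n" "\<And>n. n \<noteq> e1 \<Longrightarrow> n \<noteq> e2 \<Longrightarrow> h n \<le> M"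
    and m: "0 < m" and e: "e1 \<noteq> e2" and M: "0 < M"
  shows "ess_spectrum ell2 (line_op h \<gamma>) = - {z. gap (M * cmod \<gamma>) z > 0}"
proof -
  define T where "T = line_op h \<gamma>"
  define b where "b = M * cmod \<gamma>"
  have b: "0 \<le> b" using M by (simp add: b_def)
  have hb: "\<bar>h n\<bar> \<le> Max {M, \<bar>h e1\<bar>, \<bar>h e2\<bar>}" for n
  proof (cases "n = e1 \<or> n = e2")
    case False
    then have "\<bar>h n\<bar> \<le> M" using h[of n] m by auto
    then show ?thesis by simp
  qed auto
  have seg: "- {z. gap b z > 0} \<subseteq> spectrum ell2 T"
    unfolding T_def b_def using M by (intro segment_subset_spectrum_line_op[OF lim hb]) auto
  have "z \<in> discrete_spectrum ell2 T" if z: "z \<in> spectrum ell2 T" "gap b z > 0" for z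
  proof -
    obtain r0 where r0: "0 < r0" "cball z r0 \<inter> spectrum ell2 T \<subseteq> {z}"
      "\<And>r. 0 < r \<Longrightarrow> r \<le> r0 \<Longrightarrow> finite_dim (riesz_projection ell2 T z r ` ell2)"
      "z \<in> spectrum ell2 T \<Longrightarrow> z \<in> point_spectrum ell2 T"
      using line_op_discrete[of e1 e2 m h M \<gamma> z, OF h m e z(2)[unfolded b_def]] unfolding T_def by metis
    have "spectrum ell2 T \<inter> cball z r0 = {z}" using r0(1,2) z(1) by auto
    then show ?thesis unfolding discrete_spectrum_def using r0 z(1) by auto
  qed
  moreover have "z \<notin> discrete_spectrum ell2 T" if z: "z \<in> - {z. gap b z > 0}" for z
  proof (cases "\<gamma> = 0")
    case True
    then have "z = 0" using z by (simp add: gap_pos_iff b_def)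
    then show ?thesis using zero_notin_discrete_spectrum_line_op_0[of h] True by (simp add: T_def)
  next
    case False
    then have "0 < b" using M by (simp add: b_def)
    then have "z islimpt spectrum ell2 T"
      using islimpt_segment[OF _ z] islimpt_subset[OF _ seg] by blast
    then show ?thesis using discrete_spectrum_isolated by blast
  qed
  ultimately show ?thesis
    unfolding ess_spectrum_def T_def[symmetric] b_def[symmetric] using seg by blast
qed

section \<open>Lines in the lattice\<close>

lemma line_pt_line_pt: "line_pt p (line_pt p q k) n = line_pt p q (k + n)"
  by (simp add: line_pt_def algebra_simps)

lemma line_pt_0 [simp]: "line_pt p q 0 = q"
  by (simp add: line_pt_def)

lemma znorm_ge_1: "a \<noteq> 0 \<Longrightarrow> 1 \<le> znorm a"
  using znorm_sq_ge_1[of a] power2_le_imp_le[of 1 "znorm a"] by (simp add: znorm_def)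

lemma znorm_line_pt_ge:
  assumes "p \<noteq> 0"
  shows "\<bar>real_of_int n\<bar> - znorm q \<le> znorm (line_pt p q n)"
proof -
  have "\<bar>real_of_int n\<bar> * 1 \<le> \<bar>real_of_int n\<bar> * znorm p"
    by (intro mult_left_mono znorm_ge_1 assms) auto
  also have "\<dots> = norm (real_of_int n *\<^sub>R (real_of_int (fst p), real_of_int (snd p)))"
    by (simp only: norm_scaleR znorm_def)
  also have "real_of_int n *\<^sub>R (real_of_int (fst p), real_of_int (snd p))
      = (real_of_int (fst (line_pt p q n)), real_of_int (snd (line_pt p q n)))
        - (real_of_int (fst q), real_of_int (snd q))"
    by (simp add: line_pt_def)
  also have "norm \<dots> \<le> znorm (line_pt p q n) + znorm q"
    unfolding znorm_def by (rule norm_triangle_ineq4)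
  finally show ?thesis by simp
qed

text \<open>Only finitely many points of the line are no longer than \<open>q\<close>, so a minimum
  exists and the minimisers have a largest index. This is what makes \<open>GREATEST\<close> in
  \<open>qhat\<close> meaningful.\<close>

lemma minimal_line_pt:
  assumes p: "p \<noteq> 0"
  obtains n where "\<And>m. znorm (line_pt p q n) \<le> znorm (line_pt p q m)"
    "\<And>n'. (\<And>m. znorm (line_pt p q n') \<le> znorm (line_pt p q m)) \<Longrightarrow> n' \<le> n"
proof -
  define A where "A = {n. znorm (line_pt p q n) \<le> znorm q}"
  have "A \<subseteq> {- \<lceil>2 * znorm q\<rceil> .. \<lceil>2 * znorm q\<rceil>}"
  proof
    fix n assume "n \<in> A"
    then have "\<bar>real_of_int n\<bar> \<le> 2 * znorm q"
      using znorm_line_pt_ge[OF p, of n q] by (simp add: A_def)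
    then show "n \<in> {- \<lceil>2 * znorm q\<rceil> .. \<lceil>2 * znorm q\<rceil>}" by (auto simp: abs_le_iff) linarith+
  qed
  then have A: "finite A" using finite_subset by blast
  have A0: "0 \<in> A" by (simp add: A_def)
  define M where "M = {n. \<forall>m. znorm (line_pt p q n) \<le> znorm (line_pt p q m)}"
  have "M \<subseteq> A"
  proof
    fix n assume "n \<in> M"
    then have "znorm (line_pt p q n) \<le> znorm (line_pt p q 0)" unfolding M_def by blast
    then show "n \<in> A" by (simp add: A_def)
  qed
  then have "finite M" using A finite_subset by blast
  have "M \<noteq> {}"
  proof -
    have "Min ((\<lambda>n. znorm (line_pt p q n)) ` A) \<in> (\<lambda>n. znorm (line_pt p q n)) ` A"
      using A A0 by (intro Min_in) auto
    then obtain n where n: "n \<in> A" "znorm (line_pt p q n) = Min ((\<lambda>n. znorm (line_pt p q n)) ` A)"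
      by auto
    have "znorm (line_pt p q n) \<le> znorm (line_pt p q m)" for m
    proof (cases "m \<in> A")
      case True
      then show ?thesis unfolding n(2) using A by simp
    next
      case False
      then show ?thesis using n(1) by (simp add: A_def)
    qed
    then show ?thesis by (auto simp: M_def)
  qed
  then have "Max M \<in> M" "\<And>n'. n' \<in> M \<Longrightarrow> n' \<le> Max M" using \<open>finite M\<close> by auto
  then show ?thesis using that[of "Max M"] by (auto simp: M_def)
qed

lemma qhat_eqI:
  assumes "\<And>m. znorm (line_pt p q n) \<le> znorm (line_pt p q m)"
    "\<And>n'. (\<And>m. znorm (line_pt p q n') \<le> znorm (line_pt p q m)) \<Longrightarrow> n' \<le> n"
  shows "qhat p q = line_pt p q n"
proof -
  have "(GREATEST n. \<forall>m. znorm (line_pt p q n) \<le> znorm (line_pt p q m)) = n"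
    using assms by (intro Greatest_equality) auto
  then show ?thesis by (simp add: qhat_def)
qed

text \<open>Moving the base point along the line shifts all indices by the same \<open>k\<close>,
  which respects the tie-break in favour of the larger index.\<close>

lemma qhat_line_pt:
  assumes p: "p \<noteq> 0"
  shows "qhat p (line_pt p q k) = qhat p q"
proof -
  obtain n where n: "\<And>m. znorm (line_pt p q n) \<le> znorm (line_pt p q m)"
    "\<And>n'. (\<And>m. znorm (line_pt p q n') \<le> znorm (line_pt p q m)) \<Longrightarrow> n' \<le> n"
    using minimal_line_pt[OF p] by metis
  have "qhat p (line_pt p q k) = line_pt p (line_pt p q k) (n - k)"
  proof (rule qhat_eqI)
    show "znorm (line_pt p (line_pt p q k) (n - k)) \<le> znorm (line_pt p (line_pt p q k) m)" for m
      using n(1) by (simp add: line_pt_line_pt)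
    fix n' assume "\<And>m. znorm (line_pt p (line_pt p q k) n') \<le> znorm (line_pt p (line_pt p q k) m)"
    then have "znorm (line_pt p q (k + n')) \<le> znorm (line_pt p q (k + (m - k)))" for m
      unfolding line_pt_line_pt by blast
    then have "k + n' \<le> n" by (intro n(2)) simp
    then show "n' \<le> n - k" by simp
  qed
  also have "\<dots> = qhat p q" using qhat_eqI[OF n] by (simp add: line_pt_line_pt)
  finally show ?thesis .
qed

lemma qhat_on_line: "p \<noteq> 0 \<Longrightarrow> \<exists>n. qhat p q = line_pt p q n"
  by (simp add: qhat_def) blast

lemma
  assumes p: "p \<noteq> 0" and q: "q \<in> Qset p"
  shows qhat_Qset: "qhat p q = q"
    and Qset_minimal: "znorm q \<le> znorm (line_pt p q m)"
proof -
  obtain q' where q': "q = qhat p q'" using q by (auto simp: Qset_def)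
  then show 1: "qhat p q = q" using qhat_line_pt[OF p] qhat_on_line[OF p] by metis
  obtain n where n: "\<And>m. znorm (line_pt p q n) \<le> znorm (line_pt p q m)"
    "\<And>n'. (\<And>m. znorm (line_pt p q n') \<le> znorm (line_pt p q m)) \<Longrightarrow> n' \<le> n"
    using minimal_line_pt[OF p] by metis
  have "q = line_pt p q n" using qhat_eqI[OF n] 1 by simp
  then show "znorm q \<le> znorm (line_pt p q m)" using n(1) by metis
qed

lemma line_pt_eq_iff:
  assumes p: "p \<noteq> 0" shows "line_pt p q n = line_pt p q m \<longleftrightarrow> n = m"
  using assms by (auto simp: line_pt_def prod_eq_iff)

lemma bij_betw_line_pt:
  assumes p: "p \<noteq> 0"
  shows "bij_betw (\<lambda>(q, n). line_pt p q n) (Qset p \<times> UNIV) UNIV"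
proof (rule bij_betw_imageI)
  show "inj_on (\<lambda>(q, n). line_pt p q n) (Qset p \<times> UNIV)"
  proof (rule inj_onI, clarify)
    fix q n q' n' assume q: "q \<in> Qset p" "q' \<in> Qset p" and eq: "line_pt p q n = line_pt p q' n'"
    have "q = q'" using q eq qhat_line_pt[OF p] qhat_Qset[OF p] by metis
    then show "q = q' \<and> n = n'" using eq line_pt_eq_iff[OF p] by simp
  qed
  have "k \<in> (\<lambda>(q, n). line_pt p q n) ` (Qset p \<times> UNIV)" for k
  proof -
    obtain n where n: "qhat p k = line_pt p k n" using qhat_on_line[OF p] by blast
    then have "line_pt p (qhat p k) (- n) = k" by (simp add: line_pt_line_pt)
    then show ?thesis by (intro image_eqI[of _ _ "(qhat p k, - n)"]) (auto simp: Qset_def)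
  qed
  then show "(\<lambda>(q, n). line_pt p q n) ` (Qset p \<times> UNIV) = UNIV" by blast
qed

section \<open>Lattice points in discs and the integer-valued squared norm\<close>

lemma finite_znorm_le: "finite {q. znorm q \<le> B}"
proof (rule finite_subset)
  show "{q. znorm q \<le> B} \<subseteq> {- \<lceil>B\<rceil>..\<lceil>B\<rceil>} \<times> {- \<lceil>B\<rceil>..\<lceil>B\<rceil>}"
  proof
    fix q assume "q \<in> {q. znorm q \<le> B}"
    then have "\<bar>real_of_int (fst q)\<bar> \<le> B" "\<bar>real_of_int (snd q)\<bar> \<le> B"
      using norm_fst_le[of "real_of_int (fst q)" "real_of_int (snd q)"]
        norm_snd_le[of "real_of_int (snd q)" "real_of_int (fst q)"]
      by (auto simp: znorm_def)
    then show "q \<in> {- \<lceil>B\<rceil>..\<lceil>B\<rceil>} \<times> {- \<lceil>B\<rceil>..\<lceil>B\<rceil>}"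
      by (auto simp: mem_Times_iff abs_le_iff) linarith+
  qed
qed auto

text \<open>Constant along each line, so it factors out of the coefficients of a component; it
  vanishes when \<open>q\<close> and \<open>p\<close> are parallel.\<close>

definition cross :: "int \<times> int \<Rightarrow> int \<times> int \<Rightarrow> int"
  where "cross q p = fst q * snd p - snd q * fst p"

lemma cross_line_pt: "cross (line_pt p q n) p = cross q p"
  by (simp add: cross_def line_pt_def algebra_simps)

text \<open>Kept as an integer so that strict inequalities improve by 1; the uniform lower bound for
  the coefficients depends on this.\<close>

definition normsq :: "int \<times> int \<Rightarrow> int"
  where "normsq q = (fst q)\<^sup>2 + (snd q)\<^sup>2"

lemma znorm_power2: "(znorm q)\<^sup>2 = real_of_int (normsq q)"
  by (simp add: znorm_sq normsq_def)

lemma znorm_le_iff: "znorm q \<le> znorm q' \<longleftrightarrow> normsq q \<le> normsq q'"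
proof -
  have "znorm q \<le> znorm q' \<longleftrightarrow> (znorm q)\<^sup>2 \<le> (znorm q')\<^sup>2"
    by (simp add: znorm_def power2_le_iff_abs_le)
  then show ?thesis by (simp add: znorm_power2)
qed

lemma normsq_pos: "q \<noteq> 0 \<Longrightarrow> 0 < normsq q"
  by (auto simp: normsq_def sum_power2_gt_zero_iff prod_eq_iff)

lemma normsq_line_pt:
  "normsq (line_pt p q n) = normsq q + n * (n * normsq p + 2 * (fst q * fst p + snd q * snd p))"
  by (simp add: normsq_def line_pt_def power2_eq_square algebra_simps)

text \<open>A line not through the origin has at most two points in the disc of radius \<open>\<parallel>p\<parallel>\<close>.\<close>

lemma normsq_line_pt_gt:
  assumes p: "p \<noteq> 0" and q: "q \<in> Qset p" "q \<noteq> 0"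
  obtains e where "e \<noteq> 0" "\<And>n. n \<noteq> 0 \<Longrightarrow> n \<noteq> e \<Longrightarrow> normsq p + 1 \<le> normsq (line_pt p q n)"
proof -
  define x where "x = fst q * fst p + snd q * snd p"
  define P where "P = normsq p"
  have P: "0 < P" using normsq_pos[OF p] by (simp add: P_def)
  have line: "normsq (line_pt p q n) = normsq q + n * (n * P + 2 * x)" for n
    by (simp add: normsq_line_pt x_def P_def)
  have "normsq q \<le> normsq (line_pt p q n)" for n
    using Qset_minimal[OF p q(1)] znorm_le_iff by blast
  \<comment> \<open>Minimality against the two neighbours: the component of \<open>q\<close> along
    \<open>p\<close> is at most half the length of \<open>p\<close>.\<close>
  from this[of 1] this[of "-1"] have x: "2 * x \<le> P" "- 2 * x \<le> P" by (simp_all add: line)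
  \<comment> \<open>Stated for general \<open>y\<close>, so that reflecting both \<open>n\<close>
    and \<open>x\<close> covers the negative indices.\<close>
  have big: "P \<le> k * (k * P + 2 * y)" if "2 \<le> k" "- 2 * y \<le> P" for k y :: int
  proof -
    have "2 * P \<le> k * P" using that P by (intro mult_right_mono) auto
    then have *: "P \<le> k * P + 2 * y" using that by linarith
    then have "1 * (k * P + 2 * y) \<le> k * (k * P + 2 * y)" using that P by (intro mult_right_mono) auto
    then show ?thesis using * by simp
  qed
  \<comment> \<open>The neighbour reached by the step that makes an obtuse or right angle with
    \<open>q\<close>; the step to the opposite one adds at least \<open>P\<close> to the squared
    norm.\<close>
  define e :: int where "e = (if x < 0 then 1 else - 1)"
  show ?thesis
  proof
    show "e \<noteq> 0" by (simp add: e_def)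
    fix n :: int assume n: "n \<noteq> 0" "n \<noteq> e"
    have "P \<le> n * (n * P + 2 * x)"
    proof -
      consider "2 \<le> n" | "n \<le> - 2" | "n = 1" "0 \<le> x" | "n = - 1" "x < 0"
        using n unfolding e_def by (cases "x < 0") (auto, linarith+)
      then show ?thesis
      proof cases
        case 1 then show ?thesis using big[of n x] x by simp
      next
        case 2 then show ?thesis using big[of "- n" "- x"] x by (simp add: algebra_simps)
      qed auto
    qed
    \<comment> \<open>The summand 1 comes from \<open>q\<close>, whose squared norm is a positive
      integer.\<close>
    then show "normsq p + 1 \<le> normsq (line_pt p q n)"
      using normsq_pos[OF q(2)] unfolding line P_def[symmetric] by linarith
  qed
qed

section \<open>The components of the Euler operator\<close>

text \<open>The coefficient of the component divided by \<open>- cross q p\<close>; this sign makes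
  it positive outside the disc of radius \<parallel>p\<parallel>.\<close>

definition line_coef :: "int \<times> int \<Rightarrow> int \<times> int \<Rightarrow> int \<Rightarrow> real"
  where "line_coef p q n = 1 / 2 * (1 / (znorm p)\<^sup>2 - 1 / (znorm (line_pt p q n))\<^sup>2)"

text \<open>All exceptional cases in \<open>coefA\<close> force \<open>cross q p = 0\<close>, so the
  product formula holds without a case distinction.\<close>

lemma coefA_line_pt: "coefA (line_pt p q n) p = - real_of_int (cross q p) * line_coef p q n"
proof (cases "cross q p = 0")
  case True
  then have "cross (line_pt p q n) p = 0" by (simp add: cross_line_pt)
  then show ?thesis using True by (auto simp: coefA_def cross_def)
next
  case False
  then have "cross (line_pt p q n) p \<noteq> 0" by (simp add: cross_line_pt)
  then have "line_pt p q n \<noteq> p \<and> line_pt p q n \<noteq> - p \<and> line_pt p q n \<noteq> 0 \<and> p \<noteq> 0"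
    by (auto simp: cross_def)
  then have "coefA (line_pt p q n) p = 1/2 * (1 / (znorm (line_pt p q n))\<^sup>2 - 1 / (znorm p)\<^sup>2)
      * real_of_int (cross (line_pt p q n) p)"
    by (simp add: coefA_def cross_def)
  then show ?thesis unfolding cross_line_pt line_coef_def by (simp add: algebra_simps)
qed

lemma line_coef_tendsto:
  assumes p: "p \<noteq> 0"
  shows "(line_coef p q \<longlongrightarrow> 1 / (2 * (znorm p)\<^sup>2)) at_top"
proof -
  have "filterlim (\<lambda>n. - znorm q + real_of_int n) at_top at_top"
    by (intro filterlim_tendsto_add_at_top[OF tendsto_const] filterlim_real_of_int_at_top)
  then have "filterlim (\<lambda>n. znorm (line_pt p q n)) at_top at_top"
  proof (rule filterlim_at_top_mono)
    have "- znorm q + real_of_int n \<le> znorm (line_pt p q n)" for n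
      using znorm_line_pt_ge[OF p, of n q] by linarith
    then show "\<forall>\<^sub>F n in at_top. - znorm q + real_of_int n \<le> znorm (line_pt p q n)" by simp
  qed
  then have "filterlim (\<lambda>n. (znorm (line_pt p q n))\<^sup>2) at_top at_top"
    by (intro filterlim_pow_at_top) auto
  then have "((\<lambda>n. 1 / (znorm (line_pt p q n))\<^sup>2) \<longlongrightarrow> 0) at_top"
    using tendsto_inverse_0_at_top by (simp add: inverse_eq_divide)
  then have "((\<lambda>n. 1 / 2 * (1 / (znorm p)\<^sup>2 - 1 / (znorm (line_pt p q n))\<^sup>2))
      \<longlongrightarrow> 1 / 2 * (1 / (znorm p)\<^sup>2 - 0)) at_top"
    by (intro tendsto_intros)
  then show ?thesis by (simp add: line_coef_def[abs_def])
qed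

lemma line_coef_le: "line_coef p q n \<le> 1 / (2 * (znorm p)\<^sup>2)"
  by (simp add: line_coef_def)

text \<open>The value of the coefficient at squared norm \<open>(znorm p)\<^sup>2 + 1\<close>, the
  smallest integer above the disc.\<close>

definition coef_min :: "int \<times> int \<Rightarrow> real"
  where "coef_min p = 1 / (2 * (znorm p)\<^sup>2 * ((znorm p)\<^sup>2 + 1))"

lemma line_coef_ge:
  assumes p: "p \<noteq> 0" and n: "normsq p + 1 \<le> normsq (line_pt p q n)"
  shows "coef_min p \<le> line_coef p q n"
proof -
  define P where "P = (znorm p)\<^sup>2"
  have P: "P > 0" using znorm_ge_1[OF p] by (simp add: P_def)
  have "P + 1 \<le> (znorm (line_pt p q n))\<^sup>2"
    using n unfolding P_def znorm_power2 by linarith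
  then have "1 / (znorm (line_pt p q n))\<^sup>2 \<le> 1 / (P + 1)"
    using P by (intro frac_le) auto
  then have "1 / 2 * (1 / P - 1 / (P + 1)) \<le> line_coef p q n"
    unfolding line_coef_def P_def by simp
  moreover have "1 / 2 * (1 / P - 1 / (P + 1)) = coef_min p"
    using P by (simp add: coef_min_def P_def[symmetric] field_simps)
  ultimately show ?thesis by simp
qed

lemma coef_min_pos: "p \<noteq> 0 \<Longrightarrow> 0 < coef_min p"
  using znorm_ge_1[of p] by (auto simp: coef_min_def add_pos_nonneg intro!: divide_pos_pos mult_pos_pos)

text \<open>The parameter \<gamma> of the component is \<open>- cross q p * \<Gamma>\<close>;
  multiplied by the limit of \<open>line_coef\<close> it becomes \<open>betaq\<close>.\<close>

lemma euler_Lq_eq_line_op: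
  assumes "f \<in> ell2"
  shows "euler_Lq p \<Gamma> q f = line_op (line_coef p q) (- of_int (cross q p) * \<Gamma>) f"
  by (rule ext) (simp add: euler_Lq_apply[OF assms] line_op_def hop_def coefA_line_pt algebra_simps)

lemma cmod_betaq: "cmod (betaq p \<Gamma> q) = 1 / (2 * (znorm p)\<^sup>2) * cmod (- of_int (cross q p) * \<Gamma>)"
proof -
  have "betaq p \<Gamma> q = of_real (1 / (2 * (znorm p)\<^sup>2)) * (- of_int (cross q p) * \<Gamma>)"
    unfolding betaq_def cross_def[symmetric] by simp
  then show ?thesis by (simp only: norm_mult norm_of_real) simp
qed

lemma const_op_eq_line_op:
  assumes "f \<in> ell2"
  shows "const_op \<beta> f = line_op (\<lambda>_. 1) \<beta> f"
proof -
  have "cscale (cnj \<beta>) f \<in> ell2" unfolding cscale_def by (rule ell2_mult_left[OF assms])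
  then show ?thesis
    by (simp add: const_op_def ell2_adjoint_shiftV fun_eq_iff shiftV_def cscale_def line_op_def hop_def)
qed

lemma spectrum_const_op: "spectrum ell2 (const_op \<beta>) = - {z. gap (cmod \<beta>) z > 0}"
proof -
  have "spectrum ell2 (const_op \<beta>) = spectrum ell2 (line_op (\<lambda>_. 1) \<beta>)"
    by (rule resolvent_cong(2)) (rule const_op_eq_line_op)
  moreover have "- {z. gap (1 * cmod \<beta>) z > 0} \<subseteq> spectrum ell2 (line_op (\<lambda>_. 1) \<beta>)"
    by (rule segment_subset_spectrum_line_op[where M = 1]) auto
  moreover have "{z. gap (1 * cmod \<beta>) z > 0} \<subseteq> resolvent_set ell2 (line_op (\<lambda>_. 1) \<beta>)"
    using line_op_resolvent_set[of 1 "\<lambda>_. 1" 1 \<beta>] by auto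
  ultimately show ?thesis by (auto simp: spectrum_def)
qed

text \<open>
  On lines through the origin the operator vanishes, so there the coefficients may be replaced
  by their limit.
\<close>

lemma euler_Lq_line_opE:
  assumes p: "p \<noteq> 0" and q: "q \<in> Qset p"
  obtains h \<gamma> e where "\<And>f. f \<in> ell2 \<Longrightarrow> euler_Lq p \<Gamma> q f = line_op h \<gamma> f"
    "cmod (betaq p \<Gamma> q) = 1 / (2 * (znorm p)\<^sup>2) * cmod \<gamma>"
    "(h \<longlongrightarrow> 1 / (2 * (znorm p)\<^sup>2)) at_top" "\<And>n. h n \<le> 1 / (2 * (znorm p)\<^sup>2)"
    "e \<noteq> 0" "\<And>n. n \<noteq> 0 \<Longrightarrow> n \<noteq> e \<Longrightarrow> coef_min p \<le> h n"
    "\<And>n. znorm p < znorm q \<Longrightarrow> coef_min p \<le> h n"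
proof (cases "cross q p = 0")
  case True
  have P: "(znorm p)\<^sup>2 \<ge> 1" by (rule znorm_sq_ge_1[OF p])
  have "2 * (znorm p)\<^sup>2 * 1 \<le> 2 * (znorm p)\<^sup>2 * ((znorm p)\<^sup>2 + 1)"
    by (intro mult_left_mono) auto
  then have m: "coef_min p \<le> 1 / (2 * (znorm p)\<^sup>2)"
    unfolding coef_min_def using P by (intro frac_le) auto
  have "euler_Lq p \<Gamma> q f = line_op (\<lambda>_. 1 / (2 * (znorm p)\<^sup>2)) 0 f" if "f \<in> ell2" for f
    using euler_Lq_eq_line_op[OF that, of p \<Gamma> q] True by (simp add: line_op_def)
  then show ?thesis
    using True m cmod_betaq[of p \<Gamma> q] by (intro that[of "\<lambda>_. 1 / (2 * (znorm p)\<^sup>2)" 0 1]) auto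
next
  case False
  then have "q \<noteq> 0" by (auto simp: cross_def)
  then obtain e where e: "e \<noteq> 0" "\<And>n. n \<noteq> 0 \<Longrightarrow> n \<noteq> e \<Longrightarrow> normsq p + 1 \<le> normsq (line_pt p q n)"
    using normsq_line_pt_gt[OF p q] by metis
  show ?thesis
  proof (rule that[of "line_coef p q" "- of_int (cross q p) * \<Gamma>" e])
    \<comment> \<open>No point of the line is shorter than \<open>q\<close>, so none lies in the
      disc and no weight is exceptional.\<close>
    fix n assume "znorm p < znorm q"
    then have "\<not> znorm (line_pt p q n) \<le> znorm p" using Qset_minimal[OF p q, of n] by linarith
    then have "normsq p + 1 \<le> normsq (line_pt p q n)" by (simp add: znorm_le_iff)
    then show "coef_min p \<le> line_coef p q n" by (rule line_coef_ge[OF p])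
  qed (use e line_coef_ge[OF p] line_coef_le line_coef_tendsto[OF p] euler_Lq_eq_line_op cmod_betaq in auto)
qed

text \<open>The constant in the resolvent bound is the ratio \<open>(znorm p)\<^sup>2 + 1\<close> of
  the limit of the weights to \<open>coef_min\<close>. Estimating \<open>gap\<close> from below by
  \<bar>Re z\<bar> removes the dependence on \<open>betaq\<close>, hence on
  \<open>q\<close>.\<close>

lemma
  assumes p: "p \<noteq> 0" and q: "q \<in> Qset p"
  shows ess_spectrum_euler_Lq:
      "ess_spectrum ell2 (euler_Lq p \<Gamma> q) = - {z. gap (cmod (betaq p \<Gamma> q)) z > 0}"
    and euler_Lq_discrete: "gap (cmod (betaq p \<Gamma> q)) z > 0 \<Longrightarrow>
      \<exists>r0>0. cball z r0 \<inter> spectrum ell2 (euler_Lq p \<Gamma> q) \<subseteq> {z} \<and>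
        (\<forall>r. 0 < r \<and> r \<le> r0 \<longrightarrow> finite_dim (riesz_projection ell2 (euler_Lq p \<Gamma> q) z r ` ell2)) \<and>
        (z \<in> spectrum ell2 (euler_Lq p \<Gamma> q) \<longrightarrow> z \<in> point_spectrum ell2 (euler_Lq p \<Gamma> q))"
    and bounded_point_spectrum_euler_Lq: "bounded (point_spectrum ell2 (euler_Lq p \<Gamma> q))"
    and euler_Lq_resolvent_set:
      "znorm p < znorm q \<Longrightarrow> Re z \<noteq> 0 \<Longrightarrow> z \<in> resolvent_set ell2 (euler_Lq p \<Gamma> q)"
    and euler_Lq_resolvent_bound:
      "znorm p < znorm q \<Longrightarrow> Re z \<noteq> 0 \<Longrightarrow> f \<in> ell2 \<Longrightarrow> ell2_norm f
        \<le> sqrt ((znorm p)\<^sup>2 + 1) / \<bar>Re z\<bar> * ell2_norm (pencil (euler_Lq p \<Gamma> q) z f)"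
    and euler_Lq_resolvent_holomorphic:
      "znorm p < znorm q \<Longrightarrow> f \<in> ell2 \<Longrightarrow>
        (\<lambda>z. resolvent ell2 (euler_Lq p \<Gamma> q) z f i) holomorphic_on {z. Re z \<noteq> 0}"
proof -
  define M where "M = 1 / (2 * (znorm p)\<^sup>2)"
  have M: "0 < M" using znorm_ge_1[OF p] by (simp add: M_def)
  note m = coef_min_pos[OF p]
  obtain h \<gamma> e where L: "\<And>f. f \<in> ell2 \<Longrightarrow> euler_Lq p \<Gamma> q f = line_op h \<gamma> f"
    and \<beta>: "cmod (betaq p \<Gamma> q) = M * cmod \<gamma>"
    and lim: "(h \<longlongrightarrow> M) at_top" and hM: "\<And>n. h n \<le> M"
    and e: "0 \<noteq> e" and hm: "\<And>n. n \<noteq> 0 \<Longrightarrow> n \<noteq> e \<Longrightarrow> coef_min p \<le> h n"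
    and hm': "\<And>n. znorm p < znorm q \<Longrightarrow> coef_min p \<le> h n"
    using euler_Lq_line_opE[OF p q, of \<Gamma>] unfolding M_def by metis
  have cong: "resolvent_set ell2 (euler_Lq p \<Gamma> q) = resolvent_set ell2 (line_op h \<gamma>)"
    "spectrum ell2 (euler_Lq p \<Gamma> q) = spectrum ell2 (line_op h \<gamma>)"
    "point_spectrum ell2 (euler_Lq p \<Gamma> q) = point_spectrum ell2 (line_op h \<gamma>)"
    "ess_spectrum ell2 (euler_Lq p \<Gamma> q) = ess_spectrum ell2 (line_op h \<gamma>)"
    "riesz_projection ell2 (euler_Lq p \<Gamma> q) z r f = riesz_projection ell2 (line_op h \<gamma>) z r f"
    "resolvent ell2 (euler_Lq p \<Gamma> q) z f = resolvent ell2 (line_op h \<gamma>) z f" for z r f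
    by (rule resolvent_cong, rule L, assumption)+
  show "ess_spectrum ell2 (euler_Lq p \<Gamma> q) = - {z. gap (cmod (betaq p \<Gamma> q)) z > 0}"
    unfolding cong \<beta> by (rule ess_spectrum_line_op[OF lim _ _ m e M]) (use hm hM in auto)
  show "\<exists>r0>0. cball z r0 \<inter> spectrum ell2 (euler_Lq p \<Gamma> q) \<subseteq> {z} \<and>
      (\<forall>r. 0 < r \<and> r \<le> r0 \<longrightarrow> finite_dim (riesz_projection ell2 (euler_Lq p \<Gamma> q) z r ` ell2)) \<and>
      (z \<in> spectrum ell2 (euler_Lq p \<Gamma> q) \<longrightarrow> z \<in> point_spectrum ell2 (euler_Lq p \<Gamma> q))"
    if z: "gap (cmod (betaq p \<Gamma> q)) z > 0"
  proof -
    have "riesz_projection ell2 (euler_Lq p \<Gamma> q) z r = riesz_projection ell2 (line_op h \<gamma>) z r" for r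
      by (simp add: fun_eq_iff cong(5))
    then show ?thesis
      unfolding cong(1-3)
      using line_op_discrete[of 0 e "coef_min p" h M \<gamma> z, OF hm hM m e z[unfolded \<beta>]] by metis
  qed
  have hb: "\<bar>h n\<bar> \<le> Max {M, \<bar>h 0\<bar>, \<bar>h e\<bar>}" for n
  proof (cases "n = 0 \<or> n = e")
    case False
    then have "\<bar>h n\<bar> \<le> M" using hm[of n] hM[of n] m by auto
    then show ?thesis by simp
  qed auto
  have "cmod z \<le> 2 * (Max {M, \<bar>h 0\<bar>, \<bar>h e\<bar>} * cmod \<gamma>)"
    if "z \<in> point_spectrum ell2 (line_op h \<gamma>)" for z
    by (rule norm_point_spectrum_le[OF _ that]) (rule ell2_norm_line_op_le[OF _ hb])
  then show "bounded (point_spectrum ell2 (euler_Lq p \<Gamma> q))"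
    unfolding cong bounded_iff by blast
  show "z \<in> resolvent_set ell2 (euler_Lq p \<Gamma> q)" if pq: "znorm p < znorm q" and z: "Re z \<noteq> 0"
    unfolding cong by (rule line_op_resolvent_set[OF hm'[OF pq] hM m]) (use z in \<open>simp add: gap_pos_iff\<close>)
  show "ell2_norm f \<le> sqrt ((znorm p)\<^sup>2 + 1) / \<bar>Re z\<bar> * ell2_norm (pencil (euler_Lq p \<Gamma> q) z f)"
    if pq: "znorm p < znorm q" and z: "Re z \<noteq> 0" and f: "f \<in> ell2"
  proof -
    have "ell2_norm f \<le> sqrt (M / coef_min p) / gap (M * cmod \<gamma>) z * ell2_norm (pencil (line_op h \<gamma>) z f)"
      by (rule line_op_resolvent_bound[OF hm'[OF pq] hM m _ f]) (use z in \<open>simp add: gap_pos_iff\<close>)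
    also have "M / coef_min p = (znorm p)\<^sup>2 + 1"
      using znorm_ge_1[OF p] by (simp add: M_def coef_min_def)
    also have "sqrt ((znorm p)\<^sup>2 + 1) / gap (M * cmod \<gamma>) z * ell2_norm (pencil (line_op h \<gamma>) z f)
        \<le> sqrt ((znorm p)\<^sup>2 + 1) / \<bar>Re z\<bar> * ell2_norm (pencil (line_op h \<gamma>) z f)"
      using z gap_ge_abs_Re[of z "M * cmod \<gamma>"]
      by (intro mult_right_mono divide_left_mono) auto
    also have "pencil (line_op h \<gamma>) z f = pencil (euler_Lq p \<Gamma> q) z f"
      using L[OF f] by (simp add: pencil_def)
    finally show ?thesis .
  qed
  show "(\<lambda>z. resolvent ell2 (euler_Lq p \<Gamma> q) z f i) holomorphic_on {z. Re z \<noteq> 0}"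
    if pq: "znorm p < znorm q" and f: "f \<in> ell2"
    unfolding cong
    by (rule holomorphic_on_subset[OF line_op_resolvent_holomorphic[OF hm'[OF pq] hM m f]])
      (auto simp: gap_pos_iff)
qed

lemma segment_subset_spectrum_euler_Lq:
  assumes "p \<noteq> 0" "q \<in> Qset p"
  shows "- {z. gap (cmod (betaq p \<Gamma> q)) z > 0} \<subseteq> spectrum ell2 (euler_Lq p \<Gamma> q)"
  using ess_spectrum_euler_Lq[OF assms, of \<Gamma>] unfolding ess_spectrum_def by blast

section \<open>The direct sum decomposition\<close>

definition on_line :: "int \<times> int \<Rightarrow> int \<times> int \<Rightarrow> (int \<times> int \<Rightarrow> complex) \<Rightarrow> int \<Rightarrow> complex"
  where "on_line p q f = (\<lambda>n. f (line_pt p q n))"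

text \<open>Inverse to cutting a sequence into lines: \<open>k\<close> is located by its
  representative and by its index on that line, which is unique for
  \<open>p \<noteq> 0\<close>.\<close>

definition assemble :: "int \<times> int \<Rightarrow> (int \<times> int \<Rightarrow> int \<Rightarrow> complex) \<Rightarrow> int \<times> int \<Rightarrow> complex"
  where "assemble p u k = u (qhat p k) (THE n. line_pt p (qhat p k) n = k)"

lemma on_line_assemble:
  assumes p: "p \<noteq> 0" and q: "q \<in> Qset p"
  shows "on_line p q (assemble p u) = u q"
proof
  fix n
  have "qhat p (line_pt p q n) = q" using qhat_line_pt[OF p] qhat_Qset[OF p q] by metis
  then show "on_line p q (assemble p u) n = u q n"
    by (simp add: on_line_def assemble_def line_pt_eq_iff[OF p])
qed

lemma on_line_eqI:
  assumes p: "p \<noteq> 0" and eq: "\<And>q. q \<in> Qset p \<Longrightarrow> on_line p q f = on_line p q g"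
  shows "f = g"
proof
  fix k
  obtain q n where "q \<in> Qset p" "k = line_pt p q n"
    using bij_betw_imp_surj_on[OF bij_betw_line_pt[OF p]] by fastforce
  then show "f k = g k" using fun_cong[OF eq, of q n] by (simp add: on_line_def)
qed

lemma on_line_ell2:
  assumes p: "p \<noteq> 0" and f: "f \<in> ell2"
  shows "on_line p q f \<in> ell2"
proof -
  have inj: "inj (line_pt p q)" using line_pt_eq_iff[OF p] by (auto simp: inj_def)
  have "(\<lambda>k. (cmod (f k))\<^sup>2) summable_on range (line_pt p q)"
    by (rule summable_on_subset_banach[where A = UNIV]) (use f in \<open>auto simp: ell2_def\<close>)
  then show ?thesis
    using summable_on_reindex[OF inj, of "\<lambda>k. (cmod (f k))\<^sup>2"] by (simp add: ell2_def on_line_def o_def)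
qed

lemma ell2_from_lines:
  assumes p: "p \<noteq> 0" and f: "\<And>q. q \<in> Qset p \<Longrightarrow> on_line p q f \<in> ell2"
    and sum: "(\<lambda>q. (ell2_norm (on_line p q f))\<^sup>2) summable_on Qset p"
  shows "f \<in> ell2"
proof -
  have "(\<lambda>(q, n). (cmod (f (line_pt p q n)))\<^sup>2) summable_on Qset p \<times> UNIV"
  proof (rule summable_on_SigmaI[OF _ sum])
    fix q assume "q \<in> Qset p"
    then have "(\<lambda>n. (cmod (f (line_pt p q n)))\<^sup>2) summable_on UNIV"
      using f by (simp add: ell2_def on_line_def)
    then show "((\<lambda>n. case (q, n) of (q, n) \<Rightarrow> (cmod (f (line_pt p q n)))\<^sup>2)
        has_sum (ell2_norm (on_line p q f))\<^sup>2) UNIV"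
      by (simp add: ell2_norm_power2 on_line_def)
  qed auto
  then show ?thesis
    using summable_on_reindex_bij_betw[OF bij_betw_line_pt[OF p], of "\<lambda>k. (cmod (f k))\<^sup>2"]
    by (simp add: ell2_def case_prod_unfold)
qed

lemma
  assumes p: "p \<noteq> 0" and f: "f \<in> ell2"
  shows summable_on_lines: "(\<lambda>q. (ell2_norm (on_line p q f))\<^sup>2) summable_on Qset p"
    and ell2_norm_lines: "(ell2_norm f)\<^sup>2 = (\<Sum>\<^sub>\<infinity>q\<in>Qset p. (ell2_norm (on_line p q f))\<^sup>2)"
proof -
  define F where "F = (\<lambda>(q, n). (cmod (f (line_pt p q n)))\<^sup>2)"
  have s: "F summable_on Qset p \<times> UNIV"
    using f summable_on_reindex_bij_betw[OF bij_betw_line_pt[OF p], of "\<lambda>k. (cmod (f k))\<^sup>2"]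
    by (simp add: ell2_def case_prod_unfold F_def)
  have F: "(\<Sum>\<^sub>\<infinity>n. F (q, n)) = (ell2_norm (on_line p q f))\<^sup>2" for q
    by (simp add: F_def ell2_norm_power2 on_line_def)
  have "(\<lambda>n. F (q, n)) summable_on UNIV" for q
    using on_line_ell2[OF p f, of q] by (simp add: F_def ell2_def on_line_def)
  from summable_on_SigmaD[OF s this]
  show "(\<lambda>q. (ell2_norm (on_line p q f))\<^sup>2) summable_on Qset p" unfolding F .
  have "(ell2_norm f)\<^sup>2 = infsum F (Qset p \<times> UNIV)"
    using infsum_reindex_bij_betw[OF bij_betw_line_pt[OF p], of "\<lambda>k. (cmod (f k))\<^sup>2"]
    by (simp add: ell2_norm_power2 case_prod_unfold F_def)
  also have "\<dots> = (\<Sum>\<^sub>\<infinity>q\<in>Qset p. (ell2_norm (on_line p q f))\<^sup>2)"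
    using infsum_Sigma_banach[OF s] unfolding F by simp
  finally show "(ell2_norm f)\<^sup>2 = (\<Sum>\<^sub>\<infinity>q\<in>Qset p. (ell2_norm (on_line p q f))\<^sup>2)" .
qed

text \<open>Squared norms add up over the lines, so one constant for all lines passes to the whole
  sequence. This is where uniformity in \<open>q\<close> enters.\<close>

lemma
  assumes p: "p \<noteq> 0" and g: "g \<in> ell2" and C: "0 \<le> C"
    and f: "\<And>q. q \<in> Qset p \<Longrightarrow> on_line p q f \<in> ell2"
    and le: "\<And>q. q \<in> Qset p \<Longrightarrow> ell2_norm (on_line p q f) \<le> C * ell2_norm (on_line p q g)"
  shows ell2_lines_dominated: "f \<in> ell2"
    and ell2_norm_lines_dominated: "ell2_norm f \<le> C * ell2_norm g"
proof -
  have le2: "(ell2_norm (on_line p q f))\<^sup>2 \<le> C\<^sup>2 * (ell2_norm (on_line p q g))\<^sup>2" if "q \<in> Qset p" for q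
    using power_mono[OF le[OF that] ell2_norm_nonneg, of 2] by (simp add: power_mult_distrib)
  have sg: "(\<lambda>q. C\<^sup>2 * (ell2_norm (on_line p q g))\<^sup>2) summable_on Qset p"
    by (intro summable_on_cmult_right summable_on_lines p g)
  show fe: "f \<in> ell2"
    by (rule ell2_from_lines[OF p f summable_on_comparison_test[OF sg]]) (use le2 in auto)
  have "(ell2_norm f)\<^sup>2 \<le> (\<Sum>\<^sub>\<infinity>q\<in>Qset p. C\<^sup>2 * (ell2_norm (on_line p q g))\<^sup>2)"
    unfolding ell2_norm_lines[OF p fe]
    by (rule infsum_mono[OF summable_on_lines[OF p fe] sg]) (use le2 in auto)
  also have "\<dots> = (C * ell2_norm g)\<^sup>2"
    by (simp add: infsum_cmult_right' ell2_norm_lines[OF p g] power_mult_distrib)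
  finally show "ell2_norm f \<le> C * ell2_norm g"
    by (rule power2_le_imp_le) (use C in auto)
qed

section \<open>Embedding a single component\<close>

definition extend_line :: "int \<times> int \<Rightarrow> int \<times> int \<Rightarrow> (int \<Rightarrow> complex) \<Rightarrow> int \<times> int \<Rightarrow> complex"
  where "extend_line p q u = assemble p (\<lambda>q'. if q' = q then u else 0)"

lemma on_line_extend_line:
  assumes "p \<noteq> 0" "q' \<in> Qset p"
  shows "on_line p q' (extend_line p q u) = (if q' = q then u else 0)"
  unfolding extend_line_def by (rule on_line_assemble[OF assms])

lemma
  assumes p: "p \<noteq> 0" and q: "q \<in> Qset p" and u: "u \<in> ell2"
  shows extend_line_ell2: "extend_line p q u \<in> ell2"
    and ell2_norm_extend_line: "ell2_norm (extend_line p q u) = ell2_norm u"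
proof -
  have eq: "(ell2_norm (on_line p q' (extend_line p q u)))\<^sup>2 = (if q' = q then (ell2_norm u)\<^sup>2 else 0)"
    if "q' \<in> Qset p" for q'
    by (simp add: on_line_extend_line[OF p that])
  have "(\<lambda>q'. if q' = q then (ell2_norm u)\<^sup>2 else 0) summable_on {q}" by simp
  then have "(\<lambda>q'. if q' = q then (ell2_norm u)\<^sup>2 else 0) summable_on Qset p"
    by (rule summable_on_cong_neutral[THEN iffD1, rotated -1]) (use q in auto)
  then have "(\<lambda>q'. (ell2_norm (on_line p q' (extend_line p q u)))\<^sup>2) summable_on Qset p"
    using eq by (simp cong: summable_on_cong)
  then show e: "extend_line p q u \<in> ell2"
    by (rule ell2_from_lines[OF p, rotated]) (simp add: on_line_extend_line[OF p] u)
  have "(ell2_norm (extend_line p q u))\<^sup>2 = (\<Sum>\<^sub>\<infinity>q'\<in>Qset p. if q' = q then (ell2_norm u)\<^sup>2 else 0)"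
    unfolding ell2_norm_lines[OF p e] by (rule infsum_cong) (rule eq)
  also have "\<dots> = (\<Sum>\<^sub>\<infinity>q'\<in>{q}. (ell2_norm u)\<^sup>2)"
    by (rule infsum_cong_neutral) (use q in auto)
  finally show "ell2_norm (extend_line p q u) = ell2_norm u" by simp
qed

lemma euler_Lq_ell2:
  assumes "u \<in> ell2" shows "euler_Lq p \<Gamma> q u \<in> ell2"
proof -
  \<comment> \<open>The origin is included: there the quotient is a division by zero, with value
    0.\<close>
  have le: "0 \<le> 1 / (znorm a)\<^sup>2 \<and> 1 / (znorm a)\<^sup>2 \<le> 1" for a
  proof (cases "a = 0")
    case False
    then show ?thesis using znorm_sq_ge_1[of a] by (simp add: divide_le_eq)
  qed (simp add: znorm_def)
  have "\<bar>line_coef p q n\<bar> \<le> 1" for n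
  proof -
    have "\<bar>1 / 2 * (u - v)\<bar> \<le> 1" if "0 \<le> u \<and> u \<le> 1" "0 \<le> v \<and> v \<le> 1" for u v :: real
      using that by (auto simp: abs_le_iff)
    then show ?thesis unfolding line_coef_def using le by blast
  qed
  then show ?thesis unfolding euler_Lq_eq_line_op[OF assms] by (rule line_op_ell2[OF assms])
qed

lemma on_line_euler_L:
  assumes "p \<noteq> 0" "f \<in> ell2"
  shows "on_line p q (euler_L p \<Gamma> f) = euler_Lq p \<Gamma> q (on_line p q f)"
  using euler_L_line[of f p q \<Gamma>] on_line_ell2[OF assms, of q] by (auto simp: on_line_def)

lemma on_line_pencil:
  assumes "p \<noteq> 0" "f \<in> ell2"
  shows "on_line p q (pencil (euler_L p \<Gamma>) z f) = pencil (euler_Lq p \<Gamma> q) z (on_line p q f)"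
  using on_line_euler_L[OF assms, of q \<Gamma>] by (auto simp: pencil_def on_line_def fun_eq_iff)

lemma euler_Lq_zero: "euler_Lq p \<Gamma> q 0 = 0"
  using euler_Lq_eq_line_op[OF ell2_zero(1), of p \<Gamma> q] by (simp add: line_op_def hop_def fun_eq_iff)

lemma
  assumes p: "p \<noteq> 0" and q: "q \<in> Qset p" and u: "u \<in> ell2"
  shows euler_L_extend_line:
      "euler_L p \<Gamma> (extend_line p q u) = extend_line p q (euler_Lq p \<Gamma> q u)"
    and extend_line_euler_dom: "extend_line p q u \<in> euler_dom p \<Gamma>"
    and pencil_extend_line:
      "pencil (euler_L p \<Gamma>) z (extend_line p q u) = extend_line p q (pencil (euler_Lq p \<Gamma> q) z u)"
proof -
  note e = extend_line_ell2[OF p q u]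
  show L: "euler_L p \<Gamma> (extend_line p q u) = extend_line p q (euler_Lq p \<Gamma> q u)"
    by (rule on_line_eqI[OF p]) (simp add: on_line_euler_L[OF p e] on_line_extend_line[OF p] euler_Lq_zero)
  show "extend_line p q u \<in> euler_dom p \<Gamma>"
    by (simp add: euler_dom_def L e extend_line_ell2[OF p q euler_Lq_ell2[OF u]])
  show "pencil (euler_L p \<Gamma>) z (extend_line p q u) = extend_line p q (pencil (euler_Lq p \<Gamma> q) z u)"
    by (rule on_line_eqI[OF p])
      (simp add: on_line_pencil[OF p e] on_line_extend_line[OF p], simp add: pencil_def euler_Lq_zero fun_eq_iff)
qed

lemma extend_line_inj:
  assumes "p \<noteq> 0" "q \<in> Qset p" "extend_line p q u = extend_line p q v" shows "u = v"
  using assms on_line_extend_line[OF assms(1,2)] by metis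

text \<open>Sequences on one line reduce the operator: extension by zero transports injectivity and
  the norm bound to the component, restriction transports surjectivity.\<close>

lemma resolvent_set_euler_LD:
  assumes p: "p \<noteq> 0" and q: "q \<in> Qset p" and z: "z \<in> resolvent_set (euler_dom p \<Gamma>) (euler_L p \<Gamma>)"
  shows "z \<in> resolvent_set ell2 (euler_Lq p \<Gamma> q)"
proof -
  define L where "L = euler_L p \<Gamma>"
  define T where "T = euler_Lq p \<Gamma> q"
  obtain C where bij: "bij_betw (pencil L z) (euler_dom p \<Gamma>) ell2"
    and C: "\<And>f. f \<in> euler_dom p \<Gamma> \<Longrightarrow> ell2_norm f \<le> C * ell2_norm (pencil L z f)"
    using z by (auto simp: resolvent_set_def L_def)
  note ext = pencil_extend_line[OF p q, of _ \<Gamma> z, folded L_def T_def]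
  note dom = extend_line_euler_dom[OF p q, of _ \<Gamma>]
  have pT: "pencil T z u \<in> ell2" if "u \<in> ell2" for u
    unfolding pencil_def T_def by (intro ell2_diff ell2_mult_left euler_Lq_ell2 that)
  have "inj_on (pencil T z) ell2"
  proof (rule inj_onI)
    fix u v assume uv: "u \<in> ell2" "v \<in> ell2" "pencil T z u = pencil T z v"
    then have "pencil L z (extend_line p q u) = pencil L z (extend_line p q v)" by (simp add: ext)
    then have "extend_line p q u = extend_line p q v"
      using bij dom uv unfolding bij_betw_def inj_on_def by blast
    then show "u = v" by (rule extend_line_inj[OF p q])
  qed
  moreover have "g \<in> pencil T z ` ell2" if g: "g \<in> ell2" for g
  proof -
    obtain f where f: "f \<in> euler_dom p \<Gamma>" "pencil L z f = extend_line p q g"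
      using bij extend_line_ell2[OF p q g] unfolding bij_betw_def by (metis imageE)
    have fe: "f \<in> ell2" using f(1) by (simp add: euler_dom_def)
    have "pencil T z (on_line p q f) = on_line p q (extend_line p q g)"
      using on_line_pencil[OF p fe, of q \<Gamma> z] f(2) by (simp add: L_def T_def)
    also have "\<dots> = g" by (simp add: on_line_extend_line[OF p q])
    finally show ?thesis using on_line_ell2[OF p fe, of q] by blast
  qed
  moreover have "ell2_norm u \<le> C * ell2_norm (pencil T z u)" if u: "u \<in> ell2" for u
    using C[OF dom[OF u]] ell2_norm_extend_line[OF p q] u pT[OF u] by (simp add: ext)
  ultimately show ?thesis
    using pT unfolding resolvent_set_def bij_betw_def T_def[symmetric] by blast
qed

text \<open>A common constant \<open>C\<close> serves twice: it makes the assembled componentwise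
  solutions square-summable, and it is the bound of the resolvent.\<close>

lemma resolvent_set_euler_LI:
  assumes p: "p \<noteq> 0" and C: "0 \<le> C"
    and res: "\<And>q. q \<in> Qset p \<Longrightarrow> z \<in> resolvent_set ell2 (euler_Lq p \<Gamma> q)"
    and bound: "\<And>q u. q \<in> Qset p \<Longrightarrow> u \<in> ell2 \<Longrightarrow> ell2_norm u \<le> C * ell2_norm (pencil (euler_Lq p \<Gamma> q) z u)"
  shows "z \<in> resolvent_set (euler_dom p \<Gamma>) (euler_L p \<Gamma>)"
proof -
  define L where "L = euler_L p \<Gamma>"
  have dom: "f \<in> ell2" "pencil L z f \<in> ell2" if "f \<in> euler_dom p \<Gamma>" for f
    using that unfolding euler_dom_def pencil_def L_def by (auto intro!: ell2_diff ell2_mult_left)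
  have pencil: "on_line p q (pencil L z f) = pencil (euler_Lq p \<Gamma> q) z (on_line p q f)" if "f \<in> ell2" for f q
    unfolding L_def by (rule on_line_pencil[OF p that])
  have "inj_on (pencil L z) (euler_dom p \<Gamma>)"
  proof (rule inj_onI, rule on_line_eqI[OF p])
    fix f g q assume fg: "f \<in> euler_dom p \<Gamma>" "g \<in> euler_dom p \<Gamma>" "pencil L z f = pencil L z g"
      and q: "q \<in> Qset p"
    have "pencil (euler_Lq p \<Gamma> q) z (on_line p q f) = pencil (euler_Lq p \<Gamma> q) z (on_line p q g)"
      using pencil[of f q] pencil[of g q] dom(1) fg by simp
    then show "on_line p q f = on_line p q g"
      using resolvent_pencil[OF res[OF q]] on_line_ell2[OF p] dom(1) fg by metis
  qed
  moreover have "g \<in> pencil L z ` euler_dom p \<Gamma>" if g: "g \<in> ell2" for g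
  proof -
    define f where "f = assemble p (\<lambda>q. resolvent ell2 (euler_Lq p \<Gamma> q) z (on_line p q g))"
    have fl: "on_line p q f = resolvent ell2 (euler_Lq p \<Gamma> q) z (on_line p q g)" if "q \<in> Qset p" for q
      unfolding f_def by (rule on_line_assemble[OF p that])
    have fl_ell2: "on_line p q f \<in> ell2" if "q \<in> Qset p" for q
      unfolding fl[OF that] by (rule resolvent_in[OF res[OF that] on_line_ell2[OF p g]])
    have pfl: "pencil (euler_Lq p \<Gamma> q) z (on_line p q f) = on_line p q g" if "q \<in> Qset p" for q
      unfolding fl[OF that] by (rule pencil_resolvent[OF res[OF that] on_line_ell2[OF p g]])
    have "ell2_norm (on_line p q f) \<le> C * ell2_norm (on_line p q g)" if "q \<in> Qset p" for q
      using bound[OF that fl_ell2[OF that]] unfolding pfl[OF that] .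
    then have f: "f \<in> ell2" by (intro ell2_lines_dominated[OF p g C fl_ell2])
    have eq: "pencil L z f = g"
      by (rule on_line_eqI[OF p]) (simp add: pencil[OF f] pfl)
    \<comment> \<open>Expressing \<open>L f\<close> through \<open>f\<close> and \<open>g\<close>
      shows that it is square-summable, which puts \<open>f\<close> into the maximal domain.\<close>
    have "L f = (\<lambda>i. z * f i - g i)"
      unfolding eq[symmetric] by (simp add: pencil_def)
    then have "L f \<in> ell2" using ell2_diff[OF ell2_mult_left[OF f] g] by simp
    then have "f \<in> euler_dom p \<Gamma>" using f by (simp add: euler_dom_def L_def)
    then show ?thesis using eq by blast
  qed
  moreover have "ell2_norm f \<le> C * ell2_norm (pencil L z f)" if f: "f \<in> euler_dom p \<Gamma>" for f
    by (rule ell2_norm_lines_dominated[OF p dom(2)[OF f] C])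
      (use bound on_line_ell2[OF p dom(1)[OF f]] pencil[OF dom(1)[OF f]] in auto)
  ultimately show ?thesis
    using dom(2) unfolding resolvent_set_def bij_betw_def L_def[symmetric] by blast
qed

text \<open>Finitely many lines with \<parallel>q\<parallel> \<le> \<parallel>p\<parallel>
  contribute constants of their own; all others share the bound that depends on \<open>p\<close> and
  \<open>z\<close> only.\<close>

lemma resolvent_set_euler_L_off_axis:
  assumes p: "p \<noteq> 0" and z: "Re z \<noteq> 0"
    and res: "\<And>q. q \<in> Qset p \<Longrightarrow> znorm q \<le> znorm p \<Longrightarrow> z \<in> resolvent_set ell2 (euler_Lq p \<Gamma> q)"
  shows "z \<in> resolvent_set (euler_dom p \<Gamma>) (euler_L p \<Gamma>)"
proof -
  define F where "F = {q \<in> Qset p. znorm q \<le> znorm p}"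
  have F: "finite F" unfolding F_def by (rule finite_subset[OF _ finite_znorm_le]) auto
  have "\<forall>q\<in>F. \<exists>c. \<forall>u\<in>ell2. ell2_norm u \<le> c * ell2_norm (pencil (euler_Lq p \<Gamma> q) z u)"
    using res by (auto simp: F_def resolvent_set_def)
  then obtain c where c: "\<And>q u. q \<in> F \<Longrightarrow> u \<in> ell2 \<Longrightarrow>
      ell2_norm u \<le> c q * ell2_norm (pencil (euler_Lq p \<Gamma> q) z u)" by metis
  define C where "C = sqrt ((znorm p)\<^sup>2 + 1) / \<bar>Re z\<bar> + (\<Sum>q\<in>F. \<bar>c q\<bar>)"
  have C: "sqrt ((znorm p)\<^sup>2 + 1) / \<bar>Re z\<bar> \<le> C" "0 \<le> C"
    unfolding C_def by (auto intro!: add_nonneg_nonneg sum_nonneg)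
  have cC: "c q \<le> C" if "q \<in> F" for q
  proof -
    have "c q \<le> \<bar>c q\<bar>" by simp
    also have "\<dots> \<le> (\<Sum>q\<in>F. \<bar>c q\<bar>)" by (rule member_le_sum[OF that _ F]) auto
    also have "\<dots> \<le> C" by (simp add: C_def)
    finally show ?thesis .
  qed
  show ?thesis
  proof (rule resolvent_set_euler_LI[OF p C(2)])
    fix q assume q: "q \<in> Qset p"
    show "z \<in> resolvent_set ell2 (euler_Lq p \<Gamma> q)"
      using res[OF q] euler_Lq_resolvent_set[OF p q _ z] by fastforce
    fix u :: "int \<Rightarrow> complex" assume u: "u \<in> ell2"
    show "ell2_norm u \<le> C * ell2_norm (pencil (euler_Lq p \<Gamma> q) z u)"
    proof (cases "q \<in> F")
      case True
      show ?thesis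
        by (rule order_trans[OF c[OF True u] mult_right_mono[OF cC[OF True] ell2_norm_nonneg]])
    next
      case False
      then have "znorm p < znorm q" using q by (simp add: F_def)
      from euler_Lq_resolvent_bound[OF p q this z u] mult_right_mono[OF C(1) ell2_norm_nonneg]
      show ?thesis by (rule order_trans)
    qed
  qed
qed

text \<open>The numbers \<open>\<bar>\<beta>(q)\<bar>\<close> are unbounded, so that the segments exhaust the imaginary axis.\<close>

lemma imaginary_axis_in_segment:
  assumes p: "p \<noteq> 0" and \<Gamma>: "\<Gamma> \<noteq> 0" and z: "Re z = 0"
  obtains q where "q \<in> Qset p" "0 < cmod (betaq p \<Gamma> q)" "z \<in> - {z. gap (cmod (betaq p \<Gamma> q)) z > 0}"
proof -
  define N where "N = nat \<lceil>cmod z / cmod \<Gamma>\<rceil> + 1"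
  \<comment> \<open>A multiple of \<open>p\<close> rotated by a right angle, so that the cross
    product is \<open>N\<close> times the squared norm of \<open>p\<close>; passing to the
    representative of the line preserves it.\<close>
  define q0 where "q0 = (int N * snd p, - int N * fst p)"
  have "cross (qhat p q0) p = cross q0 p"
    using qhat_on_line[OF p, of q0] cross_line_pt by metis
  also have "\<dots> = int N * normsq p"
    by (simp add: cross_def q0_def normsq_def power2_eq_square algebra_simps)
  finally have "real_of_int (cross (qhat p q0) p) = real N * (znorm p)\<^sup>2"
    by (simp add: znorm_power2)
  moreover have "cmod (complex_of_int (cross (qhat p q0) p)) = \<bar>real_of_int (cross (qhat p q0) p)\<bar>"
    by (rule norm_of_int)
  ultimately have b: "2 * cmod (betaq p \<Gamma> (qhat p q0)) = real N * cmod \<Gamma>"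
    using znorm_ge_1[OF p] by (simp add: cmod_betaq norm_mult abs_mult)
  have N: "cmod z / cmod \<Gamma> \<le> real N" "0 < real N" unfolding N_def by linarith+
  have "cmod z \<le> real N * cmod \<Gamma>" using N(1) \<Gamma> by (simp add: divide_le_eq)
  moreover have "0 < real N * cmod \<Gamma>" using N(2) \<Gamma> by simp
  ultimately have "0 < cmod (betaq p \<Gamma> (qhat p q0))"
    "z \<in> - {z. gap (cmod (betaq p \<Gamma> (qhat p q0))) z > 0}"
    using b z by (auto simp: gap_pos_iff)
  then show ?thesis using that[of "qhat p q0"] by (simp add: Qset_def)
qed

text \<open>The uniform resolvent bound degenerates on the imaginary axis, but there each point lies
  in the segment of some component.\<close>

lemma spectrum_euler_L:
  assumes p: "p \<noteq> 0" and \<Gamma>: "\<Gamma> \<noteq> 0"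
  shows "spectrum (euler_dom p \<Gamma>) (euler_L p \<Gamma>) = (\<Union>q\<in>Qset p. spectrum ell2 (euler_Lq p \<Gamma> q))"
proof (intro equalityI subsetI)
  fix z assume "z \<in> (\<Union>q\<in>Qset p. spectrum ell2 (euler_Lq p \<Gamma> q))"
  then show "z \<in> spectrum (euler_dom p \<Gamma>) (euler_L p \<Gamma>)"
    using resolvent_set_euler_LD[OF p] by (auto simp: spectrum_def)
next
  fix z assume z: "z \<in> spectrum (euler_dom p \<Gamma>) (euler_L p \<Gamma>)"
  show "z \<in> (\<Union>q\<in>Qset p. spectrum ell2 (euler_Lq p \<Gamma> q))"
  proof (cases "Re z = 0")
    case True
    obtain q where "q \<in> Qset p" "z \<in> - {z. gap (cmod (betaq p \<Gamma> q)) z > 0}"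
      using imaginary_axis_in_segment[OF p \<Gamma> True] .
    then show ?thesis using segment_subset_spectrum_euler_Lq[OF p, of q \<Gamma>] by blast
  next
    case False
    then show ?thesis
      using z resolvent_set_euler_L_off_axis[OF p False] unfolding spectrum_def by blast
  qed
qed

section \<open>Eigenvalues and Riesz projections of the direct sum\<close>

lemma point_spectrum_euler_Lq_extend:
  assumes p: "p \<noteq> 0" and q: "q \<in> Qset p" and z: "z \<in> point_spectrum ell2 (euler_Lq p \<Gamma> q)"
  shows "z \<in> point_spectrum (euler_dom p \<Gamma>) (euler_L p \<Gamma>)"
proof -
  obtain u where u: "u \<in> ell2" "u \<noteq> 0" "euler_Lq p \<Gamma> q u = cscale z u"
    using z by (auto simp: point_spectrum_def)
  have "extend_line p q u \<noteq> 0"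
  proof
    assume "extend_line p q u = 0"
    then have "on_line p q (extend_line p q u) = 0" by (simp add: on_line_def zero_fun_def)
    then show False using u(2) by (simp add: on_line_extend_line[OF p q])
  qed
  moreover have "euler_L p \<Gamma> (extend_line p q u) = cscale z (extend_line p q u)"
    unfolding euler_L_extend_line[OF p q u(1)] u(3)
    by (auto simp: extend_line_def assemble_def cscale_def fun_eq_iff)
  ultimately show ?thesis
    using extend_line_euler_dom[OF p q u(1)] unfolding point_spectrum_def by blast
qed

text \<open>An eigenfunction restricts to an eigenfunction on some line where it is non-zero. If
  \<parallel>q\<parallel> > \<parallel>p\<parallel>, the resolvent bound with vanishing right-hand
  side would annihilate the restriction.\<close>

lemma point_spectrum_euler_L:
  assumes p: "p \<noteq> 0"
  shows "point_spectrum (euler_dom p \<Gamma>) (euler_L p \<Gamma>) - {z. Re z = 0} =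
    (\<Union>q\<in>{q \<in> Qset p. znorm q \<le> znorm p}. point_spectrum ell2 (euler_Lq p \<Gamma> q) - {z. Re z = 0})"
proof (intro equalityI subsetI)
  fix z assume "z \<in> point_spectrum (euler_dom p \<Gamma>) (euler_L p \<Gamma>) - {z. Re z = 0}"
  then obtain f where f: "f \<in> euler_dom p \<Gamma>" "f \<noteq> 0" "euler_L p \<Gamma> f = cscale z f" and z: "Re z \<noteq> 0"
    by (auto simp: point_spectrum_def)
  have fe: "f \<in> ell2" using f(1) by (simp add: euler_dom_def)
  have "\<exists>q\<in>Qset p. on_line p q f \<noteq> 0"
  proof (rule ccontr)
    assume "\<not> ?thesis"
    then have "f = 0" by (intro on_line_eqI[OF p]) (auto simp: on_line_def fun_eq_iff)
    with f(2) show False by simp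
  qed
  then obtain q where q: "q \<in> Qset p" "on_line p q f \<noteq> 0" by blast
  note fl = on_line_ell2[OF p fe, of q]
  have eq: "euler_Lq p \<Gamma> q (on_line p q f) = cscale z (on_line p q f)"
    using on_line_euler_L[OF p fe, of q \<Gamma>] f(3) by (simp add: on_line_def cscale_def)
  have "znorm q \<le> znorm p"
  proof (rule ccontr)
    assume "\<not> znorm q \<le> znorm p"
    then have "znorm p < znorm q" by simp
    from euler_Lq_resolvent_bound[OF p q(1) this z fl, of \<Gamma>]
    have "ell2_norm (on_line p q f) \<le> 0" by (simp add: pencil_def eq cscale_def)
    then have "ell2_norm (on_line p q f) = 0" by (simp add: antisym)
    then show False using q(2) ell2_norm_eq_0_iff[OF fl] by simp
  qed
  moreover have "z \<in> point_spectrum ell2 (euler_Lq p \<Gamma> q)"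
    using fl q(2) eq unfolding point_spectrum_def by blast
  ultimately show "z \<in> (\<Union>q\<in>{q \<in> Qset p. znorm q \<le> znorm p}.
      point_spectrum ell2 (euler_Lq p \<Gamma> q) - {z. Re z = 0})"
    using q(1) z by blast
qed (use point_spectrum_euler_Lq_extend[OF p] in auto)

text \<open>Restriction to a line commutes with the pencils, hence with their inverses; integrating
  over a circle carries this over to Riesz projections.\<close>

lemma on_line_resolvent:
  assumes p: "p \<noteq> 0" and q: "q \<in> Qset p"
    and z: "z \<in> resolvent_set (euler_dom p \<Gamma>) (euler_L p \<Gamma>)" and f: "f \<in> ell2"
  shows "on_line p q (resolvent (euler_dom p \<Gamma>) (euler_L p \<Gamma>) z f)
    = resolvent ell2 (euler_Lq p \<Gamma> q) z (on_line p q f)"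
proof -
  define g where "g = resolvent (euler_dom p \<Gamma>) (euler_L p \<Gamma>) z f"
  have "g \<in> euler_dom p \<Gamma>" "pencil (euler_L p \<Gamma>) z g = f"
    unfolding g_def by (rule resolvent_in[OF z f], rule pencil_resolvent[OF z f])
  then have g: "g \<in> ell2" "pencil (euler_Lq p \<Gamma> q) z (on_line p q g) = on_line p q f"
    using on_line_pencil[OF p, of g q \<Gamma> z] by (auto simp: euler_dom_def)
  show ?thesis
    using resolvent_unique[OF resolvent_set_euler_LD[OF p q z] on_line_ell2[OF p g(1)] g(2)]
    by (simp add: g_def)
qed

lemma extend_line_span:
  assumes "x \<in> cfun.span B"
  shows "extend_line p q x \<in> cfun.span (extend_line p q ` B)"
proof -
  have add: "extend_line p q (x + y) = extend_line p q x + extend_line p q y"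
    and scale: "extend_line p q (cscale c x) = cscale c (extend_line p q x)"
    and zero: "extend_line p q 0 = 0" for x y c
    by (auto simp: extend_line_def assemble_def cscale_def fun_eq_iff)
  have "cfun.span B \<subseteq> {x. extend_line p q x \<in> cfun.span (extend_line p q ` B)}"
  proof (rule cfun.span_minimal)
    show "cfun.subspace {x. extend_line p q x \<in> cfun.span (extend_line p q ` B)}"
      unfolding cfun.subspace_def
      by (auto simp: add scale zero intro: cfun.span_add cfun.span_scale cfun.span_zero)
  qed (auto intro: cfun.span_base)
  then show ?thesis using assms by blast
qed

text \<open>The Riesz projection acts line by line, and only the finitely many lines with
  \<parallel>q\<parallel> \<le> \<parallel>p\<parallel> contribute, each with finite rank.\<close>

lemma spectrum_euler_L_off_axis:
  assumes p: "p \<noteq> 0" and z: "Re z \<noteq> 0"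
  obtains r where "0 < r" "cball z r \<inter> spectrum (euler_dom p \<Gamma>) (euler_L p \<Gamma>) \<subseteq> {z}"
    "finite_dim (riesz_projection (euler_dom p \<Gamma>) (euler_L p \<Gamma>) z r ` ell2)"
    "z \<in> spectrum (euler_dom p \<Gamma>) (euler_L p \<Gamma>) \<Longrightarrow> z \<in> point_spectrum (euler_dom p \<Gamma>) (euler_L p \<Gamma>)"
proof -
  define D where "D = euler_dom p \<Gamma>"
  define L where "L = euler_L p \<Gamma>"
  define F where "F = {q \<in> Qset p. znorm q \<le> znorm p}"
  have F: "finite F" unfolding F_def by (rule finite_subset[OF _ finite_znorm_le]) auto
  have "\<forall>q\<in>F. \<exists>r>0. cball z r \<inter> spectrum ell2 (euler_Lq p \<Gamma> q) \<subseteq> {z} \<and>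
      (\<forall>r'. 0 < r' \<and> r' \<le> r \<longrightarrow> finite_dim (riesz_projection ell2 (euler_Lq p \<Gamma> q) z r' ` ell2)) \<and>
      (z \<in> spectrum ell2 (euler_Lq p \<Gamma> q) \<longrightarrow> z \<in> point_spectrum ell2 (euler_Lq p \<Gamma> q))"
    using euler_Lq_discrete[OF p] z by (auto simp: F_def gap_pos_iff)
  then obtain \<rho> where \<rho>: "\<And>q. q \<in> F \<Longrightarrow> 0 < \<rho> q"
    "\<And>q. q \<in> F \<Longrightarrow> cball z (\<rho> q) \<inter> spectrum ell2 (euler_Lq p \<Gamma> q) \<subseteq> {z}"
    "\<And>q r. q \<in> F \<Longrightarrow> 0 < r \<Longrightarrow> r \<le> \<rho> q \<Longrightarrow> finite_dim (riesz_projection ell2 (euler_Lq p \<Gamma> q) z r ` ell2)"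
    "\<And>q. q \<in> F \<Longrightarrow> z \<in> spectrum ell2 (euler_Lq p \<Gamma> q) \<Longrightarrow> z \<in> point_spectrum ell2 (euler_Lq p \<Gamma> q)"
    by metis
  \<comment> \<open>Half of \<bar>Re z\<bar> keeps the closed disc away from the imaginary axis; the
    radii \<rho> isolate \<open>z\<close> in the finitely many relevant components.\<close>
  define r where "r = Min (insert (\<bar>Re z\<bar> / 2) (\<rho> ` F))"
  have r: "0 < r" "r \<le> \<bar>Re z\<bar> / 2" "\<And>q. q \<in> F \<Longrightarrow> r \<le> \<rho> q"
  proof -
    have fin: "finite (insert (\<bar>Re z\<bar> / 2) (\<rho> ` F))" using F by simp
    show "0 < r" using Min_in[OF fin] z \<rho>(1) unfolding r_def by auto
    show "r \<le> \<bar>Re z\<bar> / 2" "\<And>q. q \<in> F \<Longrightarrow> r \<le> \<rho> q"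
      unfolding r_def by (intro Min_le fin; simp)+
  qed
  have axis: "Re w \<noteq> 0" if "dist z w < \<bar>Re z\<bar>" for w
    using abs_Re_le_cmod[of "z - w"] that by (auto simp: dist_norm)
  have off: "w \<in> resolvent_set D L" if w: "w \<in> cball z r" "w \<noteq> z" for w
    unfolding D_def L_def
  proof (rule resolvent_set_euler_L_off_axis[OF p])
    show "Re w \<noteq> 0" using w(1) r(2) z by (intro axis) auto
    fix q assume "q \<in> Qset p" "znorm q \<le> znorm p"
    then have q: "q \<in> F" by (simp add: F_def)
    have "w \<in> cball z (\<rho> q)" using w(1) r(3)[OF q] by auto
    then show "w \<in> resolvent_set ell2 (euler_Lq p \<Gamma> q)"
      using \<rho>(2)[OF q] w(2) by (auto simp: spectrum_def)
  qed
  show ?thesis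
  proof (rule that[OF r(1), folded D_def L_def])
    show "cball z r \<inter> spectrum D L \<subseteq> {z}" using off unfolding spectrum_def by blast
  next
    assume "z \<in> spectrum D L"
    then have "\<not> (\<forall>q\<in>F. z \<in> resolvent_set ell2 (euler_Lq p \<Gamma> q))"
      using resolvent_set_euler_L_off_axis[OF p z, of \<Gamma>] by (auto simp: spectrum_def D_def L_def F_def)
    then obtain q where q: "q \<in> F" "z \<in> spectrum ell2 (euler_Lq p \<Gamma> q)" by (auto simp: spectrum_def)
    then have "q \<in> Qset p" by (simp add: F_def)
    then show "z \<in> point_spectrum D L"
      unfolding D_def L_def by (rule point_spectrum_euler_Lq_extend[OF p _ \<rho>(4)[OF q]])
  next
    have "\<forall>q\<in>F. \<exists>B. finite B \<and> riesz_projection ell2 (euler_Lq p \<Gamma> q) z r ` ell2 \<subseteq> cfun.span B"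
      using \<rho>(3)[OF _ r(1) r(3)] unfolding finite_dim_def by blast
    then obtain B where B: "\<And>q. q \<in> F \<Longrightarrow> finite (B q)"
      "\<And>q. q \<in> F \<Longrightarrow> riesz_projection ell2 (euler_Lq p \<Gamma> q) z r ` ell2 \<subseteq> cfun.span (B q)"
      by metis
    define V where "V = (\<Union>q\<in>F. extend_line p q ` B q)"
    have "riesz_projection D L z r f \<in> cfun.span V" if f: "f \<in> ell2" for f
    proof -
      define P where "P q = riesz_projection ell2 (euler_Lq p \<Gamma> q) z r (on_line p q f)" for q
      have P: "on_line p q (riesz_projection D L z r f) = P q" if q: "q \<in> Qset p" for q
      proof
        fix n
        have "contour_integral (circlepath z r) (\<lambda>w. resolvent D L w f (line_pt p q n))
            = contour_integral (circlepath z r) (\<lambda>w. resolvent ell2 (euler_Lq p \<Gamma> q) w (on_line p q f) n)"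
        proof (rule contour_integral_eq)
          fix w assume "w \<in> path_image (circlepath z r)"
          then have w: "w \<in> cball z r" "w \<noteq> z" using r(1) by auto
          show "resolvent D L w f (line_pt p q n) = resolvent ell2 (euler_Lq p \<Gamma> q) w (on_line p q f) n"
            using fun_cong[OF on_line_resolvent[OF p q off[OF w, unfolded D_def L_def] f], of n]
            by (simp add: on_line_def D_def L_def)
        qed
        then show "on_line p q (riesz_projection D L z r f) n = P q n"
          by (simp add: on_line_def riesz_projection_def P_def)
      qed
      \<comment> \<open>On these lines the resolvent is holomorphic off the axis, so the integral
        vanishes by Cauchy's theorem.\<close>
      have P0: "P q = 0" if q: "q \<in> Qset p" "q \<notin> F" for q
      proof
        fix n
        have pq: "znorm p < znorm q" using q by (simp add: F_def)
        have "(\<lambda>w. resolvent ell2 (euler_Lq p \<Gamma> q) w (on_line p q f) n) holomorphic_on ball z \<bar>Re z\<bar>"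
          by (rule holomorphic_on_subset[OF euler_Lq_resolvent_holomorphic[OF p q(1) pq on_line_ell2[OF p f]]])
            (use axis in auto)
        then have "((\<lambda>w. resolvent ell2 (euler_Lq p \<Gamma> q) w (on_line p q f) n) has_contour_integral 0)
            (circlepath z r)"
          by (rule Cauchy_theorem_disc_simple) (use r(1,2) z in \<open>auto simp: dist_norm\<close>)
        then show "P q n = 0 n"
          by (simp add: P_def riesz_projection_def contour_integral_unique)
      qed
      have "riesz_projection D L z r f = (\<Sum>q\<in>F. extend_line p q (P q))"
      proof (rule on_line_eqI[OF p])
        fix q assume q: "q \<in> Qset p"
        have "on_line p q (\<Sum>q'\<in>F. extend_line p q' (P q')) = (\<Sum>q'\<in>F. on_line p q (extend_line p q' (P q')))"
          by (simp add: on_line_def fun_eq_iff sum_fun_apply)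
        also have "\<dots> = (\<Sum>q'\<in>F. if q = q' then P q' else 0)"
          by (simp add: on_line_extend_line[OF p q])
        also have "\<dots> = P q" using F P0[OF q] by (simp add: sum.delta)
        finally show "on_line p q (riesz_projection D L z r f) = on_line p q (\<Sum>q\<in>F. extend_line p q (P q))"
          using P[OF q] by simp
      qed
      also have "\<dots> \<in> cfun.span V"
      proof (rule cfun.span_sum)
        fix q assume q: "q \<in> F"
        have "P q \<in> cfun.span (B q)"
          using B(2)[OF q] on_line_ell2[OF p f] unfolding P_def by blast
        then have "extend_line p q (P q) \<in> cfun.span (extend_line p q ` B q)" by (rule extend_line_span)
        moreover have "cfun.span (extend_line p q ` B q) \<subseteq> cfun.span V"
          using q by (intro cfun.span_mono) (auto simp: V_def)
        ultimately show "extend_line p q (P q) \<in> cfun.span V" by blast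
      qed
      finally show ?thesis .
    qed
    then show "finite_dim (riesz_projection D L z r ` ell2)"
      unfolding finite_dim_def using F B(1) by (intro exI[of _ V]) (auto simp: V_def)
  qed
qed

text \<open>Each point of the axis lies in a segment of positive length contained in the spectrum,
  so it is not isolated; off the axis all spectral points are discrete.\<close>

lemma ess_spectrum_euler_L:
  assumes p: "p \<noteq> 0" and \<Gamma>: "\<Gamma> \<noteq> 0"
  shows "ess_spectrum (euler_dom p \<Gamma>) (euler_L p \<Gamma>) = {z. Re z = 0}"
proof -
  define D where "D = euler_dom p \<Gamma>"
  define L where "L = euler_L p \<Gamma>"
  have "z \<in> ess_spectrum D L" if z: "Re z = 0" for z
  proof -
    obtain q where q: "q \<in> Qset p" "0 < cmod (betaq p \<Gamma> q)" "z \<in> - {z. gap (cmod (betaq p \<Gamma> q)) z > 0}"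
      using imaginary_axis_in_segment[OF p \<Gamma> z] .
    have sub: "- {z. gap (cmod (betaq p \<Gamma> q)) z > 0} \<subseteq> spectrum D L"
      using segment_subset_spectrum_euler_Lq[OF p q(1)] q(1)
      unfolding D_def L_def spectrum_euler_L[OF p \<Gamma>] by blast
    have "z islimpt spectrum D L" by (rule islimpt_subset[OF islimpt_segment[OF q(2,3)] sub])
    then have "z \<notin> discrete_spectrum D L" using discrete_spectrum_isolated by blast
    then show ?thesis using sub q(3) by (auto simp: ess_spectrum_def)
  qed
  moreover have "z \<in> discrete_spectrum D L" if z: "z \<in> spectrum D L" "Re z \<noteq> 0" for z
  proof -
    obtain r where r: "0 < r" "cball z r \<inter> spectrum D L \<subseteq> {z}"
      "finite_dim (riesz_projection D L z r ` ell2)" "z \<in> spectrum D L \<Longrightarrow> z \<in> point_spectrum D L"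
      using spectrum_euler_L_off_axis[OF p z(2), of \<Gamma>] unfolding D_def L_def by metis
    then have "spectrum D L \<inter> cball z r = {z}" using z(1) by auto
    then show ?thesis unfolding discrete_spectrum_def using r z(1) by auto
  qed
  ultimately show ?thesis
    unfolding D_def[symmetric] L_def[symmetric] by (auto simp: ess_spectrum_def)
qed

theorem theorem3:
  fixes p :: "int \<times> int" and \<Gamma> :: complex
  assumes "p \<noteq> 0" and "\<Gamma> \<noteq> 0"
  shows
    "(\<forall>q\<in>Qset p.
        ess_spectrum ell2 (euler_Lq p \<Gamma> q) = spectrum ell2 (const_op (betaq p \<Gamma> q)) \<and>
        spectrum ell2 (const_op (betaq p \<Gamma> q)) =
          (\<lambda>t. \<i> * complex_of_real t) ` {- 2 * cmod (betaq p \<Gamma> q) .. 2 * cmod (betaq p \<Gamma> q)})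
     \<and> spectrum (euler_dom p \<Gamma>) (euler_L p \<Gamma>) = (\<Union>q\<in>Qset p. spectrum ell2 (euler_Lq p \<Gamma> q))
     \<and> ess_spectrum (euler_dom p \<Gamma>) (euler_L p \<Gamma>) = {z. Re z = 0}
     \<and> point_spectrum (euler_dom p \<Gamma>) (euler_L p \<Gamma>) - {z. Re z = 0} =
         (\<Union>q\<in>{q \<in> Qset p. znorm q \<le> znorm p}.
            point_spectrum ell2 (euler_Lq p \<Gamma> q) - {z. Re z = 0})
     \<and> bounded (point_spectrum (euler_dom p \<Gamma>) (euler_L p \<Gamma>) - {z. Re z = 0})
     \<and> (\<forall>z. z islimpt (point_spectrum (euler_dom p \<Gamma>) (euler_L p \<Gamma>) - {z. Re z = 0})
            \<longrightarrow> Re z = 0)"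
proof (intro conjI ballI allI impI)
  fix q assume q: "q \<in> Qset p"
  show "ess_spectrum ell2 (euler_Lq p \<Gamma> q) = spectrum ell2 (const_op (betaq p \<Gamma> q))"
    unfolding ess_spectrum_euler_Lq[OF assms(1) q] spectrum_const_op ..
  show "spectrum ell2 (const_op (betaq p \<Gamma> q)) =
      (\<lambda>t. \<i> * complex_of_real t) ` {- 2 * cmod (betaq p \<Gamma> q) .. 2 * cmod (betaq p \<Gamma> q)}"
    by (simp only: spectrum_const_op segment_eq_gap norm_ge_zero)
next
  \<comment> \<open>Only finitely many components contribute, each with bounded point
    spectrum.\<close>
  have "finite {q \<in> Qset p. znorm q \<le> znorm p}"
    by (rule finite_subset[OF _ finite_znorm_le]) auto
  then show "bounded (point_spectrum (euler_dom p \<Gamma>) (euler_L p \<Gamma>) - {z. Re z = 0})"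
    unfolding point_spectrum_euler_L[OF assms(1)]
    by (intro bounded_UN ballI bounded_diff bounded_point_spectrum_euler_Lq[OF assms(1)]) auto
next
  fix z assume lim: "z islimpt (point_spectrum (euler_dom p \<Gamma>) (euler_L p \<Gamma>) - {z. Re z = 0})"
  show "Re z = 0"
  proof (rule ccontr)
    assume "Re z \<noteq> 0"
    \<comment> \<open>Off the axis a small disc meets the spectrum at most in its centre, so
      eigenvalues cannot accumulate there.\<close>
    then obtain r where r: "0 < r" "cball z r \<inter> spectrum (euler_dom p \<Gamma>) (euler_L p \<Gamma>) \<subseteq> {z}"
      using spectrum_euler_L_off_axis[OF assms(1), of z \<Gamma>] by metis
    obtain w where w: "w \<in> point_spectrum (euler_dom p \<Gamma>) (euler_L p \<Gamma>) - {z. Re z = 0}"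
      "w \<noteq> z" "dist w z < r"
      using lim r(1) unfolding islimpt_approachable by blast
    have "0 \<in> euler_dom p \<Gamma>" "euler_L p \<Gamma> 0 = 0"
      by (simp_all add: euler_dom_def euler_L_def zero_fun_def)
    then have "w \<in> spectrum (euler_dom p \<Gamma>) (euler_L p \<Gamma>)"
      using point_spectrum_subset[of "euler_dom p \<Gamma>" "euler_L p \<Gamma>"] w(1) by blast
    moreover have "w \<in> cball z r" using w(3) by (simp add: dist_commute)
    ultimately show False using r(2) w(2) by blast
  qed
qed (use spectrum_euler_L[OF assms] ess_spectrum_euler_L[OF assms] point_spectrum_euler_L[OF assms(1)] in auto)

end
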